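(* Let $\mathbb{X},\mathbb{Y}$ be finite dimensional real inner product spaces, $f:\mathbb{X}\to(-\infty,\infty]$ and $g:\mathbb{Y}\to(-\infty,\infty]$ be proper, lower semicontinuous and bounded below, $H:\mathbb{X}\times\mathbb{Y}\to\mathbb{R}$ be a smooth function such that $\nabla_xH(\cdot,y)$ is $L_1(y)$-Lipschitz for each $y$ and $\nabla_yH(x,\cdot)$ is $L_2(x)$-Lipschitz for each $x$, and let $\Psi(x,y):=f(x)+g(y)+H(x,y)$ be coercive and bounded below. Suppose that $\Psi$ is a KL function. Let $\{(x^k,y^k)\}_{k\in\mathbb{N}}$ be the sequence generated by the PALMenls algorithm (described in the context) with $\delta\in(0,1)$, and let $z^k:=(x^k,y^k,x^{k-1},y^{k-1})$. Then the following statements hold. (i) Let $K_1:=\big\{k\in\mathbb{N}\,|\,\Upsilon_\delta(z^{\ell(k+1)})-\Upsilon_\delta(z^{k+1})\ge\frac{\alpha}{4}\|z^{k+1}-z^k\|^2\big\}$. If $$\sum_{k\in K_1}\sqrt{\Upsilon_\delta(z^{\ell(k+1)})-\Upsilon_\delta(z^{k+1})}<\infty\quad\text{whenever}\quad\liminf_{K_1\ni k\to\infty}\frac{\Upsilon_\delta(z^{\ell(k)})-\Upsilon_\delta(z^{\ell(k+1)})}{\|z^{k+1}-z^k\|^2}=0,$$ then $\sum_{k=1}^\infty\|z^k-z^{k-1}\|<\infty$. (ii) Suppose that $\Psi$ is a KL function of exponent $\theta\in[1/2,1)$. Let $\omega^*:=\lim_{k\to\infty}\Upsilon_\delta(z^k)$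 (this limit exists), $$K_2:=\big\{k\in\mathbb{N}\,|\,\tfrac{\alpha}{4}\|z^{k+1}-z^k\|^2\le\Upsilon_\delta(z^{\ell(k+1)})-\Upsilon_\delta(z^{k+1})<\tfrac{\alpha}{4}\|z^{k+1}-z^k\|^{\frac1\theta}\big\},$$ $$K_{31}:=\big\{k\in K_1\setminus K_2\,|\,\omega^*-\Upsilon_\delta(z^{k+1})>\tfrac{\alpha}{8}\|z^{k+1}-z^k\|^{\frac1\theta}\big\},$$ and suppose that there exist $\widetilde{k}_0\in\mathbb{N}$, $\widetilde{\gamma}>0$ and $\widetilde{\tau}\in(0,1)$ such that for all $k\ge\widetilde{k}_0$, $$\sum_{j\in K_2\cup K_{31},\,j\ge k}\sqrt{\Upsilon_\delta(z^{\ell(j+1)})-\Upsilon_\delta(z^{j+1})}\le\begin{cases}\widetilde{\gamma}\,\widetilde{\tau}^k&\text{if }\theta=1/2,\\ \widetilde{\gamma}\,k^{\frac{1-\theta}{1-2\theta}}&\text{if }\theta\in(1/2,1).\end{cases}$$ Then $\{z^k\}_{k\in\mathbb{N}}$ converges to some $\widetilde{z}\in\mathrm{crit}\,\Upsilon_\delta$ and there exist $\overline{k}\in\mathbb{N}$, $\gamma>0$ and $\varrho\in(0,1)$ such that for all $k\ge\overline{k}$ $$\|z^k-\widetilde{z}\|\le\sum_{j=k}^\infty\|z^{j+1}-z^j\|\le\begin{cases}\gamma\varrho^k&\text{if }\theta=1/2,\\ \gamma k^{\frac{1-\theta}{1-2\theta}}&\text{if }\theta\in(1/2,1).\end{cases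}$$
   Context: $\partial$ is the limiting (Mordukhovich) subdifferential and $\mathrm{crit}\,h:=\{x\,|\,0\in\partial h(x)\}$. For $\tau>0$, $\mathcal{P}_\tau h(x):=\arg\min_{z}\{\frac{1}{2\tau}\|z-x\|^2+h(z)\}$. For $\delta>0$ and $z=(x,y,u,v)\in\mathbb{X}\times\mathbb{Y}\times\mathbb{X}\times\mathbb{Y}$, $\Upsilon_\delta(z):=f(x)+g(y)+H(x,y)+\frac{\delta}{2}\|x-u\|^2+\frac{\delta}{2}\|y-v\|^2$. Products carry the product Euclidean norm. $[t]_+:=\max(0,t)$. KL: for $\eta\in(0,\infty]$, let $\Upsilon_\eta^{\mathrm{KL}}$ be the family of continuous concave $\varphi:[0,\eta)\to\mathbb{R}_+$ that are $C^1$ on $(0,\eta)$ with $\varphi'>0$ there and $\varphi(0)=0$. A proper lsc $h$ has the KL property at $\overline{x}\in\mathrm{dom}\,\partial h$ if there exist $\eta\in(0,\infty]$, a neighborhood $\mathcal{U}$ of $\overline{x}$ and $\varphi\in\Upsilon_\eta^{\mathrm{KL}}$ with $\varphi'(h(x)-h(\overline{x}))\,\mathrm{dist}(0,\partial h(x))\ge1$ for all $x\in\mathcal{U}$ with $h(\overline{x})<h(x)<h(\overline{x})+\eta$; it has the KL property of exponent $\theta\in[0,1)$ at $\overline{x}$ if $\varphi$ can be chosen as $\varphi(t)=ct^{1-\theta}$ for some $c>0$. $h$ is a KL function (of exponent $\theta$) if this holds at every point of $\mathrm{dom}\,\partial h$. PALMenls algorithm (nonmonotone line search PALM with extrapolation).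 Choose an integer $m\ge0$ and $(x^0,y^0)\in\mathrm{dom}\,\Psi$; let $\mathcal{L}_0:=\{(x,y)\,|\,\Psi(x,y)\le\Psi(x^0,y^0)\}$ (compact) and $L:=\max_{(x,y)\in\mathcal{L}_0}\max(L_1(y),L_2(x))$. Parameters: $\delta\in(0,1)$, $\alpha\in(0,\delta/2]$, $0<\underline{\tau}<\frac{1}{L+\delta+2\alpha}<\overline{\tau}$, $\beta_{\max}\ge0$, $\eta,\eta_1,\eta_2\in(0,1)$. Set $(x^{-1},y^{-1})=(x^0,y^0)$, $z^0=(x^0,y^0,x^{-1},y^{-1})$. Iteration $k=0,1,2,\ldots$ (run indefinitely): choose any $\beta_{k,0}\in[0,\beta_{\max}]$, $\tau_{1,k}^0,\tau_{2,k}^0\in[\underline{\tau},\overline{\tau}]$; for $l=0,1,2,\ldots$ set $\beta_k=\beta_{k,0}\eta^l$, $\tau_{1,k}=\max\{\tau_{1,k}^0\eta_1^l,\underline{\tau}\}$, $\tau_{2,k}=\max\{\tau_{2,k}^0\eta_2^l,\underline{\tau}\}$, $\widetilde{x}^k=x^k+\beta_k(x^k-x^{k-1})$, pick $x^{k+1}\in\mathcal{P}_{\tau_{1,k}}f(\widetilde{x}^k-\tau_{1,k}\nabla_xH(\widetilde{x}^k,y^k))$, $\widetilde{y}^k=y^k+\beta_k(y^k-y^{k-1})$, pick $y^{k+1}\in\mathcal{P}_{\tau_{2,k}}g(\widetilde{y}^k-\tau_{2,k}\nabla_yH(x^{k+1},\widetilde{y}^k))$, $z^{k+1}=(x^{k+1},y^{k+1},x^k,y^k)$,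 and stop the inner loop (accepting the point) as soon as $\Upsilon_\delta(z^{k+1})\le\max_{j=[k-m]_+,\ldots,k}\Upsilon_\delta(z^j)-\frac{\alpha}{2}\|z^{k+1}-z^k\|^2$. Standing conventions: with $B_1,B_2$ balls centered at the origin containing $\{(1+2\beta_{\max})x^k\}_k$ and $\{(1+2\beta_{\max})y^k\}_k$ respectively, the quantities $L$, $M:=\sup_{x\ne x'\in B_1,\,y\ne y'\in B_2}\frac{\|\nabla_xH(x,y)-\nabla_xH(x',y')\|}{\|(x,y)-(x',y')\|}$ and $\overline{L}_2:=\sup_{x\in B_1}L_2(x)$ are finite. $\ell(k)$ denotes the largest index in $\arg\max_{j=[k-m]_+,\ldots,k}\Upsilon_\delta(z^j)$. The quotient with denominator $\|z^{k+1}-z^k\|^2$ is read as $+\infty$ when $z^{k+1}=z^k$, and a liminf over a finite index set is $+\infty$. *)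

theory Defs
  imports "HOL-Analysis.Analysis"
begin

text \<open>Extended-valued functions.\<close>

definition edom :: "('a \<Rightarrow> ereal) \<Rightarrow> 'a set" where
  "edom h = {x. h x < \<infinity>}"

definition proper :: "('a \<Rightarrow> ereal) \<Rightarrow> bool" where
  "proper h \<longleftrightarrow> (\<forall>x. h x \<noteq> -\<infinity>) \<and> edom h \<noteq> {}"

definition lsc :: "('a::topological_space \<Rightarrow> ereal) \<Rightarrow> bool" where
  "lsc h \<longleftrightarrow> (\<forall>x. h x \<le> Liminf (nhds x) h)"

definition bounded_below :: "('a \<Rightarrow> ereal) \<Rightarrow> bool" where
  "bounded_below h \<longleftrightarrow> (\<exists>c::real. \<forall>x. ereal c \<le> h x)"

definition coercive :: "('a::real_normed_vector \<Rightarrow> ereal) \<Rightarrow> bool" where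
  "coercive h \<longleftrightarrow> (h \<longlongrightarrow> \<infinity>) at_infinity"

definition regular_subdiff :: "('a::real_inner \<Rightarrow> ereal) \<Rightarrow> 'a \<Rightarrow> 'a set" where
  "regular_subdiff h x = {v. x \<in> edom h \<and>
     0 \<le> Liminf (at x) (\<lambda>x'. (h x' - h x - ereal (v \<bullet> (x' - x))) / ereal (norm (x' - x)))}"

text \<open>The limiting (Mordukhovich) subdifferential; empty outside the domain.\<close>

definition subdiff :: "('a::real_inner \<Rightarrow> ereal) \<Rightarrow> 'a \<Rightarrow> 'a set" where
  "subdiff h x = {v. x \<in> edom h \<and>
     (\<exists>X V. X \<longlonglongrightarrow> x \<and> (\<lambda>n. h (X n)) \<longlonglongrightarrow> h x \<and>
            (\<forall>n. V n \<in> regular_subdiff h (X n)) \<and> V \<longlonglongrightarrow> v)}"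

definition dom_subdiff :: "('a::real_inner \<Rightarrow> ereal) \<Rightarrow> 'a set" where
  "dom_subdiff h = {x. subdiff h x \<noteq> {}}"

definition crit :: "('a::real_inner \<Rightarrow> ereal) \<Rightarrow> 'a set" where
  "crit h = {x. 0 \<in> subdiff h x}"

definition prox :: "real \<Rightarrow> ('a::real_inner \<Rightarrow> ereal) \<Rightarrow> 'a \<Rightarrow> 'a set" where
  "prox \<tau> h x = {z. is_arg_min (\<lambda>w. ereal (1 / (2 * \<tau>) * (norm (w - x))\<^sup>2) + h w) (\<lambda>_. True) z}"

definition gradient :: "('a::real_inner \<Rightarrow> real) \<Rightarrow> 'a \<Rightarrow> 'a" where
  "gradient h x = (THE D. GDERIV h x :> D)"

text \<open>Smooth is read as continuously differentiable.\<close>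

definition smooth :: "('a::real_inner \<Rightarrow> real) \<Rightarrow> bool" where
  "smooth h \<longleftrightarrow> (\<exists>G. (\<forall>x. GDERIV h x :> G x) \<and> continuous_on UNIV G)"

definition grad_x :: "('a::real_inner \<times> 'b::real_inner \<Rightarrow> real) \<Rightarrow> 'a \<Rightarrow> 'b \<Rightarrow> 'a" where
  "grad_x H x y = gradient (\<lambda>x'. H (x', y)) x"

definition grad_y :: "('a::real_inner \<times> 'b::real_inner \<Rightarrow> real) \<Rightarrow> 'a \<Rightarrow> 'b \<Rightarrow> 'b" where
  "grad_y H x y = gradient (\<lambda>y'. H (x, y')) y"

text \<open>The distance from a point to a set is \<^term>\<open>\<infinity>\<close> for the empty set; this is why
  \<^const>\<open>infdist\<close>, which is 0 there, is not used in the Kurdyka--Lojasiewicz inequality.\<close>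

definition edist_set :: "'a::metric_space \<Rightarrow> 'a set \<Rightarrow> ereal" where
  "edist_set x S = (INF s\<in>S. ereal (dist x s))"

definition KL_family :: "ereal \<Rightarrow> (real \<Rightarrow> real) set" where
  "KL_family \<eta> = {\<phi>. continuous_on {t. 0 \<le> t \<and> ereal t < \<eta>} \<phi> \<and>
     concave_on {t. 0 \<le> t \<and> ereal t < \<eta>} \<phi> \<and>
     (\<forall>t. 0 \<le> t \<and> ereal t < \<eta> \<longrightarrow> 0 \<le> \<phi> t) \<and>
     \<phi> C1_differentiable_on {t. 0 < t \<and> ereal t < \<eta>} \<and>
     (\<forall>t. 0 < t \<and> ereal t < \<eta> \<longrightarrow> 0 < deriv \<phi> t) \<and>
     \<phi> 0 = 0}"

definition KL_with :: "('a::real_inner \<Rightarrow> ereal) \<Rightarrow> 'a \<Rightarrow> (real \<Rightarrow> real) \<Rightarrow> bool" where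
  "KL_with h xb \<phi> \<longleftrightarrow> (\<exists>\<eta> U. 0 < \<eta> \<and> open U \<and> xb \<in> U \<and> \<phi> \<in> KL_family \<eta> \<and>
     (\<forall>x\<in>U. h xb < h x \<and> h x < h xb + \<eta> \<longrightarrow>
        1 \<le> ereal (deriv \<phi> (real_of_ereal (h x - h xb))) * edist_set 0 (subdiff h x)))"

definition KL_function :: "('a::real_inner \<Rightarrow> ereal) \<Rightarrow> bool" where
  "KL_function h \<longleftrightarrow> (\<forall>xb\<in>dom_subdiff h. \<exists>\<phi>. KL_with h xb \<phi>)"

definition KL_function_exponent :: "real \<Rightarrow> ('a::real_inner \<Rightarrow> ereal) \<Rightarrow> bool" where
  "KL_function_exponent \<theta> h \<longleftrightarrow>
     (\<forall>xb\<in>dom_subdiff h. \<exists>c>0. KL_with h xb (\<lambda>t. c * t powr (1 - \<theta>)))"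

definition Psi :: "('a \<Rightarrow> ereal) \<Rightarrow> ('b \<Rightarrow> ereal) \<Rightarrow> ('a \<times> 'b \<Rightarrow> real) \<Rightarrow> 'a \<times> 'b \<Rightarrow> ereal" where
  "Psi f g H = (\<lambda>(x, y). f x + g y + ereal (H (x, y)))"

definition Upsilon :: "('a::real_inner \<Rightarrow> ereal) \<Rightarrow> ('b::real_inner \<Rightarrow> ereal) \<Rightarrow> ('a \<times> 'b \<Rightarrow> real)
    \<Rightarrow> real \<Rightarrow> 'a \<times> 'b \<times> 'a \<times> 'b \<Rightarrow> ereal" where
  "Upsilon f g H \<delta> = (\<lambda>(x, y, u, v). f x + g y + ereal (H (x, y))
     + ereal (\<delta> / 2 * (norm (x - u))\<^sup>2) + ereal (\<delta> / 2 * (norm (y - v))\<^sup>2))"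

definition level_set0 :: "('a \<Rightarrow> ereal) \<Rightarrow> ('b \<Rightarrow> ereal) \<Rightarrow> ('a \<times> 'b \<Rightarrow> real) \<Rightarrow> 'a \<Rightarrow> 'b \<Rightarrow> ('a \<times> 'b) set" where
  "level_set0 f g H x0 y0 = {p. Psi f g H p \<le> Psi f g H (x0, y0)}"

text \<open>In the indices below, truncated subtraction on \<^typ>\<open>nat\<close> does exactly what is wanted:
  \<^term>\<open>x (k - 1)\<close> at \<^term>\<open>k = 0\<close> is \<^term>\<open>x 0\<close> (the convention $x^{-1} = x^0$), and
  \<^term>\<open>k - m\<close> is the positive part $[k-m]_+$.\<close>

definition palm_z :: "(nat \<Rightarrow> 'a) \<Rightarrow> (nat \<Rightarrow> 'b) \<Rightarrow> nat \<Rightarrow> 'a \<times> 'b \<times> 'a \<times> 'b" where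
  "palm_z x y k = (x k, y k, x (k - 1), y (k - 1))"

definition palm_trial :: "('a::real_inner \<Rightarrow> ereal) \<Rightarrow> ('b::real_inner \<Rightarrow> ereal) \<Rightarrow> ('a \<times> 'b \<Rightarrow> real)
    \<Rightarrow> (nat \<Rightarrow> 'a) \<Rightarrow> (nat \<Rightarrow> 'b) \<Rightarrow> nat \<Rightarrow> real \<Rightarrow> real \<Rightarrow> real \<Rightarrow> 'a \<Rightarrow> 'b \<Rightarrow> bool" where
  "palm_trial f g H x y k \<beta> \<tau>1 \<tau>2 xn yn \<longleftrightarrow>
     (let xt = x k + \<beta> *\<^sub>R (x k - x (k - 1));
          yt = y k + \<beta> *\<^sub>R (y k - y (k - 1))
      in xn \<in> prox \<tau>1 f (xt - \<tau>1 *\<^sub>R grad_x H xt (y k)) \<and>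
         yn \<in> prox \<tau>2 g (yt - \<tau>2 *\<^sub>R grad_y H xn yt))"

definition palm_accept :: "('a::real_inner \<Rightarrow> ereal) \<Rightarrow> ('b::real_inner \<Rightarrow> ereal) \<Rightarrow> ('a \<times> 'b \<Rightarrow> real)
    \<Rightarrow> real \<Rightarrow> real \<Rightarrow> nat \<Rightarrow> (nat \<Rightarrow> 'a) \<Rightarrow> (nat \<Rightarrow> 'b) \<Rightarrow> nat \<Rightarrow> 'a \<Rightarrow> 'b \<Rightarrow> bool" where
  "palm_accept f g H \<delta> \<alpha> m x y k xn yn \<longleftrightarrow>
     Upsilon f g H \<delta> (xn, yn, x k, y k)
       \<le> Max ((\<lambda>j. Upsilon f g H \<delta> (palm_z x y j)) ` {k - m..k})
          - ereal (\<alpha> / 2 * (norm ((xn, yn, x k, y k) - palm_z x y k))\<^sup>2)"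

text \<open>\<open>X i\<close> and \<open>Y i\<close> are the trial points computed in the inner iteration \<open>i\<close>, which are
  rejected for \<open>i < l\<close> and accepted for \<open>i = l\<close>; all choices left open by the algorithm
  (starting stepsizes, elements of the proximal sets) are existentially quantified.\<close>

definition PALMenls_iteration :: "('a::real_inner \<Rightarrow> ereal) \<Rightarrow> ('b::real_inner \<Rightarrow> ereal)
    \<Rightarrow> ('a \<times> 'b \<Rightarrow> real) \<Rightarrow> real \<Rightarrow> real \<Rightarrow> real \<Rightarrow> real \<Rightarrow> real \<Rightarrow> real \<Rightarrow> real \<Rightarrow> real \<Rightarrow> nat
    \<Rightarrow> (nat \<Rightarrow> 'a) \<Rightarrow> (nat \<Rightarrow> 'b) \<Rightarrow> nat \<Rightarrow> bool" where
  "PALMenls_iteration f g H \<delta> \<alpha> \<tau>lo \<tau>hi \<beta>max \<eta> \<eta>1 \<eta>2 m x y k \<longleftrightarrow>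
     (\<exists>\<beta>0 \<tau>10 \<tau>20 l X Y.
        \<beta>0 \<in> {0..\<beta>max} \<and> \<tau>10 \<in> {\<tau>lo..\<tau>hi} \<and> \<tau>20 \<in> {\<tau>lo..\<tau>hi} \<and>
        (\<forall>i\<le>l. palm_trial f g H x y k (\<beta>0 * \<eta> ^ i) (max (\<tau>10 * \<eta>1 ^ i) \<tau>lo)
                 (max (\<tau>20 * \<eta>2 ^ i) \<tau>lo) (X i) (Y i)) \<and>
        (\<forall>i<l. \<not> palm_accept f g H \<delta> \<alpha> m x y k (X i) (Y i)) \<and>
        palm_accept f g H \<delta> \<alpha> m x y k (X l) (Y l) \<and>
        x (Suc k) = X l \<and> y (Suc k) = Y l)"

definition PALMenls :: "('a::real_inner \<Rightarrow> ereal) \<Rightarrow> ('b::real_inner \<Rightarrow> ereal)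
    \<Rightarrow> ('a \<times> 'b \<Rightarrow> real) \<Rightarrow> real \<Rightarrow> real \<Rightarrow> real \<Rightarrow> real \<Rightarrow> real \<Rightarrow> real \<Rightarrow> real \<Rightarrow> real \<Rightarrow> real \<Rightarrow> nat
    \<Rightarrow> (nat \<Rightarrow> 'a) \<Rightarrow> (nat \<Rightarrow> 'b) \<Rightarrow> bool" where
  "PALMenls f g H L \<delta> \<alpha> \<tau>lo \<tau>hi \<beta>max \<eta> \<eta>1 \<eta>2 m x y \<longleftrightarrow>
     0 < \<delta> \<and> \<delta> < 1 \<and> 0 < \<alpha> \<and> \<alpha> \<le> \<delta> / 2 \<and>
     0 < \<tau>lo \<and> \<tau>lo < 1 / (L + \<delta> + 2 * \<alpha>) \<and> 1 / (L + \<delta> + 2 * \<alpha>) < \<tau>hi \<and>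
     0 \<le> \<beta>max \<and> \<eta> \<in> {0<..<1} \<and> \<eta>1 \<in> {0<..<1} \<and> \<eta>2 \<in> {0<..<1} \<and>
     (x 0, y 0) \<in> edom (Psi f g H) \<and>
     (\<forall>k. PALMenls_iteration f g H \<delta> \<alpha> \<tau>lo \<tau>hi \<beta>max \<eta> \<eta>1 \<eta>2 m x y k)"

text \<open>In the rest, \<open>U k\<close> stands for the (finite) value of \<^const>\<open>Upsilon\<close> at the \<open>k\<close>-th iterate \<open>z k\<close>.\<close>

definition ell :: "nat \<Rightarrow> (nat \<Rightarrow> real) \<Rightarrow> nat \<Rightarrow> nat" where
  "ell m U k = Max {j. is_arg_max U (\<lambda>i. i \<in> {k - m..k}) j}"

definition K1_set :: "nat \<Rightarrow> real \<Rightarrow> (nat \<Rightarrow> real) \<Rightarrow> (nat \<Rightarrow> 'c::real_normed_vector) \<Rightarrow> nat set" where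
  "K1_set m \<alpha> U z = {k. U (ell m U (Suc k)) - U (Suc k) \<ge> \<alpha> / 4 * (norm (z (Suc k) - z k))\<^sup>2}"

definition K2_set :: "nat \<Rightarrow> real \<Rightarrow> real \<Rightarrow> (nat \<Rightarrow> real) \<Rightarrow> (nat \<Rightarrow> 'c::real_normed_vector) \<Rightarrow> nat set" where
  "K2_set m \<alpha> \<theta> U z = {k. \<alpha> / 4 * (norm (z (Suc k) - z k))\<^sup>2 \<le> U (ell m U (Suc k)) - U (Suc k) \<and>
     U (ell m U (Suc k)) - U (Suc k) < \<alpha> / 4 * norm (z (Suc k) - z k) powr (1 / \<theta>)}"

definition K31_set :: "nat \<Rightarrow> real \<Rightarrow> real \<Rightarrow> real \<Rightarrow> (nat \<Rightarrow> real) \<Rightarrow> (nat \<Rightarrow> 'c::real_normed_vector) \<Rightarrow> nat set" where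
  "K31_set m \<alpha> \<theta> \<omega> U z = {k \<in> K1_set m \<alpha> U z - K2_set m \<alpha> \<theta> U z.
     \<omega> - U (Suc k) > \<alpha> / 8 * norm (z (Suc k) - z k) powr (1 / \<theta>)}"

definition decrease_ratio :: "nat \<Rightarrow> (nat \<Rightarrow> real) \<Rightarrow> (nat \<Rightarrow> 'c::real_normed_vector) \<Rightarrow> nat \<Rightarrow> ereal" where
  "decrease_ratio m U z k = (if z (Suc k) = z k then \<infinity>
     else ereal ((U (ell m U k) - U (ell m U (Suc k))) / (norm (z (Suc k) - z k))\<^sup>2))"

end

theory Submission
  imports Defs
begin

text \<open>Write \<open>s k = \<parallel>z (k + 1) - z k\<parallel>\<close> and let \<open>V k\<close> be the gap between the largest of the last
  \<open>m + 1\<close> values of \<open>U\<close> and its limit. The KL inequality at the index \<open>ell m U k\<close> bounds from below the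
  decrease of a concave function of \<open>V\<close>. For \<open>k\<close> outside \<open>K1_set\<close> (and, in the first statement with positive
  liminf, for all large \<open>k\<close>) the decrease of \<open>V\<close> dominates \<open>(s k)\<^sup>2\<close>, so that AM-GM yields
  \<open>s k \<le> \<epsilon> s (ell m U k - 1) + (summable)\<close>, and a window of \<open>m + 1\<close> consecutive steps absorbs the first
  term. For exponent \<open>\<theta>\<close> the KL inequality alone gives \<open>V (k + N) powr (2 * \<theta>) \<le> c * (V k - V (k + N))\<close> with
  \<open>N = m + 1\<close>; this fixes the decay of \<open>V\<close> and makes \<open>V k powr \<theta>\<close> a telescoping quantity, which controls
  all steps outside \<open>K2_set\<close> and \<open>K31_set\<close>.

  The KL property of \<open>Psi\<close> is enough, although it is \<open>Upsilon\<close> that decreases: the additional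
  quadratic term of \<open>Upsilon\<close> has a KL function of exponent 1/2.\<close>

section \<open>Nonmonotone descent sequences\<close>

text \<open>Descent holds only relative to the window maximum \<open>W\<close>, and \<open>U\<close>
  may fall below \<open>W\<close>, even below \<omega>, by an amount that \<open>V\<close> does not
  see. On \<open>K1_set\<close> a step is controlled merely by this deficit
  \<open>W (Suc k) - U (Suc k)\<close>, which is exactly what the assumptions of the theorem sum up.
  At \<open>ell m U k\<close> the deficit vanishes, so the KL inequality there speaks of
  \<open>V k\<close>; the price is that it involves \<open>s (ell m U k - 1)\<close>, one of the
  \<open>m + 1\<close> preceding steps. Several \<open>k\<close> may share the same such step, hence
  the choice \<epsilon> = 1 / (2 * N) when it is absorbed. A second obstacle is that the KL property
  is local while convergence of the iterates is the conclusion. All cluster points have the same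
  value \<omega> of \<open>Psi\<close>, so compactness yields finitely many neighbourhoods with
  desingularizing functions for one common level, and the sum of these functions serves at every
  late iterate.\<close>

lemma ell_props:
  shows ell_in: "ell m U k \<in> {k - m..k}"
    and ell_max: "i \<in> {k - m..k} \<Longrightarrow> (U i :: real) \<le> U (ell m U k)"
proof -
  define S where "S = {j. is_arg_max U (\<lambda>i. i \<in> {k - m..k}) j}"
  have sub: "S \<subseteq> {k - m..k}" by (auto simp: S_def is_arg_max_def)
  obtain j where j: "j \<in> {k - m..k}" "U j = Max (U ` {k - m..k})"
    using Max_in[of "U ` {k - m..k}"] by (metis atLeastAtMost_iff diff_le_self empty_iff
        finite_atLeastAtMost finite_imageI imageE image_is_empty order_refl)
  have "j \<in> S" using j by (auto simp: S_def is_arg_max_def not_less)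
  then have "Max S \<in> S" using sub finite_subset by (intro Max_in) auto
  then have *: "ell m U k \<in> S" by (simp add: ell_def S_def)
  then show "ell m U k \<in> {k - m..k}" using sub by blast
  show "U i \<le> U (ell m U k)" if "i \<in> {k - m..k}"
    using * that by (auto simp: S_def is_arg_max_def not_less)
qed

lemma ell_Max: "U (ell m U k) = Max (U ` {k - m..k})" for U :: "nat \<Rightarrow> real"
  using ell_in[of m U k] ell_max[of _ k m U] by (intro Max_eqI[symmetric]) auto

text \<open>The one-sided \<open>growth\<close> bound is what makes the whole sequence
  \<open>U\<close> converge: descent controls only window maxima, and a value far below them could
  otherwise return to the top of the window by arbitrarily short steps.\<close>

locale nonmonotone_descent =
  fixes m :: nat and \<alpha> :: real and U :: "nat \<Rightarrow> real" and z :: "nat \<Rightarrow> 'c::real_normed_vector"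
  assumes \<alpha>_pos: "0 < \<alpha>"
    and descent: "\<And>k. U (Suc k) \<le> U (ell m U k) - \<alpha> / 2 * (norm (z (Suc k) - z k))\<^sup>2"
    and growth: "\<exists>C. \<forall>k. U (Suc k) \<le> U k + C * norm (z (Suc k) - z k)"
    and bdd_below_U: "bdd_below (range U)"
begin

abbreviation W :: "nat \<Rightarrow> real" where "W k \<equiv> U (ell m U k)"
abbreviation s :: "nat \<Rightarrow> real" where "s k \<equiv> norm (z (Suc k) - z k)"

lemma U_le_W: "U k \<le> W k"
  by (rule ell_max) simp

text \<open>The only new index in the window is \<open>Suc k\<close>, whose value descent keeps
  below \<open>W k\<close>; every other index already belonged to the old window.\<close>

lemma W_Suc_le: "W (Suc k) \<le> W k"
proof (cases "ell m U (Suc k) = Suc k")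
  case True
  have "0 \<le> \<alpha> / 2 * (s k)\<^sup>2" using \<alpha>_pos by simp
  then show ?thesis using True descent[of k] by simp
next
  case False
  then have "ell m U (Suc k) \<in> {k - m..k}" using ell_in[of m U "Suc k"] by auto
  then show ?thesis by (rule ell_max)
qed

lemma decseq_W: "decseq W"
  using W_Suc_le by (simp add: decseq_Suc_iff)

text \<open>\<open>W\<close> is monotone, so its limit is available at once;
  \<open>U_tendsto\<close> identifies it with the limit of \<open>U\<close> that occurs in the
  theorem.\<close>

definition \<omega> :: real where "\<omega> = lim W"

lemma W_tendsto: "W \<longlonglongrightarrow> \<omega>"
proof -
  obtain c where "\<And>k. c \<le> U k" using bdd_below_U by (auto simp: bdd_below_def)
  then have "convergent W"
    using decseq_W by (metis decseq_convergent convergent_def)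
  then show ?thesis by (simp add: \<omega>_def convergent_LIMSEQ_iff)
qed

lemma \<omega>_le_W: "\<omega> \<le> W k"
  using decseq_W W_tendsto by (rule decseq_ge)

lemma filterlim_ell: "filterlim (\<lambda>k. ell m U k - j) at_top sequentially"
proof (rule filterlim_at_top_mono[of "\<lambda>k. k - (m + j)"])
  show "filterlim (\<lambda>k::nat. k - (m + j)) at_top sequentially"
    by (rule filterlim_minus_const_nat_at_top)
  show "\<forall>\<^sub>F k in sequentially. k - (m + j) \<le> ell m U k - j"
  proof (intro always_eventually allI)
    fix k show "k - (m + j) \<le> ell m U k - j" using ell_in[of m U k] by auto
  qed
qed

lemma s_le: "s k \<le> sqrt (2 / \<alpha> * (W k - U (Suc k)))"
proof (rule real_le_rsqrt)
  show "(s k)\<^sup>2 \<le> 2 / \<alpha> * (W k - U (Suc k))"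
    using descent[of k] \<alpha>_pos by (simp add: field_simps)
qed

text \<open>A small step cannot lower \<open>U\<close> by much, so closeness to the limit propagates
  backwards from the indices \<open>ell m U k\<close>, which are at most \<open>m + 1\<close> apart.\<close>

lemma U_ell_tendsto: "(\<lambda>k. U (ell m U k - j)) \<longlonglongrightarrow> \<omega>"
proof (induction j)
  case 0 then show ?case using W_tendsto by simp
next
  case (Suc j)
  obtain C where C: "\<And>k. U (Suc k) \<le> U k + C * s k" using growth by blast
  define i where "i k = ell m U k - Suc j" for k
  have lim_i: "filterlim i at_top sequentially"
    unfolding i_def by (rule filterlim_ell)
  have Suc_i: "\<forall>\<^sub>F k in sequentially. Suc (i k) = ell m U k - j"
  proof -
    have "\<forall>\<^sub>F k in sequentially. 1 \<le> i k"
      using lim_i by (simp add: filterlim_at_top)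
    then show ?thesis by eventually_elim (auto simp: i_def)
  qed
  have W_i: "(\<lambda>k. W (i k)) \<longlonglongrightarrow> \<omega>" using W_tendsto lim_i by (rule filterlim_compose)
  \<comment> \<open>Both ends of the descent inequality at \<open>i k\<close> tend to \<omega>, so
    the step between them vanishes; then \<open>growth\<close>, read backwards, bounds
    \<open>U (i k)\<close> from below.\<close>
  have "(\<lambda>k. sqrt (2 / \<alpha> * (W (i k) - U (ell m U k - j)))) \<longlonglongrightarrow> sqrt (2 / \<alpha> * (\<omega> - \<omega>))"
    by (intro tendsto_intros W_i Suc)
  then have up: "(\<lambda>k. sqrt (2 / \<alpha> * (W (i k) - U (ell m U k - j)))) \<longlonglongrightarrow> 0" by simp
  have s_i: "(\<lambda>k. s (i k)) \<longlonglongrightarrow> 0"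
  proof (rule tendsto_sandwich[OF _ _ tendsto_const up])
    show "\<forall>\<^sub>F k in sequentially. s (i k) \<le> sqrt (2 / \<alpha> * (W (i k) - U (ell m U k - j)))"
      using Suc_i
    proof eventually_elim
      case (elim k)
      show ?case using s_le[of "i k"] unfolding elim .
    qed
  qed simp
  have "(\<lambda>k. U (ell m U k - j) - C * s (i k)) \<longlonglongrightarrow> \<omega> - C * 0"
    by (intro tendsto_intros s_i Suc)
  then have lo: "(\<lambda>k. U (ell m U k - j) - C * s (i k)) \<longlonglongrightarrow> \<omega>" by simp
  have "(\<lambda>k. U (i k)) \<longlonglongrightarrow> \<omega>"
  proof (rule tendsto_sandwich[OF _ _ lo W_i])
    show "\<forall>\<^sub>F k in sequentially. U (ell m U k - j) - C * s (i k) \<le> U (i k)"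
      using Suc_i
    proof eventually_elim
      case (elim k)
      show ?case using C[of "i k"] unfolding elim by simp
    qed
    show "\<forall>\<^sub>F k in sequentially. U (i k) \<le> W (i k)" using U_le_W by simp
  qed
  then show ?case by (simp add: i_def)
qed

text \<open>Every \<open>k\<close> is reached backwards from \<open>ell m U (k + Suc m)\<close> in
  at most \<open>Suc m\<close> steps, so finitely many instances of the preceding limit cover all
  indices.\<close>

lemma U_tendsto: "U \<longlonglongrightarrow> \<omega>"
proof (rule tendstoI)
  fix e :: real assume "0 < e"
  have "\<forall>\<^sub>F n in sequentially. \<forall>j\<in>{..Suc m}. dist (U (ell m U n - j)) \<omega> < e"
    using U_ell_tendsto \<open>0 < e\<close> by (intro eventually_ball_finite) (auto dest: tendstoD)
  then obtain K where K: "\<And>n j. n \<ge> K \<Longrightarrow> j \<le> Suc m \<Longrightarrow> dist (U (ell m U n - j)) \<omega> < e"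
    unfolding eventually_sequentially by auto
  have "dist (U k) \<omega> < e" if "k \<ge> K" for k
  proof -
    have "ell m U (k + Suc m) \<in> {k + Suc m - m..k + Suc m}" by (rule ell_in)
    then show ?thesis using K[of "k + Suc m" "ell m U (k + Suc m) - k"] that by auto
  qed
  then show "\<forall>\<^sub>F k in sequentially. dist (U k) \<omega> < e"
    unfolding eventually_sequentially by blast
qed

lemma lim_U: "lim U = \<omega>" using U_tendsto by (rule limI)

lemma s_tendsto: "s \<longlonglongrightarrow> 0"
proof -
  have "(\<lambda>k. sqrt (2 / \<alpha> * (W k - U (Suc k)))) \<longlonglongrightarrow> sqrt (2 / \<alpha> * (\<omega> - \<omega>))"
    by (intro tendsto_intros W_tendsto LIMSEQ_Suc U_tendsto)
  then have up: "(\<lambda>k. sqrt (2 / \<alpha> * (W k - U (Suc k)))) \<longlonglongrightarrow> 0" by simp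
  show ?thesis
    by (rule tendsto_sandwich[OF _ _ tendsto_const up]) (use s_le in auto)
qed

abbreviation V :: "nat \<Rightarrow> real" where "V k \<equiv> W k - \<omega>"

lemma V_nonneg: "0 \<le> V k" using \<omega>_le_W by simp

lemma V_antimono: "k \<le> l \<Longrightarrow> V l \<le> V k"
  using decseq_W by (simp add: decseq_def)

lemma V_tendsto: "V \<longlonglongrightarrow> 0"
  using W_tendsto by (simp add: LIM_zero)

text \<open>Outside \<open>K1_set\<close> the deficit \<open>W (Suc k) - U (Suc k)\<close> consumes
  less than half of the guaranteed descent; the other half, \<alpha>/4 times the squared step, is
  left for the decrease of \<open>W\<close>.\<close>

lemma s_sq_le_if_notin_K1: "k \<notin> K1_set m \<alpha> U z \<Longrightarrow> (s k)\<^sup>2 \<le> 4 / \<alpha> * (V k - V (Suc k))"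
  using descent[of k] \<alpha>_pos by (simp add: K1_set_def field_simps)

lemma s_le_sqrt_if_in_K1:
  assumes "k \<in> K1_set m \<alpha> U z"
  shows "s k \<le> 2 / sqrt \<alpha> * sqrt (W (Suc k) - U (Suc k))"
proof -
  have "(s k)\<^sup>2 \<le> 4 / \<alpha> * (W (Suc k) - U (Suc k))"
    using assms \<alpha>_pos by (simp add: K1_set_def field_simps)
  then have "s k \<le> sqrt (4 / \<alpha> * (W (Suc k) - U (Suc k)))" by (rule real_le_rsqrt)
  then show ?thesis by (simp only: real_sqrt_mult real_sqrt_divide real_sqrt_four)
qed

end

text \<open>Sum the recursion over \<open>k < n\<close>. Each of the \<open>N\<close> shifted sums
  on the right is at most the partial sum of length \<open>N + n\<close>, so together they
  contribute half of it, which moves to the left. The partial sums are therefore bounded.\<close>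

lemma summable_if_window_contraction:
  fixes a b :: "nat \<Rightarrow> real"
  assumes a: "\<And>k. 0 \<le> a k" and b: "\<And>k. 0 \<le> b k" "summable b" and N: "0 < N"
    and ev: "\<forall>\<^sub>F k in sequentially. a (k + N) \<le> 1 / (2 * real N) * (\<Sum>i<N. a (k + i)) + b k"
  shows "summable a"
proof -
  obtain k0 where k0: "\<And>k. k \<ge> k0 \<Longrightarrow> a (k + N) \<le> 1 / (2 * real N) * (\<Sum>i<N. a (k + i)) + b k"
    using ev unfolding eventually_sequentially by blast
  define a' where "a' k = a (k + k0)" for k
  define b' where "b' k = b (k + k0)" for k
  have a'0: "0 \<le> a' k" for k using a by (simp add: a'_def)
  have b': "\<And>k. 0 \<le> b' k" "summable b'"
    using b summable_ignore_initial_segment[of b k0] by (simp_all add: b'_def[abs_def])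
  have step: "a' (k + N) \<le> 1 / (2 * real N) * (\<Sum>i<N. a' (k + i)) + b' k" for k
    using k0[of "k + k0"] by (simp add: a'_def b'_def ac_simps)
  define T where "T n = (\<Sum>k<n. a' k)" for n
  have T_mono: "T n \<le> T l" if "n \<le> l" for n l
    unfolding T_def using that a'0 by (intro sum_mono2) auto
  have "T n \<le> 2 * (suminf b' + T N)" for n
  proof -
    have split: "T (N + n) = T N + (\<Sum>k<n. a' (k + N))"
      unfolding T_def by (induction n) (simp_all add: ac_simps)
    have shift: "(\<Sum>k<n. a' (k + i)) \<le> T (N + n)" if "i < N" for i
    proof -
      have "(\<Sum>k<n. a' (k + i)) = (\<Sum>k\<in>(\<lambda>k. k + i) ` {..<n}. a' k)"
        by (subst sum.reindex) auto
      also have "\<dots> \<le> T (N + n)"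
        unfolding T_def using that a'0 by (intro sum_mono2) auto
      finally show ?thesis .
    qed
    have "(\<Sum>k<n. a' (k + N)) \<le> (\<Sum>k<n. 1 / (2 * real N) * (\<Sum>i<N. a' (k + i)) + b' k)"
      by (intro sum_mono step)
    also have "\<dots> = 1 / (2 * real N) * (\<Sum>i<N. \<Sum>k<n. a' (k + i)) + (\<Sum>k<n. b' k)"
      by (simp add: sum.distrib sum_distrib_left sum.swap[of _ "{..<n}"])
    also have "\<dots> \<le> 1 / (2 * real N) * (\<Sum>i<N. T (N + n)) + suminf b'"
      using shift b' by (intro add_mono mult_left_mono sum_mono sum_le_suminf) auto
    also have "\<dots> = T (N + n) / 2 + suminf b'" using N by simp
    finally have le: "(\<Sum>k<n. a' (k + N)) \<le> T (N + n) / 2 + suminf b'" .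
    from le[unfolded split] have "T (N + n) \<le> 2 * (suminf b' + T N)"
      by (simp add: split field_simps)
    then show ?thesis using T_mono[of n "N + n"] by linarith
  qed
  then have "summable a'"
    unfolding T_def using a'0 by (intro summableI_nonneg_bounded) auto
  then show ?thesis by (simp add: a'_def[abs_def] summable_iff_shift)
qed

lemma summable_nonneg_telescope:
  fixes F :: "nat \<Rightarrow> real"
  assumes "\<And>k. F (Suc k) \<le> F k" "\<And>k. 0 \<le> F k"
  shows "summable (\<lambda>k. F k - F (Suc k))"
proof (rule summableI_nonneg_bounded)
  show "(\<Sum>k<n. F k - F (Suc k)) \<le> F 0" for n
    using sum_lessThan_telescope'[of F n] assms(2)[of n] by simp
qed (use assms in simp)

text \<open>The squares of \<open>e * b + d / (4 * e)\<close> and \<open>e * b - d / (4 * e)\<close>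
  differ by \<open>b * d\<close>.\<close>

lemma le_weighted_AM_GM:
  fixes a b d e :: real
  assumes "0 < e" "0 \<le> b" "0 \<le> d" "0 \<le> a" "a\<^sup>2 \<le> b * d"
  shows "a \<le> e * b + d / (4 * e)"
proof (rule power2_le_imp_le)
  have "0 \<le> (e * b - d / (4 * e))\<^sup>2" by simp
  then show "a\<^sup>2 \<le> (e * b + d / (4 * e))\<^sup>2"
    using assms by (simp add: power2_sum power2_diff)
  show "0 \<le> e * b + d / (4 * e)" using assms by simp
qed

section \<open>Summability of the steps from a KL inequality\<close>

context nonmonotone_descent
begin

lemma W_sub_W_nonneg: "0 \<le> W k - W (Suc k)" using W_Suc_le by simp

lemma decrease_ratio_nonneg: "0 \<le> decrease_ratio m U z k"
  using W_Suc_le[of k] by (simp add: decrease_ratio_def)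

text \<open>The ratio is nonnegative, so a nonzero liminf is positive and bounds it away from 0 on
  late members of \<open>K1_set\<close>. Outside \<open>K1_set\<close> the constant 4/\<alpha> is
  always available; the sum of both constants serves every index.\<close>

lemma eventually_square_le_if_Liminf_ratio:
  assumes "Liminf (inf sequentially (principal (K1_set m \<alpha> U z))) (decrease_ratio m U z) \<noteq> 0"
  shows "\<exists>B>0. \<forall>\<^sub>F k in sequentially. (s k)\<^sup>2 \<le> B * (V k - V (Suc k))"
proof -
  let ?F = "inf sequentially (principal (K1_set m \<alpha> U z))"
  have "0 \<le> Liminf ?F (decrease_ratio m U z)"
    by (rule Liminf_bounded) (simp add: decrease_ratio_nonneg)
  with assms have "0 < Liminf ?F (decrease_ratio m U z)" by simp
  \<comment> \<open>The liminf may be infinite, for instance when \<open>K1_set\<close> is finite,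
    so a real number strictly below it is taken.\<close>
  then obtain b :: ereal where b: "0 < b" "b < Liminf ?F (decrease_ratio m U z)"
    using dense by blast
  then obtain r where r: "b = ereal r" "0 < r" by (cases b) auto
  have "\<forall>\<^sub>F k in ?F. b < decrease_ratio m U z k" using b(2) by (rule less_LiminfD)
  then have *: "\<forall>\<^sub>F k in sequentially. k \<in> K1_set m \<alpha> U z \<longrightarrow> b < decrease_ratio m U z k"
    by (simp add: eventually_inf_principal)
  show ?thesis
  proof (intro exI conjI)
    show "0 < 1 / r + 4 / \<alpha>" using r \<alpha>_pos by (simp add: add_pos_pos)
    show "\<forall>\<^sub>F k in sequentially. (s k)\<^sup>2 \<le> (1 / r + 4 / \<alpha>) * (V k - V (Suc k))"
      using *
    proof eventually_elim
      case (elim k)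
      have d: "0 \<le> V k - V (Suc k)" using W_sub_W_nonneg by simp
      consider "k \<notin> K1_set m \<alpha> U z" | "k \<in> K1_set m \<alpha> U z" "z (Suc k) = z k"
        | "k \<in> K1_set m \<alpha> U z" "z (Suc k) \<noteq> z k" by blast
      then show ?case
      proof cases
        case 1
        have "0 \<le> 1 / r * (V k - V (Suc k))" using r d by simp
        then show ?thesis using s_sq_le_if_notin_K1[OF 1] by (simp only: distrib_right)
      next
        case 2
        then show ?thesis using d r \<alpha>_pos by simp
      next
        case 3
        then have "r < (W k - W (Suc k)) / (s k)\<^sup>2" using elim r by (simp add: decrease_ratio_def)
        then have "(s k)\<^sup>2 \<le> 1 / r * (V k - V (Suc k))" using 3 r by (simp add: field_simps)
        moreover have "0 \<le> 4 / \<alpha> * (V k - V (Suc k))" using \<alpha>_pos d by simp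
        ultimately show ?thesis by (simp only: distrib_right)
      qed
    qed
  qed
qed

text \<open>\<open>F\<close> and \<open>D\<close> stand for a desingularizing function and its
  derivative. Only signs and the tangent inequality of a concave function are assumed, which sums of
  several such functions satisfy as well.\<close>

lemma summable_steps_if_KL:
  assumes tangent: "\<And>a b. 0 \<le> b \<Longrightarrow> b \<le> a \<Longrightarrow> 0 < a \<Longrightarrow> a < r \<Longrightarrow> D a * (a - b) \<le> F a - F b"
    and F_nonneg: "\<And>a. 0 \<le> a \<Longrightarrow> a < r \<Longrightarrow> 0 \<le> F a"
    and D_nonneg: "\<And>a. 0 < a \<Longrightarrow> a < r \<Longrightarrow> 0 \<le> D a"
    and r: "0 < r"
    and KL: "\<forall>\<^sub>F k in sequentially. \<omega> < U (Suc k) \<longrightarrow> 1 \<le> D (U (Suc k) - \<omega>) * s k"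
    and K1: "Liminf (inf sequentially (principal (K1_set m \<alpha> U z))) (decrease_ratio m U z) = 0 \<longrightarrow>
      (\<lambda>k. sqrt (U (ell m U (Suc k)) - U (Suc k))) summable_on K1_set m \<alpha> U z"
  shows "summable s"
proof -
  \<comment> \<open>Both cases of the assumption are brought to one alternative: the squared step is
    dominated by the decrease of \<open>V\<close>, or the step by a summable \<open>t\<close>. For a
    nonzero liminf \<open>t\<close> is 0; otherwise it carries the steps in
    \<open>K1_set\<close>.\<close>
  obtain B t where B: "0 < B" and t: "summable t" "\<And>k. 0 \<le> t k"
    and dich: "\<forall>\<^sub>F k in sequentially. (s k)\<^sup>2 \<le> B * (V k - V (Suc k)) \<or> s k \<le> t k"
  proof (cases "Liminf (inf sequentially (principal (K1_set m \<alpha> U z))) (decrease_ratio m U z) = 0")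
    case False
    then obtain B where "0 < B" "\<forall>\<^sub>F k in sequentially. (s k)\<^sup>2 \<le> B * (V k - V (Suc k))"
      using eventually_square_le_if_Liminf_ratio by blast
    then show thesis
      by (intro that[of B "\<lambda>_. 0"]) (simp_all add: eventually_mono[OF _ disjI1])
  next
    case True
    define h where "h k = 2 / sqrt \<alpha> * sqrt (U (ell m U (Suc k)) - U (Suc k))" for k
    define t where "t k = (if k \<in> K1_set m \<alpha> U z then h k else 0)" for k
    have h0: "0 \<le> h k" for k using \<alpha>_pos U_le_W by (simp add: h_def)
    have "h summable_on K1_set m \<alpha> U z"
      unfolding h_def using K1 True by (intro summable_on_cmult_right) auto
    also have "h summable_on K1_set m \<alpha> U z \<longleftrightarrow> t summable_on UNIV"
      by (rule summable_on_cong_neutral) (auto simp: t_def)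
    finally have "summable t"
      using h0 by (subst (asm) summable_on_UNIV_nonneg_real_iff) (auto simp: t_def)
    moreover have "(s k)\<^sup>2 \<le> 4 / \<alpha> * (V k - V (Suc k)) \<or> s k \<le> t k" for k
      using s_sq_le_if_notin_K1[of k] s_le_sqrt_if_in_K1[of k] by (auto simp: t_def h_def)
    ultimately show thesis using \<alpha>_pos h0
      by (intro that[of "4 / \<alpha>" t]) (auto simp: t_def)
  qed
  define N where "N = Suc m"
  define e where "e = 1 / (2 * real N)"
  have e: "0 < e" by (simp add: e_def N_def)
  obtain k1 where k1: "\<And>k. k \<ge> k1 \<Longrightarrow> V k < r"
    using order_tendstoD(2)[OF V_tendsto r] unfolding eventually_sequentially by blast
  define G where "G k = F (V (k + k1))" for k
  have F_mono: "F b \<le> F a" if "0 \<le> b" "b \<le> a" "a < r" for a b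
  proof (cases "a = 0")
    case False
    then have "0 \<le> D a * (a - b)" using that D_nonneg[of a] by simp
    then show ?thesis using tangent[of b a] that False by simp
  qed (use that in simp)
  have "summable (\<lambda>k. G k - G (Suc k))"
  proof (rule summable_nonneg_telescope)
    show "0 \<le> G k" for k using F_nonneg V_nonneg k1 by (simp add: G_def)
    show "G (Suc k) \<le> G k" for k
      using F_mono[of "V (Suc k + k1)" "V (k + k1)"] V_nonneg k1 V_antimono by (simp add: G_def)
  qed
  \<comment> \<open>Set to 0 before \<open>k1\<close>, where \<open>V k\<close> may leave the range
    below \<open>r\<close> on which \<open>F\<close> is controlled.\<close>
  moreover define \<Delta> where "\<Delta> k = (if k1 \<le> k then F (V k) - F (V (Suc k)) else 0)" for k
  ultimately have "summable (\<lambda>k. \<Delta> (k + k1))" by (simp add: G_def)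
  then have sum_\<Delta>: "summable \<Delta>" by (simp add: summable_iff_shift)
  have \<Delta>0: "0 \<le> \<Delta> k" for k
    using F_mono[of "V (Suc k)" "V k"] V_nonneg k1 V_antimono by (simp add: \<Delta>_def)
  have \<Delta>V: "\<forall>\<^sub>F k in sequentially. V k - V (Suc k) \<le> s (ell m U k - 1) * \<Delta> k"
  proof -
    have "\<forall>\<^sub>F k in sequentially. \<omega> < U (Suc (ell m U k - 1)) \<longrightarrow>
        1 \<le> D (U (Suc (ell m U k - 1)) - \<omega>) * s (ell m U k - 1)"
      using eventually_compose_filterlim[OF KL filterlim_ell[of 1]] .
    moreover have "\<forall>\<^sub>F k in sequentially. m < k" by (rule eventually_gt_at_top)
    moreover have "\<forall>\<^sub>F k in sequentially. k1 \<le> k" by (rule eventually_ge_at_top)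
    ultimately show ?thesis
    proof eventually_elim
      case (elim k)
      \<comment> \<open>\<open>m < k\<close> makes \<open>ell m U k\<close> positive, so that
        \<open>Suc\<close> undoes the truncated subtraction.\<close>
      have Suc: "Suc (ell m U k - 1) = ell m U k" using ell_in[of m U k] elim(2) by auto
      have d: "0 \<le> V k - V (Suc k)" using W_sub_W_nonneg by simp
      show ?case
      proof (cases "V k = 0")
        case True
        then have "V k - V (Suc k) \<le> 0" using V_nonneg[of "Suc k"] by linarith
        also have "0 \<le> s (ell m U k - 1) * \<Delta> k" using \<Delta>0[of k] by simp
        finally show ?thesis .
      next
        case False
        then have pos: "0 < V k" using V_nonneg[of k] by linarith
        have "1 \<le> D (V k) * s (ell m U k - 1)" using elim(1) pos unfolding Suc by simp
        then have "V k - V (Suc k) \<le> D (V k) * s (ell m U k - 1) * (V k - V (Suc k))"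
          using d mult_right_mono by fastforce
        also have "\<dots> = s (ell m U k - 1) * (D (V k) * (V k - V (Suc k)))" by simp
        also have "\<dots> \<le> s (ell m U k - 1) * \<Delta> k"
          using tangent[of "V (Suc k)" "V k"] V_nonneg pos k1 elim(3) d
          by (intro mult_left_mono) (auto simp: \<Delta>_def)
        finally show ?thesis .
      qed
    qed
  qed
  have "\<forall>\<^sub>F k in sequentially. s k \<le> e * s (ell m U k - 1) + (B / (4 * e) * \<Delta> k + t k)"
    using \<Delta>V dich
  proof eventually_elim
    case (elim k)
    show ?case
      using elim(2)
    proof
      assume "(s k)\<^sup>2 \<le> B * (V k - V (Suc k))"
      also have "\<dots> \<le> B * (s (ell m U k - 1) * \<Delta> k)" using elim(1) B by simp
      finally have "s k \<le> e * s (ell m U k - 1) + B * \<Delta> k / (4 * e)"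
        using e B \<Delta>0 by (intro le_weighted_AM_GM) (auto simp: ac_simps)
      then show ?thesis using t(2)[of k] by simp
    next
      assume "s k \<le> t k"
      moreover have "0 \<le> e * s (ell m U k - 1)" "0 \<le> B / (4 * e) * \<Delta> k" using e B \<Delta>0 by simp_all
      ultimately show ?thesis by linarith
    qed
  qed
  then have "\<forall>\<^sub>F k in sequentially. s (k + N) \<le>
      e * s (ell m U (k + N) - 1) + (B / (4 * e) * \<Delta> (k + N) + t (k + N))"
    by (rule sequentially_offset)
  \<comment> \<open>The index lies between \<open>k\<close> and \<open>k + m\<close>, hence in the
    window of length \<open>N\<close>; a single nonnegative term is at most the window sum.\<close>
  moreover have "s (ell m U (k + N) - 1) \<le> (\<Sum>i<N. s (k + i))" for k
  proof -
    have "ell m U (k + N) \<in> {k + N - m..k + N}" by (rule ell_in)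
    then have "ell m U (k + N) - 1 = k + (ell m U (k + N) - 1 - k)"
      and lt: "ell m U (k + N) - 1 - k \<in> {..<N}" by (auto simp: N_def)
    then show ?thesis using member_le_sum[OF lt, of "\<lambda>i. s (k + i)"] by simp
  qed
  ultimately have "\<forall>\<^sub>F k in sequentially. s (k + N) \<le>
      e * (\<Sum>i<N. s (k + i)) + (B / (4 * e) * \<Delta> (k + N) + t (k + N))"
    using e
  proof (elim eventually_mono)
    fix k
    assume le: "s (k + N) \<le> e * s (ell m U (k + N) - 1) + (B / (4 * e) * \<Delta> (k + N) + t (k + N))"
      and "\<And>k. s (ell m U (k + N) - 1) \<le> (\<Sum>i<N. s (k + i))"
    then have "e * s (ell m U (k + N) - 1) \<le> e * (\<Sum>i<N. s (k + i))"
      using e by (intro mult_left_mono) auto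
    with le show "s (k + N) \<le> e * (\<Sum>i<N. s (k + i)) + (B / (4 * e) * \<Delta> (k + N) + t (k + N))"
      by linarith
  qed
  moreover have "summable (\<lambda>k. B / (4 * e) * \<Delta> (k + N) + t (k + N))"
    by (intro summable_add summable_mult summable_ignore_initial_segment sum_\<Delta> t)
  moreover have "0 \<le> B / (4 * e) * \<Delta> (k + N) + t (k + N)" for k
    using t(2) \<Delta>0 B e by simp
  ultimately show ?thesis
    by (intro summable_if_window_contraction[where a = s and N = N])
      (auto simp only: e_def, auto simp: N_def)
qed

end

section \<open>Rates from power-type recursions\<close>

text \<open>Concavity of \<open>t powr q\<close> via the mean value theorem. The case
  \<open>b = 0\<close> is separate because the derivative does not exist there when
  \<open>q < 1\<close>.\<close>

lemma powr_tangent_le: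
  fixes a b q :: real
  assumes "0 \<le> b" "b \<le> a" "0 < a" "0 < q" "q \<le> 1"
  shows "q * a powr (q - 1) * (a - b) \<le> a powr q - b powr q"
proof -
  consider "b = 0" | "b = a" | "0 < b" "b < a" using assms by linarith
  then show ?thesis
  proof cases
    case 1
    have "a powr (q - 1) * a = a powr q" using assms by (simp add: powr_diff)
    then show ?thesis using 1 assms by (simp add: mult.assoc mult_left_le_one_le)
  next
    case 3
    obtain x where x: "b < x" "x < a" "a powr q - b powr q = (a - b) * (q * x powr (q - 1))"
      using MVT2[OF 3(2), of "\<lambda>x. x powr q" "\<lambda>x. q * x powr (q - 1)"] 3(1)
        has_real_derivative_powr[of _ q] order_less_le_trans by blast
    moreover have "a powr (q - 1) \<le> x powr (q - 1)"
      using x 3 assms by (intro powr_mono2') auto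
    ultimately show ?thesis using assms by (simp add: mult.commute mult.left_commute mult_left_mono)
  qed simp
qed

lemma powr_minus_tangent_le:
  fixes a b p :: real
  assumes "0 < b" "b \<le> a" "0 < p"
  shows "p * a powr (- p - 1) * (a - b) \<le> b powr (- p) - a powr (- p)"
proof (cases "b = a")
  case False
  then have "b < a" using assms by simp
  then obtain x where x: "b < x" "x < a"
      "a powr (- p) - b powr (- p) = (a - b) * (- p * x powr (- p - 1))"
    using MVT2[of b a "\<lambda>x. x powr (- p)" "\<lambda>x. - p * x powr (- p - 1)"] assms(1)
      has_real_derivative_powr[of _ "- p"] order_less_le_trans by blast
  moreover have "p * a powr (- p - 1) * (a - b) \<le> p * x powr (- p - 1) * (a - b)"
    using x assms by (intro mult_right_mono mult_left_mono powr_mono2') auto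
  ultimately show ?thesis by (simp add: algebra_simps)
qed simp

text \<open>This turns \<open>V powr \<theta>\<close> into a telescoping quantity. If
  \<open>b\<close> is at least \<open>a / 2\<close>, write \<open>b powr \<theta>\<close> as
  \<open>b powr (2 * \<theta>) * b powr (- \<theta>)\<close>, apply the recursion and recognize the
  tangent of \<open>t powr (1 - \<theta>)\<close>. If \<open>b < a / 2\<close>, the difference on
  the right is already a fixed fraction of \<open>a powr (1 - \<theta>)\<close>. The constant adds
  those of the two cases.\<close>

lemma powr_le_powr_diff:
  fixes a b c \<theta> :: real
  assumes \<theta>: "1/2 \<le> \<theta>" "\<theta> < 1" and c: "0 < c" and ab: "0 \<le> b" "b \<le> a" "a \<le> 1"
    and rec: "b powr (2 * \<theta>) \<le> c * (a - b)"
  shows "b powr \<theta> \<le> (c * 2 powr \<theta> / (1 - \<theta>) + 1 / (1 - 2 powr (\<theta> - 1)))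
    * (a powr (1 - \<theta>) - b powr (1 - \<theta>))"
proof (cases "b = 0")
  case True
  have "2 powr (\<theta> - 1) < 2 powr (0::real)" using \<theta> by (intro powr_less_mono) auto
  then show ?thesis using True \<theta> c by (simp add: add_nonneg_nonneg)
next
  case False
  then have pos: "0 < b" "0 < a" using ab by auto
  have q: "2 powr (\<theta> - 1) < (1::real)"
    using \<theta> powr_less_mono[of "\<theta> - 1" 0 "2::real"] by simp
  define E where "E = a powr (1 - \<theta>) - b powr (1 - \<theta>)"
  have E0: "0 \<le> E" using ab \<theta> by (simp add: E_def powr_mono2)
  show ?thesis
  proof (cases "a / 2 \<le> b")
    case True
    have "b powr \<theta> = b powr (2 * \<theta>) * b powr (- \<theta>)" by (simp flip: powr_add)
    also have "\<dots> \<le> c * (a - b) * (a / 2) powr (- \<theta>)"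
      using rec True pos \<theta> c ab by (intro mult_mono powr_mono2') auto
    also have "(a / 2) powr (- \<theta>) = 2 powr \<theta> * a powr (- \<theta>)"
      using pos by (simp add: powr_divide powr_minus field_simps)
    also have "c * (a - b) * (2 powr \<theta> * a powr (- \<theta>))
        = c * 2 powr \<theta> / (1 - \<theta>) * ((1 - \<theta>) * a powr (1 - \<theta> - 1) * (a - b))"
      using \<theta> by (simp add: field_simps)
    also have "\<dots> \<le> c * 2 powr \<theta> / (1 - \<theta>) * E"
      unfolding E_def using \<theta> c ab pos by (intro mult_left_mono powr_tangent_le) auto
    finally have "b powr \<theta> \<le> c * 2 powr \<theta> / (1 - \<theta>) * E" .
    moreover have "0 \<le> 1 / (1 - 2 powr (\<theta> - 1)) * E" using q E0 by simp
    ultimately show ?thesis unfolding E_def distrib_right by linarith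
  next
    case False
    have "b powr (1 - \<theta>) \<le> (a / 2) powr (1 - \<theta>)" using False pos \<theta> by (intro powr_mono2) auto
    also have "\<dots> = 2 powr (\<theta> - 1) * a powr (1 - \<theta>)"
      using pos by (simp add: powr_divide powr_diff field_simps)
    finally have "(1 - 2 powr (\<theta> - 1)) * a powr (1 - \<theta>) \<le> E" by (simp add: E_def algebra_simps)
    then have "a powr (1 - \<theta>) \<le> 1 / (1 - 2 powr (\<theta> - 1)) * E" using q by (simp add: field_simps)
    moreover have "b powr \<theta> \<le> a powr \<theta>" using ab \<theta> by (intro powr_mono2) auto
    \<comment> \<open>Here \<open>a \<le> 1\<close> and \<open>1 - \<theta> \<le> \<theta>\<close>
      enter: the smaller exponent gives the larger power.\<close>
    moreover have "a powr \<theta> \<le> a powr (1 - \<theta>)" using ab \<theta> pos by (intro powr_mono') auto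
    moreover have "0 \<le> c * 2 powr \<theta> / (1 - \<theta>) * E" using \<theta> c E0 by simp
    ultimately show ?thesis unfolding E_def distrib_right by linarith
  qed
qed

text \<open>One function for both regimes, so that bounds of the same rate can be shifted and added
  without case distinctions. At \<theta> = 1/2 the exponent of the power regime has denominator 0;
  for \<theta> between 1/2 and 1 it is negative.\<close>

definition kl_rate :: "real \<Rightarrow> real \<Rightarrow> nat \<Rightarrow> real" where
  "kl_rate \<theta> \<rho> k = (if \<theta> = 1/2 then \<rho> ^ k else real k powr ((1 - \<theta>) / (1 - 2 * \<theta>)))"

lemma kl_rate_mono: "0 < \<rho> \<Longrightarrow> \<rho> \<le> \<rho>' \<Longrightarrow> kl_rate \<theta> \<rho> k \<le> kl_rate \<theta> \<rho>' k"
  by (simp add: kl_rate_def power_mono)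

text \<open>A delay by \<open>N\<close> costs a constant factor: \<open>1 / \<rho> ^ N\<close> in
  the geometric regime, and in the power regime a power of 1/2 because \<open>k - N\<close> is
  eventually at least \<open>k / 2\<close>.\<close>

lemma kl_rate_shift:
  assumes "1/2 \<le> \<theta>" "\<theta> < 1" "0 < \<rho>"
  shows "\<exists>C>0. \<forall>\<^sub>F k in sequentially. kl_rate \<theta> \<rho> (k - N) \<le> C * kl_rate \<theta> \<rho> k"
proof (cases "\<theta> = 1/2")
  case True
  have "\<forall>\<^sub>F k in sequentially. kl_rate \<theta> \<rho> (k - N) \<le> (1 / \<rho> ^ N) * kl_rate \<theta> \<rho> k"
    using eventually_ge_at_top[of N]
  proof eventually_elim
    case (elim k)
    then show ?case using True assms(3) by (simp add: kl_rate_def power_diff)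
  qed
  then show ?thesis using assms(3) by (intro exI[of _ "1 / \<rho> ^ N"]) simp
next
  case False
  define e where "e = (1 - \<theta>) / (1 - 2 * \<theta>)"
  have e: "e \<le> 0" unfolding e_def using assms False by (intro divide_nonneg_nonpos) auto
  have "\<forall>\<^sub>F k in sequentially. kl_rate \<theta> \<rho> (k - N) \<le> (1/2) powr e * kl_rate \<theta> \<rho> k"
    \<comment> \<open>\<open>2 * N\<close> gives \<open>k - N \<ge> k / 2\<close>; the additional 1
      keeps the base of the negative power positive.\<close>
    using eventually_ge_at_top[of "2 * N + 1"]
  proof eventually_elim
    case (elim k)
    then have "real (k - N) powr e \<le> (1/2 * real k) powr e" using e by (intro powr_mono2') auto
    also have "\<dots> = (1/2) powr e * real k powr e" by (rule powr_mult)
    finally show ?case using False by (simp add: kl_rate_def e_def)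
  qed
  then show ?thesis by (intro exI[of _ "(1/2) powr e"]) simp
qed

text \<open>A contraction by \<open>q\<close> every \<open>N\<close> steps has per-step factor
  \<open>root N q\<close>; monotonicity fills the indices between the blocks.\<close>

lemma linear_rate:
  fixes E :: "nat \<Rightarrow> real"
  assumes E: "\<And>k. 0 \<le> E k" "\<And>k l. k \<le> l \<Longrightarrow> E l \<le> E k" and q: "0 < q" "q < 1" and N: "0 < N"
    and ev: "\<forall>\<^sub>F k in sequentially. E (k + N) \<le> q * E k"
  shows "\<exists>C>0. \<exists>\<rho>. 0 < \<rho> \<and> \<rho> < 1 \<and> (\<forall>\<^sub>F k in sequentially. E k \<le> C * \<rho> ^ k)"
proof -
  obtain k0 where k0: "\<And>k. k \<ge> k0 \<Longrightarrow> E (k + N) \<le> q * E k"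
    using ev unfolding eventually_sequentially by blast
  have it: "E (k0 + j * N) \<le> q ^ j * E k0" for j
  proof (induction j)
    case (Suc j)
    have "E (k0 + Suc j * N) \<le> q * E (k0 + j * N)" using k0[of "k0 + j * N"] by (simp add: ac_simps)
    also have "\<dots> \<le> q * (q ^ j * E k0)" using Suc q by simp
    finally show ?case by simp
  qed simp
  define \<rho> where "\<rho> = root N q"
  have \<rho>: "0 < \<rho>" "\<rho> < 1" "\<rho> ^ N = q" using q N by (auto simp: \<rho>_def)
  \<comment> \<open>Dividing by \<open>\<rho> ^ (k0 + N)\<close> pays for the start at
    \<open>k0\<close> and for the last, incomplete block; the summand 1 keeps the constant
    positive.\<close>
  have "E k \<le> ((E k0 + 1) / \<rho> ^ (k0 + N)) * \<rho> ^ k" if "k \<ge> k0" for k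
  proof -
    define j where "j = (k - k0) div N"
    have "(k - k0) mod N < N" using N by simp
    moreover have "k - k0 = j * N + (k - k0) mod N" by (simp add: j_def)
    ultimately have j: "k0 + j * N \<le> k" "k \<le> j * N + (k0 + N)" using that by linarith+
    have "E k \<le> q ^ j * E k0" using E(2)[OF j(1)] it[of j] by linarith
    also have "\<dots> \<le> q ^ j * (E k0 + 1)" using q by simp
    finally have "E k * \<rho> ^ (k0 + N) \<le> q ^ j * (E k0 + 1) * \<rho> ^ (k0 + N)"
      using \<rho> by (intro mult_right_mono) auto
    also have "\<dots> = (E k0 + 1) * \<rho> ^ (j * N + (k0 + N))"
      unfolding \<rho>(3)[symmetric] by (simp add: power_add power_mult[symmetric] mult.commute)
    also have "\<dots> \<le> (E k0 + 1) * \<rho> ^ k"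
      using j E(1)[of k0] \<rho> by (intro mult_left_mono power_decreasing) auto
    finally show ?thesis using \<rho> by (simp add: field_simps)
  qed
  then show ?thesis using E(1)[of k0] \<rho>
    by (intro exI[of _ "(E k0 + 1) / \<rho> ^ (k0 + N)"] exI[of _ \<rho>] conjI)
      (auto simp: eventually_sequentially intro!: divide_pos_pos add_nonneg_pos)
qed

text \<open>The recursion makes \<open>V k powr (1 - 2 * \<theta>)\<close> grow by a fixed amount every \<open>N\<close> steps.\<close>

lemma sublinear_rate:
  fixes V :: "nat \<Rightarrow> real"
  assumes V: "\<And>k. 0 \<le> V k" "\<And>k l. k \<le> l \<Longrightarrow> V l \<le> V k" and \<theta>: "1/2 < \<theta>" "\<theta> < 1"
    and c: "0 < c" and N: "0 < N"
    and ev: "\<forall>\<^sub>F k in sequentially. V (k + N) powr (2 * \<theta>) \<le> c * (V k - V (k + N))"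
  shows "\<exists>C>0. \<forall>\<^sub>F k in sequentially. V k powr (1 - \<theta>) \<le> C * real k powr ((1 - \<theta>) / (1 - 2 * \<theta>))"
proof (cases "\<exists>k. V k = 0")
  case True
  then obtain k where k: "V k = 0" by blast
  have "V l = 0" if "l \<ge> k" for l using V(1)[of l] V(2)[OF that] k by linarith
  then show ?thesis by (intro exI[of _ 1]) (auto simp: eventually_sequentially intro!: exI[of _ k])
next
  case False
  then have pos: "0 < V k" for k using V(1)[of k] by (metis less_eq_real_def)
  obtain k0 where k0: "\<And>k. k \<ge> k0 \<Longrightarrow> V (k + N) powr (2 * \<theta>) \<le> c * (V k - V (k + N))"
    using ev unfolding eventually_sequentially by blast
  define p where "p = 2 * \<theta> - 1"
  have p: "0 < p" using \<theta> by (simp add: p_def)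
  \<comment> \<open>A lower bound for the growth of \<open>V k powr (- p)\<close> over
    \<open>N\<close> steps. The first entry is for the case that at least half of \<open>V k\<close>
    remains, through the recursion and convexity of \<open>t powr (- p)\<close>; the second is for
    the case that \<open>V\<close> is halved, when \<open>V k powr (- p)\<close> gains the factor
    \<open>2 powr p\<close>.\<close>
  define \<mu> where "\<mu> = min (p * (1/2) powr (p + 1) / c) ((2 powr p - 1) * V k0 powr (- p))"
  have "1 < 2 powr p" using p by simp
  then have \<mu>: "0 < \<mu>" using p c pos[of k0] by (simp add: \<mu>_def)
  have step: "V k powr (- p) + \<mu> \<le> V (k + N) powr (- p)" if k: "k \<ge> k0" for k
  proof (cases "V k / 2 \<le> V (k + N)")
    case True
    have "(1/2) powr (p + 1) = (V k / 2) powr (p + 1) * V k powr (- p - 1)"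
      using pos[of k] by (simp add: powr_divide powr_minus_divide powr_diff powr_add field_simps)
    also have "\<dots> \<le> V (k + N) powr (p + 1) * V k powr (- p - 1)"
      using True p pos by (intro mult_right_mono powr_mono2) (auto simp: less_imp_le)
    also have "\<dots> \<le> c * (V k - V (k + N)) * V k powr (- p - 1)"
      using k0[OF k] by (intro mult_right_mono) (auto simp: p_def)
    finally have "(1/2) powr (p + 1) / c \<le> V k powr (- p - 1) * (V k - V (k + N))"
      using c by (simp add: field_simps)
    then have "p * ((1/2) powr (p + 1) / c) \<le> p * (V k powr (- p - 1) * (V k - V (k + N)))"
      using p by (intro mult_left_mono) auto
    also have "\<dots> \<le> V (k + N) powr (- p) - V k powr (- p)"
      using powr_minus_tangent_le[OF pos V(2) p, of k "k + N"] by (simp add: mult.assoc)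
    finally show ?thesis by (simp add: \<mu>_def)
  next
    case False
    have "2 powr p * V k powr (- p) = (V k / 2) powr (- p)"
      using pos[of k] by (simp add: powr_divide powr_minus_divide)
    also have "\<dots> \<le> V (k + N) powr (- p)"
      using False p pos[of "k + N"] by (intro powr_mono2') auto
    finally have "(2 powr p - 1) * V k powr (- p) \<le> V (k + N) powr (- p) - V k powr (- p)"
      by (simp add: algebra_simps)
    moreover have "(2 powr p - 1) * V k0 powr (- p) \<le> (2 powr p - 1) * V k powr (- p)"
      using p pos V(2)[OF k] less_imp_le[OF \<open>1 < 2 powr p\<close>]
      by (intro mult_left_mono powr_mono2') (simp_all only: diff_ge_0_iff_ge neg_le_0_iff_le less_imp_le)
    ultimately show ?thesis by (simp add: \<mu>_def)
  qed
  have it: "real j * \<mu> \<le> V (k0 + j * N) powr (- p)" for j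
  proof (induction j)
    case (Suc j)
    then show ?case using step[of "k0 + j * N"] by (simp add: algebra_simps)
  qed simp
  \<comment> \<open>For \<open>k \<ge> 2 * k0 + 2 * N\<close> the number \<open>j\<close> of
    complete blocks after \<open>k0\<close> is at least \<open>k / (2 * N)\<close>.\<close>
  define \<nu> where "\<nu> = \<mu> / (2 * real N)"
  have \<nu>: "0 < \<nu>" using \<mu> N by (simp add: \<nu>_def)
  define e where "e = (1 - \<theta>) / (1 - 2 * \<theta>)"
  have e: "e \<le> 0" unfolding e_def using \<theta> by (intro divide_nonneg_nonpos) auto
  \<comment> \<open>This identity of exponents converts linear growth of
    \<open>V k powr (- p)\<close>, raised to the power \<open>e\<close>, into the claimed decay of
    \<open>V k powr (1 - \<theta>)\<close>.\<close>
  have pe: "- p * e = 1 - \<theta>" using \<theta> by (simp add: e_def p_def field_simps)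
  have "V k powr (1 - \<theta>) \<le> \<nu> powr e * real k powr e" if "k \<ge> 2 * k0 + 2 * N" for k
  proof -
    define j where "j = (k - k0) div N"
    have "(k - k0) mod N < N" using N by simp
    moreover have "k - k0 = j * N + (k - k0) mod N" by (simp add: j_def)
    ultimately have j: "k0 + j * N \<le> k" "k \<le> j * N + (k0 + N)" using that by linarith+
    have "real k \<le> real (j * (2 * N))" unfolding of_nat_le_iff using j(2) that by linarith
    then have "\<nu> * real k \<le> real j * \<mu>" using \<mu> N by (simp add: \<nu>_def field_simps)
    also have "\<dots> \<le> V (k0 + j * N) powr (- p)" by (rule it)
    also have "\<dots> \<le> V k powr (- p)" using V(2)[OF j(1)] pos p by (intro powr_mono2') auto
    finally have "(V k powr (- p)) powr e \<le> (\<nu> * real k) powr e"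
      using e \<nu> that N by (intro powr_mono2') auto
    then show ?thesis using \<nu> by (simp only: powr_powr pe) (simp add: powr_mult)
  qed
  then show ?thesis using \<nu>
    by (intro exI[of _ "\<nu> powr e"]) (auto simp: e_def eventually_sequentially)
qed

text \<open>At \<theta> = 1/2 the recursion is the linear contraction
  \<open>V (k + N) \<le> c / (1 + c) * V k\<close>, and the rate is that of the square root of
  \<open>V\<close>. Otherwise it is the sublinear case.\<close>

lemma powr_recursion_rate:
  fixes V :: "nat \<Rightarrow> real"
  assumes V: "\<And>k. 0 \<le> V k" "\<And>k l. k \<le> l \<Longrightarrow> V l \<le> V k" and \<theta>: "1/2 \<le> \<theta>" "\<theta> < 1"
    and c: "0 < c" and N: "0 < N"
    and ev: "\<forall>\<^sub>F k in sequentially. V (k + N) powr (2 * \<theta>) \<le> c * (V k - V (k + N))"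
  shows "\<exists>C>0. \<exists>\<rho>. 0 < \<rho> \<and> \<rho> < 1 \<and>
    (\<forall>\<^sub>F k in sequentially. V k powr (1 - \<theta>) \<le> C * kl_rate \<theta> \<rho> k)"
proof (cases "\<theta> = 1/2")
  case True
  have "\<exists>C>0. \<exists>\<rho>. 0 < \<rho> \<and> \<rho> < 1 \<and> (\<forall>\<^sub>F k in sequentially. V k powr (1/2) \<le> C * \<rho> ^ k)"
  proof (rule linear_rate[OF _ _ _ _ N])
    show "\<forall>\<^sub>F k in sequentially. V (k + N) powr (1/2) \<le> (c / (1 + c)) powr (1/2) * V k powr (1/2)"
      using ev
    proof eventually_elim
      case (elim k)
      then have "V (k + N) \<le> c / (1 + c) * V k" using True V(1)[of "k + N"] c by (simp add: field_simps)
      then have "V (k + N) powr (1/2) \<le> (c / (1 + c) * V k) powr (1/2)"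
        using V(1) by (intro powr_mono2) auto
      also have "\<dots> = (c / (1 + c)) powr (1/2) * V k powr (1/2)"
        using V(1) c by (intro powr_mult)
      finally show ?case .
    qed
    show "(c / (1 + c)) powr (1/2) < 1"
      using c powr_less_mono2[of "1/2" "c / (1 + c)" 1] by simp
  qed (use V c in \<open>auto intro: powr_mono2\<close>)
  moreover have "1 - \<theta> = 1/2" using True by simp
  ultimately show ?thesis using True by (simp only: kl_rate_def if_True refl)
next
  case False
  then have "\<exists>C>0. \<forall>\<^sub>F k in sequentially. V k powr (1 - \<theta>) \<le> C * real k powr ((1 - \<theta>) / (1 - 2 * \<theta>))"
    using \<theta> by (intro sublinear_rate[OF V _ _ c N ev]) auto
  \<comment> \<open>Any base in (0,1) may be the witness in the power regime; 1/2 is taken.\<close>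
  then have "\<exists>C>0. \<forall>\<^sub>F k in sequentially. V k powr (1 - \<theta>) \<le> C * kl_rate \<theta> (1/2) k"
    using False by (simp add: kl_rate_def)
  then show ?thesis by (metis half_gt_zero_iff zero_less_one field_sum_of_halves less_add_same_cancel1)
qed

text \<open>Telescoping with stride \<open>M\<close>: at most the first \<open>M\<close> terms
  survive, each bounded by \<open>E 0\<close>.\<close>

lemma sum_diff_shift_le:
  fixes E :: "nat \<Rightarrow> real"
  assumes "\<And>k. 0 \<le> E k" "\<And>k l. k \<le> l \<Longrightarrow> E l \<le> E k"
  shows "(\<Sum>j<n. E j - E (j + M)) \<le> real M * E 0"
proof -
  have split: "(\<Sum>j<M + n. E j) = (\<Sum>j<M. E j) + (\<Sum>j<n. E (j + M))"
    by (induction n) (simp_all add: ac_simps)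
  have "(\<Sum>j<n. E j) \<le> (\<Sum>j<M + n. E j)" using assms(1) by (intro sum_mono2) auto
  moreover have "(\<Sum>j<M. E j) \<le> real M * E 0" using assms(2) sum_bounded_above[of "{..<M}" E "E 0"] by simp
  ultimately show ?thesis by (simp add: sum_subtractf split)
qed

section \<open>Decay of the tail sums under a power-type KL inequality\<close>

context nonmonotone_descent
begin

text \<open>AM-GM for the product of \<open>V k powr \<theta>\<close> and
  \<open>4 / \<alpha> * (V k - V (Suc k)) * V k powr (- \<theta>)\<close>; the second factor is, up
  to a constant, the tangent increment of \<open>t powr (1 - \<theta>)\<close>.\<close>

lemma s_le_if_notin_K1:
  assumes "k \<notin> K1_set m \<alpha> U z" and \<theta>: "\<theta> < 1" "0 < \<theta>"
  shows "s k \<le> V k powr \<theta> + 1 / (\<alpha> * (1 - \<theta>)) * (V k powr (1 - \<theta>) - V (Suc k) powr (1 - \<theta>))"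
proof (cases "V k = 0")
  \<comment> \<open>\<open>0 powr t\<close> is 0, so the factorization needs \<open>V k > 0\<close>;
    if \<open>V k\<close> vanishes, so does the step.\<close>
  case True
  moreover have "V (Suc k) = 0" using V_antimono[of k "Suc k"] V_nonneg[of "Suc k"] True by simp
  ultimately have "(s k)\<^sup>2 \<le> 0" using s_sq_le_if_notin_K1[OF assms(1)] by simp
  then show ?thesis using True \<open>V (Suc k) = 0\<close> by simp
next
  case False
  then have pos: "0 < V k" using V_nonneg[of k] by linarith
  have d: "0 \<le> V k - V (Suc k)" using V_antimono[of k "Suc k"] by simp
  have "s k \<le> 1 * V k powr \<theta> + (4 / \<alpha> * (V k - V (Suc k)) * V k powr (- \<theta>)) / (4 * 1)"
  proof (rule le_weighted_AM_GM)
    have "V k powr \<theta> * V k powr (- \<theta>) = 1" using pos False by (simp flip: powr_add)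
    moreover have "V k powr \<theta> * (4 / \<alpha> * (V k - V (Suc k)) * V k powr (- \<theta>)) =
        4 / \<alpha> * (V k - V (Suc k)) * (V k powr \<theta> * V k powr (- \<theta>))"
      by (simp only: mult_ac)
    ultimately have "V k powr \<theta> * (4 / \<alpha> * (V k - V (Suc k)) * V k powr (- \<theta>)) =
        4 / \<alpha> * (V k - V (Suc k))" by (simp only: mult_1_right)
    then show "(s k)\<^sup>2 \<le> V k powr \<theta> * (4 / \<alpha> * (V k - V (Suc k)) * V k powr (- \<theta>))"
      using s_sq_le_if_notin_K1[OF assms(1)] by (simp only:)
  qed (use \<alpha>_pos d in auto)
  also have "(4 / \<alpha> * (V k - V (Suc k)) * V k powr (- \<theta>)) / (4 * 1)
      = 1 / (\<alpha> * (1 - \<theta>)) * ((1 - \<theta>) * V k powr (1 - \<theta> - 1) * (V k - V (Suc k)))"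
    using \<theta> \<alpha>_pos by (simp add: divide_simps)
  also have "\<dots> \<le> 1 / (\<alpha> * (1 - \<theta>)) * (V k powr (1 - \<theta>) - V (Suc k) powr (1 - \<theta>))"
    using \<theta> \<alpha>_pos pos d V_nonneg by (intro mult_left_mono powr_tangent_le) auto
  finally show ?thesis by simp
qed

text \<open>Not being in \<open>K2_set\<close> makes the deficit at least \<alpha>/4 times the step
  to the power 1/\<theta>. Not being in \<open>K31_set\<close> allows at most half of that amount to
  lie below \<omega>, so the other half lies above \<omega> and is bounded by
  \<open>V (Suc k)\<close>.\<close>

lemma s_le_if_notin_K2_K31:
  assumes K1: "k \<in> K1_set m \<alpha> U z" and K: "k \<notin> K2_set m \<alpha> \<theta> U z \<union> K31_set m \<alpha> \<theta> \<omega> U z"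
    and \<theta>: "0 < \<theta>"
  shows "s k \<le> (8 / \<alpha>) powr \<theta> * V k powr \<theta>"
proof -
  have "\<alpha> / 4 * s k powr (1 / \<theta>) \<le> W (Suc k) - U (Suc k)"
    using K1 K by (auto simp: K1_set_def K2_set_def)
  moreover have "\<omega> - U (Suc k) \<le> \<alpha> / 8 * s k powr (1 / \<theta>)"
    using K1 K by (auto simp: K31_set_def)
  ultimately have "\<alpha> / 8 * s k powr (1 / \<theta>) \<le> V (Suc k)" by linarith
  also have "\<dots> \<le> V k" by (rule V_antimono) simp
  finally have "s k powr (1 / \<theta>) \<le> 8 / \<alpha> * V k" using \<alpha>_pos by (simp add: field_simps)
  then have "(s k powr (1 / \<theta>)) powr \<theta> \<le> (8 / \<alpha> * V k) powr \<theta>"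
    using \<theta> by (intro powr_mono2) auto
  moreover have "(s k powr (1 / \<theta>)) powr \<theta> = s k" using \<theta> by (simp add: powr_powr)
  ultimately show ?thesis by (simp only: powr_mult)
qed

text \<open>Each late step is at most a decrement of \<open>V powr (1 - \<theta>)\<close> over a
  fixed stride, plus a term \<open>t\<close> supported on \<open>K\<close>. The tail from
  \<open>k\<close> thus sums to a multiple of \<open>E (k - N)\<close> plus the assumed tail over
  \<open>K\<close>, and both decay at the required rate.\<close>

lemma step_sums_rate_if_KL:
  assumes \<theta>: "1/2 \<le> \<theta>" "\<theta> < 1" and B: "0 < B"
    and KL: "\<forall>\<^sub>F k in sequentially. \<omega> < U (Suc k) \<longrightarrow> (U (Suc k) - \<omega>) powr \<theta> \<le> B * s k"
    and K_def: "K = K2_set m \<alpha> \<theta> U z \<union> K31_set m \<alpha> \<theta> \<omega> U z"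
    and h_def: "h = (\<lambda>j. sqrt (U (ell m U (Suc j)) - U (Suc j)))"
    and tail: "\<And>k. k \<ge> k0 \<Longrightarrow> h summable_on {j \<in> K. k \<le> j} \<and> infsum h {j \<in> K. k \<le> j} \<le> \<gamma> * kl_rate \<theta> \<tau> k"
    and \<gamma>: "0 < \<gamma>" and \<tau>: "0 < \<tau>" "\<tau> < 1"
  shows "summable s \<and> (\<exists>\<gamma>>0. \<exists>\<rho>. 0 < \<rho> \<and> \<rho> < 1 \<and>
    (\<forall>\<^sub>F k in sequentially. (\<Sum>j. s (k + j)) \<le> \<gamma> * kl_rate \<theta> \<rho> k))"
proof -
  define N where "N = Suc m"
  define E where "E k = V k powr (1 - \<theta>)" for k
  define t where "t k = (if k \<in> K then 2 / sqrt \<alpha> * h k else 0)" for k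
  have h0: "0 \<le> h k" for k using U_le_W by (simp add: h_def)
  have t0: "0 \<le> t k" for k using h0 \<alpha>_pos by (simp add: t_def)
  have E0: "0 \<le> E k" for k by (simp add: E_def)
  have E_anti: "E l \<le> E k" if "k \<le> l" for k l
    unfolding E_def using that \<theta> V_nonneg V_antimono by (intro powr_mono2) auto
  have t_sums: "summable (\<lambda>j. t (k + j)) \<and> (\<Sum>j. t (k + j)) \<le> 2 / sqrt \<alpha> * (\<gamma> * kl_rate \<theta> \<tau> k)"
    if k: "k \<ge> k0" for k
  proof -
    let ?S = "{j \<in> K. k \<le> j}"
    have "(h has_sum infsum h ?S) ?S" using tail[OF k] by simp
    then have "((\<lambda>j. 2 / sqrt \<alpha> * h j) has_sum 2 / sqrt \<alpha> * infsum h ?S) ?S"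
      by (rule has_sum_cmult_right)
    also have "?this \<longleftrightarrow> (t has_sum 2 / sqrt \<alpha> * infsum h ?S) {k..}"
      by (rule has_sum_cong_neutral) (auto simp: t_def)
    also have "{k..} = range (\<lambda>j. k + j)" by (auto simp: image_iff le_iff_add)
    also have "(t has_sum 2 / sqrt \<alpha> * infsum h ?S) (range (\<lambda>j. k + j)) \<longleftrightarrow>
        ((\<lambda>j. t (k + j)) has_sum 2 / sqrt \<alpha> * infsum h ?S) UNIV"
      by (subst has_sum_reindex) (auto simp: o_def)
    finally have "(\<lambda>j. t (k + j)) sums (2 / sqrt \<alpha> * infsum h ?S)" by (rule has_sum_imp_sums)
    moreover have "2 / sqrt \<alpha> * infsum h ?S \<le> 2 / sqrt \<alpha> * (\<gamma> * kl_rate \<theta> \<tau> k)"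
      using tail[OF k] \<alpha>_pos by (intro mult_left_mono) auto
    ultimately show ?thesis by (auto simp: sums_iff)
  qed
  define c where "c = 2 / \<alpha> * B\<^sup>2"
  have c: "0 < c" using B \<alpha>_pos by (simp add: c_def)
  have rec: "\<forall>\<^sub>F k in sequentially. V k powr (2 * \<theta>) \<le> c * (V (k - N) - V k)"
  proof -
    have "\<forall>\<^sub>F k in sequentially. \<omega> < U (Suc (ell m U k - 1)) \<longrightarrow>
        (U (Suc (ell m U k - 1)) - \<omega>) powr \<theta> \<le> B * s (ell m U k - 1)"
      using eventually_compose_filterlim[OF KL filterlim_ell[of 1]] .
    moreover have "\<forall>\<^sub>F k in sequentially. N < k" by (rule eventually_gt_at_top)
    ultimately show ?thesis
    proof eventually_elim
      case (elim k)
      \<comment> \<open>Descent at \<open>i\<close> bounds the squared step by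
        \<open>V i - V k\<close> up to a factor, because \<open>U (Suc i) = W k\<close>; as
        \<open>k - N \<le> i\<close>, the varying stride may be replaced by
        \<open>N\<close>.\<close>
      define i where "i = ell m U k - 1"
      have i: "Suc i = ell m U k" "k - N \<le> i" using ell_in[of m U k] elim(2) by (auto simp: i_def N_def)
      have Vi: "V i \<le> V (k - N)" using i by (intro V_antimono)
      show ?case
      proof (cases "V k = 0")
        case True
        then show ?thesis using V_nonneg[of "k - N"] c by simp
      next
        case False
        then have "\<omega> < W k" using \<omega>_le_W[of k] by linarith
        then have "V k powr \<theta> \<le> B * s i" using elim(1) i by (simp add: i_def)
        then have "(V k powr \<theta>)\<^sup>2 \<le> (B * s i)\<^sup>2" by (intro power_mono) auto
        also have "\<dots> = B\<^sup>2 * (s i)\<^sup>2" by (simp add: power_mult_distrib)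
        also have "\<dots> \<le> B\<^sup>2 * (2 / \<alpha> * (V i - V k))"
          using descent[of i] \<alpha>_pos i(1) by (intro mult_left_mono) (simp_all add: field_simps)
        also have "\<dots> = c * (V i - V k)" by (simp add: c_def)
        also have "\<dots> \<le> c * (V (k - N) - V k)" using Vi c by simp
        finally have "(V k powr \<theta>)\<^sup>2 \<le> c * (V (k - N) - V k)" .
        moreover have "(V k powr \<theta>)\<^sup>2 = V k powr (2 * \<theta>)"
          by (metis mult_2 powr_add power2_eq_square)
        ultimately show ?thesis by simp
      qed
    qed
  qed
  obtain C1 \<rho>1 where C1: "0 < C1" and \<rho>1: "0 < \<rho>1" "\<rho>1 < 1"
    and rate: "\<forall>\<^sub>F k in sequentially. E k \<le> C1 * kl_rate \<theta> \<rho>1 k"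
  proof -
    have "\<forall>\<^sub>F k in sequentially. V (k + N) powr (2 * \<theta>) \<le> c * (V k - V (k + N))"
      using sequentially_offset[OF rec, of N] by simp
    from powr_recursion_rate[OF V_nonneg V_antimono \<theta> c _ this] show thesis
      using that unfolding E_def N_def by blast
  qed
  define C2 where "C2 = c * 2 powr \<theta> / (1 - \<theta>) + 1 / (1 - 2 powr (\<theta> - 1))"
  have "2 powr (\<theta> - 1) < (1::real)" using \<theta> powr_less_mono[of "\<theta> - 1" 0 "2::real"] by simp
  then have C2: "0 \<le> C2" using c \<theta> by (simp add: C2_def)
  \<comment> \<open>\<open>1\<close> and \<open>(8 / \<alpha>) powr \<theta>\<close> are the factors
    of \<open>V k powr \<theta>\<close> for the two kinds of steps outside \<open>K\<close>,
    \<open>C2\<close> converts this power into a decrement of \<open>E\<close>, and the last summand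
    comes from AM-GM outside \<open>K1_set\<close>.\<close>
  define C3 where "C3 = (1 + (8 / \<alpha>) powr \<theta>) * C2 + 1 / (\<alpha> * (1 - \<theta>))"
  have C3: "0 < C3" using C2 \<alpha>_pos \<theta> by (simp add: C3_def add_nonneg_pos)
  have main: "\<forall>\<^sub>F k in sequentially. s k \<le> C3 * (E (k - N) - E (Suc k)) + t k"
  proof -
    have "\<forall>\<^sub>F k in sequentially. V k < 1" using V_tendsto by (rule order_tendstoD) simp
    then have "\<forall>\<^sub>F k in sequentially. V (k - N) < 1"
      by (rule eventually_compose_filterlim[OF _ filterlim_minus_const_nat_at_top])
    then show ?thesis using rec
    proof eventually_elim
      case (elim k)
      define A where "A = (8 / \<alpha>) powr \<theta>"
      define D where "D = 1 / (\<alpha> * (1 - \<theta>))"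
      have A: "0 \<le> A" by (simp add: A_def)
      have D: "0 \<le> D" using \<alpha>_pos \<theta> by (simp add: D_def)
      have C3_eq: "C3 = (1 + A) * C2 + D" by (simp add: C3_def A_def D_def)
      have E_k: "E (Suc k) \<le> E k" "E k \<le> E (k - N)" by (auto intro: E_anti)
      have "V k powr \<theta> \<le> C2 * (E (k - N) - E k)"
        unfolding C2_def E_def
        using elim \<theta> c V_nonneg V_antimono by (intro powr_le_powr_diff) auto
      also have "\<dots> \<le> C2 * (E (k - N) - E (Suc k))"
        using C2 E_k by (intro mult_left_mono) auto
      finally have "(1 + A) * V k powr \<theta> \<le> (1 + A) * (C2 * (E (k - N) - E (Suc k)))"
        using A by (intro mult_left_mono) auto
      moreover have "D * (E k - E (Suc k)) \<le> D * (E (k - N) - E (Suc k))"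
        using D E_k by (intro mult_left_mono) auto
      ultimately have "(1 + A) * V k powr \<theta> + D * (E k - E (Suc k))
          \<le> C3 * (E (k - N) - E (Suc k))"
        unfolding C3_eq distrib_right[of "(1 + A) * C2"] mult.assoc[of "1 + A"] by (rule add_mono)
      moreover have "s k \<le> (1 + A) * V k powr \<theta> + D * (E k - E (Suc k)) + t k"
      proof -
        have nn: "0 \<le> D * (E k - E (Suc k))" "0 \<le> A * V k powr \<theta>"
          using D A E_k by simp_all
        consider "k \<notin> K1_set m \<alpha> U z" | "k \<in> K" | "k \<in> K1_set m \<alpha> U z" "k \<notin> K" by blast
        then show ?thesis
        proof cases
          case 1
          have "s k \<le> V k powr \<theta> + D * (E k - E (Suc k))"
            unfolding D_def E_def using 1 \<theta> by (intro s_le_if_notin_K1) auto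
          then show ?thesis using nn t0[of k] by (simp add: distrib_right)
        next
          case 2
          then have "k \<in> K1_set m \<alpha> U z" unfolding K_def K1_set_def K2_set_def K31_set_def by blast
          then have "s k \<le> t k"
            using 2 s_le_sqrt_if_in_K1[of k] unfolding t_def h_def by simp
          then show ?thesis using nn unfolding distrib_right mult_1 using powr_ge_zero[of "V k" \<theta>] by linarith
        next
          case 3
          then have "s k \<le> A * V k powr \<theta>"
            unfolding A_def K_def using \<theta> by (intro s_le_if_notin_K2_K31) auto
          also have "\<dots> \<le> (1 + A) * V k powr \<theta>" by (simp add: distrib_right)
          finally show ?thesis using nn t0[of k] by simp
        qed
      qed
      ultimately show ?case by linarith
    qed
  qed
  then obtain k1 where k1: "\<And>k. k \<ge> k1 \<Longrightarrow> s k \<le> C3 * (E (k - N) - E (Suc k)) + t k"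
    unfolding eventually_sequentially by blast
  define k2 where "k2 = max k0 (max k1 N)"
  have sums: "summable (\<lambda>j. s (k + j)) \<and> (\<Sum>j. s (k + j)) \<le>
      C3 * (real (Suc N) * E (k - N)) + 2 / sqrt \<alpha> * (\<gamma> * kl_rate \<theta> \<tau> k)" if k: "k \<ge> k2" for k
  proof -
    have "(\<Sum>j<n. s (k + j)) \<le> C3 * (real (Suc N) * E (k - N)) + 2 / sqrt \<alpha> * (\<gamma> * kl_rate \<theta> \<tau> k)" for n
    proof -
      have "s (k + j) \<le> C3 * (E (k - N + j) - E (k - N + (j + Suc N))) + t (k + j)" for j
      proof -
        \<comment> \<open>As \<open>k \<ge> N\<close>, the subtraction is not truncated, and the
          decrement spans \<open>Suc N\<close> places.\<close>
        have eq: "k + j - N = k - N + j" "Suc (k + j) = k - N + (j + Suc N)"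
          using k by (auto simp: k2_def)
        show ?thesis using k1[of "k + j"] k unfolding eq by (simp add: k2_def)
      qed
      then have "(\<Sum>j<n. s (k + j)) \<le>
          (\<Sum>j<n. C3 * (E (k - N + j) - E (k - N + (j + Suc N))) + t (k + j))"
        by (intro sum_mono)
      also have "\<dots> = C3 * (\<Sum>j<n. E (k - N + j) - E (k - N + (j + Suc N))) + (\<Sum>j<n. t (k + j))"
        by (simp only: sum.distrib sum_distrib_left)
      also have "\<dots> \<le> C3 * (real (Suc N) * E (k - N)) + (\<Sum>j. t (k + j))"
      proof (rule add_mono)
        have "(\<Sum>j<n. E (k - N + j) - E (k - N + (j + Suc N))) \<le> real (Suc N) * E (k - N + 0)"
          by (rule sum_diff_shift_le[where E = "\<lambda>j. E (k - N + j)"]) (rule E0, rule E_anti, simp)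
        then show "C3 * (\<Sum>j<n. E (k - N + j) - E (k - N + (j + Suc N))) \<le> C3 * (real (Suc N) * E (k - N))"
          unfolding add_0_right by (rule mult_left_mono) (rule less_imp_le[OF C3])
        have "summable (\<lambda>j. t (k + j))" using t_sums[of k] k by (simp add: k2_def)
        then show "(\<Sum>j<n. t (k + j)) \<le> (\<Sum>j. t (k + j))"
          using t0 by (intro sum_le_suminf) auto
      qed
      also have "(\<Sum>j. t (k + j)) \<le> 2 / sqrt \<alpha> * (\<gamma> * kl_rate \<theta> \<tau> k)"
        using t_sums[of k] k by (simp add: k2_def)
      finally show ?thesis by simp
    qed
    then show ?thesis by (intro conjI summableI_nonneg_bounded suminf_le_const) auto
  qed
  have "summable s" using sums[of k2] summable_iff_shift[of s k2] by (simp add: add.commute)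
  moreover have "\<exists>\<gamma>>0. \<exists>\<rho>. 0 < \<rho> \<and> \<rho> < 1 \<and>
    (\<forall>\<^sub>F k in sequentially. (\<Sum>j. s (k + j)) \<le> \<gamma> * kl_rate \<theta> \<rho> k)"
  proof -
    obtain C4 where C4: "0 < C4" "\<forall>\<^sub>F k in sequentially. kl_rate \<theta> \<rho>1 (k - N) \<le> C4 * kl_rate \<theta> \<rho>1 k"
      using kl_rate_shift[OF \<theta> \<rho>1(1)] by blast
    \<comment> \<open>The larger base dominates both the decay of \<open>E\<close> and the assumed
      tail.\<close>
    define \<rho> where "\<rho> = max \<rho>1 \<tau>"
    define G where "G = C3 * (real (Suc N) * (C1 * C4)) + 2 / sqrt \<alpha> * \<gamma>"
    have "0 < G" using C3 C1 C4(1) \<gamma> \<alpha>_pos unfolding G_def by (intro add_pos_pos mult_pos_pos) auto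
    have "\<forall>\<^sub>F k in sequentially. E (k - N) \<le> C1 * kl_rate \<theta> \<rho>1 (k - N)"
      using eventually_compose_filterlim[OF rate filterlim_minus_const_nat_at_top] .
    moreover have "\<forall>\<^sub>F k in sequentially. k2 \<le> k" by (rule eventually_ge_at_top)
    ultimately have "\<forall>\<^sub>F k in sequentially. (\<Sum>j. s (k + j)) \<le> G * kl_rate \<theta> \<rho> k"
      using C4(2)
    proof eventually_elim
      case (elim k)
      have "C1 * kl_rate \<theta> \<rho>1 (k - N) \<le> C1 * (C4 * kl_rate \<theta> \<rho>1 k)"
        using C1 elim by simp
      also have "\<dots> \<le> C1 * (C4 * kl_rate \<theta> \<rho> k)"
        using C1 C4 \<rho>1 kl_rate_mono[of \<rho>1 \<rho> \<theta> k] by (simp add: \<rho>_def)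
      finally have E': "E (k - N) \<le> C1 * (C4 * kl_rate \<theta> \<rho> k)" using elim by simp
      have "(\<Sum>j. s (k + j)) \<le> C3 * (real (Suc N) * E (k - N)) + 2 / sqrt \<alpha> * (\<gamma> * kl_rate \<theta> \<tau> k)"
        using sums elim by blast
      also have "\<dots> \<le> C3 * (real (Suc N) * (C1 * (C4 * kl_rate \<theta> \<rho> k)))
          + 2 / sqrt \<alpha> * (\<gamma> * kl_rate \<theta> \<rho> k)"
        using E' C3 \<alpha>_pos \<gamma> \<tau> kl_rate_mono[of \<tau> \<rho> \<theta> k]
        by (intro add_mono mult_left_mono) (auto simp: \<rho>_def)
      also have "\<dots> = G * kl_rate \<theta> \<rho> k" by (simp add: G_def distrib_right mult.assoc)
      finally show ?case .
    qed
    moreover have "0 < \<rho>" "\<rho> < 1" using \<rho>1 \<tau> by (auto simp: \<rho>_def)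
    ultimately show ?thesis using \<open>0 < G\<close> by blast
  qed
  ultimately show ?thesis by blast
qed

end

section \<open>Subgradients, proximal points and KL functions\<close>

text \<open>Clearing the denominator of the difference quotient gives a local first-order minorant
  up to \<open>\<epsilon> * norm (w - x)\<close>. It also holds at \<open>w = x\<close>, so plain
  neighbourhoods replace punctured ones and composition with continuous maps becomes possible.
  \<open>regular_subdiffD\<close> is the converse.\<close>

lemma regular_subdiffI:
  fixes h :: "'a::real_inner \<Rightarrow> ereal"
  assumes hx: "h x = ereal c"
    and ev: "\<And>\<epsilon>. 0 < \<epsilon> \<Longrightarrow> \<forall>\<^sub>F w in nhds x. ereal (c + v \<bullet> (w - x) - \<epsilon> * norm (w - x)) \<le> h w"
  shows "v \<in> regular_subdiff h x"
proof -
  have "\<forall>\<^sub>F w in at x. e < (h w - h x - ereal (v \<bullet> (w - x))) / ereal (norm (w - x))"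
    if e: "e < 0" for e :: ereal
  proof -
    obtain d where d: "e < d" "d < 0" using dense[OF e] by blast
    then obtain r where r: "d = ereal r" "r < 0" by (cases d) auto
    have "\<forall>\<^sub>F w in at x. w \<noteq> x \<and> ereal (c + v \<bullet> (w - x) - (- r) * norm (w - x)) \<le> h w"
      using ev[of "- r"] r by (simp add: eventually_at_filter eventually_mono)
    then show ?thesis
    proof eventually_elim
      case (elim w)
      then have n: "0 < norm (w - x)" by simp
      show ?case
      proof (cases "h w")
        case (real b)
        then have "r * norm (w - x) \<le> b - c - v \<bullet> (w - x)" using elim by simp
        then have "r \<le> (b - c - v \<bullet> (w - x)) / norm (w - x)" using n by (simp add: field_simps)
        then show ?thesis using d(1) r real hx n by (simp add: less_le_trans)
      next
        case PInf
        then show ?thesis using n hx e by (cases e) auto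
      next
        case MInf
        then show ?thesis using elim by simp
      qed
    qed
  qed
  then have "0 \<le> Liminf (at x) (\<lambda>w. (h w - h x - ereal (v \<bullet> (w - x))) / ereal (norm (w - x)))"
    unfolding le_Liminf_iff by blast
  then show ?thesis using hx by (simp add: regular_subdiff_def edom_def)
qed

lemma regular_subdiff_subset_subdiff: "regular_subdiff h x \<subseteq> subdiff h x"
proof
  fix v assume "v \<in> regular_subdiff h x"
  then show "v \<in> subdiff h x"
    unfolding subdiff_def
    by (intro CollectI conjI exI[where x = "\<lambda>_. x"] exI[where x = "\<lambda>_. v"])
      (auto simp: regular_subdiff_def)
qed

lemma edist_set_le_norm: "v \<in> S \<Longrightarrow> edist_set 0 S \<le> ereal (norm v)"
  unfolding edist_set_def by (rule INF_lower2) auto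

lemma prox_finite:
  assumes "z \<in> prox \<tau> h c" and "proper h"
  shows "\<bar>h z\<bar> \<noteq> \<infinity>"
proof -
  obtain w where w: "h w < \<infinity>" using assms(2) by (auto simp: proper_def edom_def)
  have "\<not> ereal (1 / (2 * \<tau>) * (norm (w - c))\<^sup>2) + h w < ereal (1 / (2 * \<tau>) * (norm (z - c))\<^sup>2) + h z"
    using assms(1) by (auto simp: prox_def is_arg_min_def)
  then have "h z \<noteq> \<infinity>" using w by (cases "h w") auto
  moreover have "h z \<noteq> - \<infinity>" using assms(2) by (simp add: proper_def)
  ultimately show ?thesis by (cases "h z") auto
qed

text \<open>Minimality compares \<open>w\<close> with \<open>z\<close>; expanding the square of
  \<open>w - c\<close> around \<open>z\<close> leaves the slope \<open>(c - z) / \<tau>\<close>, a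
  proximal subgradient valid on the whole space.\<close>

lemma prox_quadratic_minorant:
  fixes h :: "'a::real_inner \<Rightarrow> ereal"
  assumes z: "z \<in> prox \<tau> h c" "h z = ereal r" and h: "proper h" and \<tau>: "0 < \<tau>"
  shows "ereal (r + ((1 / \<tau>) *\<^sub>R (c - z)) \<bullet> (w - z) - 1 / (2 * \<tau>) * (norm (w - z))\<^sup>2) \<le> h w"
proof (cases "h w")
  case (real b)
  have "\<not> ereal (1 / (2 * \<tau>) * (norm (w - c))\<^sup>2) + h w < ereal (1 / (2 * \<tau>) * (norm (z - c))\<^sup>2) + h z"
    using z(1) by (auto simp: prox_def is_arg_min_def)
  then have "1 / (2 * \<tau>) * (norm (z - c))\<^sup>2 + r \<le> 1 / (2 * \<tau>) * (norm (w - c))\<^sup>2 + b"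
    using real z(2) by simp
  moreover have "(norm (w - c))\<^sup>2 = (norm (z - c))\<^sup>2 + (norm (w - z))\<^sup>2 - 2 * ((c - z) \<bullet> (w - z))"
    by (simp add: power2_norm_eq_inner algebra_simps inner_commute)
  moreover have "((1 / \<tau>) *\<^sub>R (c - z)) \<bullet> (w - z) = 1 / (2 * \<tau>) * (2 * ((c - z) \<bullet> (w - z)))"
    by simp
  ultimately show ?thesis using real by (simp only: distrib_left right_diff_distrib) simp
qed (use h in \<open>auto simp: proper_def\<close>)

lemma gderiv_unique:
  fixes h :: "'a::real_inner \<Rightarrow> real"
  assumes "GDERIV h x :> D" "GDERIV h x :> D'"
  shows "D = D'"
proof -
  have "(\<lambda>v. v \<bullet> D) = (\<lambda>v. v \<bullet> D')"
    using assms has_derivative_unique unfolding gderiv_def by blast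
  then have "(D - D') \<bullet> D = (D - D') \<bullet> D'" by metis
  then show ?thesis by (metis inner_diff_right inner_eq_zero_iff right_minus_eq)
qed

lemma gradient_eqI: "GDERIV h x :> D \<Longrightarrow> gradient h x = D"
  unfolding gradient_def by (rule the_equality) (auto intro: gderiv_unique)

definition full_grad :: "('a::real_inner \<times> 'b::real_inner \<Rightarrow> real) \<Rightarrow> 'a \<times> 'b \<Rightarrow> 'a \<times> 'b" where
  "full_grad H p = (grad_x H (fst p) (snd p), grad_y H (fst p) (snd p))"

text \<open>The chain rule along the two coordinate embeddings and uniqueness of gradients identify
  the partial gradients with the components of the full one.\<close>

lemma smooth_full_grad:
  assumes "smooth H"
  shows smooth_imp_GDERIV: "GDERIV H p :> full_grad H p"
    and continuous_on_full_grad: "continuous_on UNIV (full_grad H)"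
proof -
  obtain G where G: "\<And>p. GDERIV H p :> G p" "continuous_on UNIV G"
    using assms by (auto simp: smooth_def)
  have "full_grad H p = G p" for p
  proof -
    obtain u v where p: "p = (u, v)" by (cases p)
    have d: "(H has_derivative (\<lambda>h. h \<bullet> G (u, v))) (at (u, v))"
      using G(1) by (simp add: gderiv_def)
    have "((\<lambda>x'. (x', v)) has_derivative (\<lambda>h. (h, 0))) (at u)"
      by (intro has_derivative_Pair has_derivative_ident has_derivative_const)
    from has_derivative_compose[OF this, where g = H, OF d]
    have "((\<lambda>x'. H (x', v)) has_derivative (\<lambda>h. (h, 0) \<bullet> G (u, v))) (at u)" .
    then have "GDERIV (\<lambda>x'. H (x', v)) u :> fst (G (u, v))"
      by (simp add: gderiv_def inner_prod_def)
    moreover have "((\<lambda>y'. (u, y')) has_derivative (\<lambda>h. (0, h))) (at v)"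
      by (intro has_derivative_Pair has_derivative_ident has_derivative_const)
    from has_derivative_compose[OF this, where g = H, OF d]
    have "((\<lambda>y'. H (u, y')) has_derivative (\<lambda>h. (0, h) \<bullet> G (u, v))) (at v)" .
    then have "GDERIV (\<lambda>y'. H (u, y')) v :> snd (G (u, v))"
      by (simp add: gderiv_def inner_prod_def)
    ultimately show ?thesis by (simp add: full_grad_def grad_x_def grad_y_def p gradient_eqI)
  qed
  then have "full_grad H = G" by blast
  then show "GDERIV H p :> full_grad H p" "continuous_on UNIV (full_grad H)" using G by simp_all
qed

lemma smooth_imp_continuous: "smooth H \<Longrightarrow> continuous_on UNIV H"
  unfolding smooth_def gderiv_def
  by (meson has_derivative_at_withinI has_derivative_continuous_on)

lemma eventually_in_finite_subfamily:
  fixes X :: "nat \<Rightarrow> 'a::euclidean_space"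
  assumes bdd: "bounded (range X)" and op: "\<And>A. A \<in> \<U> \<Longrightarrow> open A"
    and cluster: "\<And>p r. strict_mono r \<Longrightarrow> (X \<circ> r) \<longlonglongrightarrow> p \<Longrightarrow> \<exists>A\<in>\<U>. p \<in> A"
  shows "\<exists>\<F>\<subseteq>\<U>. finite \<F> \<and> (\<forall>\<^sub>F k in sequentially. X k \<in> \<Union>\<F>)"
proof -
  define \<T> where "\<T> = \<U> \<union> {A. open A \<and> (\<forall>\<^sub>F k in sequentially. X k \<notin> A)}"
  have cov: "\<exists>A\<in>\<T>. p \<in> A" for p
  proof (cases "\<exists>A. open A \<and> p \<in> A \<and> (\<forall>\<^sub>F k in sequentially. X k \<notin> A)")
    case False
    then have near: "\<exists>k\<ge>N. dist (X k) p < e" if "0 < e" for N e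
    proof -
      have "\<not> (\<forall>\<^sub>F k in sequentially. X k \<notin> ball p e)"
        using False that open_ball[of p e] centre_in_ball[of p e] by blast
      then show ?thesis unfolding eventually_sequentially by (auto simp: dist_commute)
    qed
    have "\<exists>r. \<forall>n. dist (X (r n)) p < 1 / real (Suc n) \<and> r n < r (Suc n)"
    proof (rule dependent_nat_choice)
      show "\<exists>k. dist (X k) p < 1 / real (Suc 0)" using near[of 1 0] by auto
      show "\<exists>l. dist (X l) p < 1 / real (Suc (Suc n)) \<and> k < l" for k n
        using near[of "1 / real (Suc (Suc n))" "Suc k"] by auto
    qed
    then obtain r where r: "\<And>n. dist (X (r n)) p < 1 / real (Suc n)" "\<And>n. r n < r (Suc n)" by blast
    have "(\<lambda>n. 1 / real (Suc n)) \<longlonglongrightarrow> 0" by (rule LIMSEQ_Suc[OF lim_1_over_n])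
    then have "(\<lambda>n. dist (X (r n)) p) \<longlonglongrightarrow> 0"
      by (rule Lim_null_comparison[rotated])
        (use r(1) in \<open>simp add: always_eventually less_imp_le\<close>)
    then have "(X \<circ> r) \<longlonglongrightarrow> p" using tendsto_dist_iff[of "\<lambda>n. X (r n)" p] by (simp add: o_def)
    moreover have "strict_mono r" using r(2) by (simp add: strict_mono_Suc_iff)
    ultimately show ?thesis using cluster by (auto simp: \<T>_def)
  qed (auto simp: \<T>_def)
  have "compact (closure (range X))" using bdd by (simp add: compact_closure)
  moreover have "closure (range X) \<subseteq> \<Union>\<T>" using cov by blast
  moreover have "\<And>A. A \<in> \<T> \<Longrightarrow> open A" using op by (auto simp: \<T>_def)
  ultimately obtain \<S> where \<S>: "\<S> \<subseteq> \<T>" "finite \<S>" "closure (range X) \<subseteq> \<Union>\<S>"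
    by (rule compactE)
  have "\<forall>\<^sub>F k in sequentially. \<forall>A\<in>\<S> - \<U>. X k \<notin> A"
    using \<S> by (intro eventually_ball_finite) (auto simp: \<T>_def)
  then have "\<forall>\<^sub>F k in sequentially. X k \<in> \<Union>(\<S> \<inter> \<U>)"
  proof eventually_elim
    case (elim k)
    have "X k \<in> \<Union>\<S>" using \<S>(3) closure_subset by blast
    then show ?case using elim by blast
  qed
  then show ?thesis using \<S>(2) by (intro exI[of _ "\<S> \<inter> \<U>"]) auto
qed

section \<open>Desingularizing functions\<close>

lemma KL_family_has_deriv:
  assumes "\<phi> \<in> KL_family \<eta>" "0 < t" "ereal t < \<eta>"
  shows "(\<phi> has_real_derivative deriv \<phi> t) (at t)"
proof -
  obtain D where "\<And>t. 0 < t \<Longrightarrow> ereal t < \<eta> \<Longrightarrow> (\<phi> has_vector_derivative D t) (at t)"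
    using assms(1) by (auto simp: KL_family_def C1_differentiable_on_def)
  then have "(\<phi> has_real_derivative D t) (at t)"
    using assms by (simp add: has_real_derivative_iff_has_vector_derivative)
  then show ?thesis using DERIV_imp_deriv by metis
qed

lemma KL_family_tangent:
  assumes \<phi>: "\<phi> \<in> KL_family \<eta>" and t: "0 < a" "ereal a < \<eta>" "0 \<le> b" "ereal b < \<eta>"
  shows "deriv \<phi> a * (a - b) \<le> \<phi> a - \<phi> b"
proof -
  let ?S = "{t. 0 \<le> t \<and> ereal t < \<eta>}"
  have conv: "convex_on ?S (\<lambda>t. - \<phi> t)" using \<phi> by (simp add: KL_family_def concave_on_def)
  obtain c where c: "a < c" "ereal c < \<eta>" using ereal_dense2[OF t(2)] by (metis less_ereal.simps(1))
  have "{0<..<c} \<subseteq> ?S"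
  proof
    fix t assume "t \<in> {0<..<c}"
    then have "0 \<le> t" "ereal t < ereal c" by auto
    then show "t \<in> ?S" using less_trans[of "ereal t" "ereal c" \<eta>] c(2) by simp
  qed
  then have int: "a \<in> interior ?S"
    using c(1) t(1) by (intro interiorI[of "{0<..<c}"]) simp_all
  have der: "((\<lambda>t. - \<phi> t) has_real_derivative - deriv \<phi> a) (at a within ?S)"
    using DERIV_minus[OF has_field_derivative_at_within[OF KL_family_has_deriv[OF \<phi> t(1,2)]]] .
  have conn: "connected ?S"
    using conv unfolding convex_on_def by (intro convex_connected) (rule conjunct1)
  have b: "b \<in> ?S" using t by simp
  have "- \<phi> b - (- \<phi> a) \<ge> - deriv \<phi> a * (b - a)"
    by (rule convex_on_imp_above_tangent[OF conv conn int b der])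
  then show ?thesis by (simp add: algebra_simps)
qed

text \<open>Add the tangent inequalities at \<open>a\<close> and at \<open>b\<close>.\<close>

lemma KL_family_deriv_antimono:
  assumes \<phi>: "\<phi> \<in> KL_family \<eta>" and t: "0 < b" "b \<le> a" "ereal a < \<eta>"
  shows "deriv \<phi> a \<le> deriv \<phi> b"
proof (cases "a = b")
  case False
  have b: "ereal b < \<eta>" using t by (metis ereal_less_eq(3) le_less_trans)
  have "deriv \<phi> a * (a - b) \<le> deriv \<phi> b * (a - b)"
    using KL_family_tangent[OF \<phi> _ t(3) _ b] KL_family_tangent[OF \<phi> t(1) b _ t(3)] t
    by (simp add: algebra_simps)
  then show ?thesis using t False by simp
qed simp

text \<open>The supremum defining M runs over pairs that differ in both components, whereas
  consecutive iterates may agree in one. Balls of positive radius have no isolated points, so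
  \<open>(u, v)\<close> is a limit of admissible points and continuity transfers the bound.\<close>

lemma Lipschitz_off_diagonal_imp_Lipschitz:
  fixes G :: "'a::euclidean_space \<times> 'b::euclidean_space \<Rightarrow> 'c::real_normed_vector"
  assumes cont: "continuous_on UNIV G" and r: "0 < r1" "0 < r2"
    and M: "\<And>u u' v v'. u \<in> cball 0 r1 \<Longrightarrow> u' \<in> cball 0 r1 \<Longrightarrow> v \<in> cball 0 r2 \<Longrightarrow> v' \<in> cball 0 r2 \<Longrightarrow>
      u \<noteq> u' \<Longrightarrow> v \<noteq> v' \<Longrightarrow> norm (G (u, v) - G (u', v')) \<le> M * norm ((u, v) - (u', v'))"
    and u: "u \<in> cball 0 r1" "u' \<in> cball 0 r1" and v: "v \<in> cball 0 r2" "v' \<in> cball 0 r2"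
  shows "norm (G (u, v) - G (u', v')) \<le> M * norm ((u, v) - (u', v'))"
proof -
  have approx: "\<exists>X. (\<forall>n. X n \<in> cball 0 r - {w'}) \<and> X \<longlonglongrightarrow> w"
    if "0 < r" "w \<in> cball 0 r" for r and w w' :: "'d::euclidean_space"
  proof -
    have "w islimpt cball 0 r" using that by (intro islimpt_subset[OF _ ball_subset_cball]) (simp add: islimpt_ball)
    then have "w islimpt (cball 0 r - {w'})" by (metis Diff_insert_absorb islimpt_insert insert_Diff Diff_empty Diff_insert0)
    then show ?thesis by (auto simp: islimpt_sequential)
  qed
  obtain X where X: "\<And>n. X n \<in> cball 0 r1 - {u'}" "X \<longlonglongrightarrow> u" using approx[OF r(1) u(1)] by blast
  obtain Y where Y: "\<And>n. Y n \<in> cball 0 r2 - {v'}" "Y \<longlonglongrightarrow> v" using approx[OF r(2) v(1)] by blast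
  have XY: "(\<lambda>n. (X n, Y n)) \<longlonglongrightarrow> (u, v)" using X Y by (intro tendsto_Pair)
  then have "(\<lambda>n. G (X n, Y n)) \<longlonglongrightarrow> G (u, v)"
    by (rule continuous_on_tendsto_compose[OF cont]) auto
  then have "(\<lambda>n. norm (G (X n, Y n) - G (u', v'))) \<longlonglongrightarrow> norm (G (u, v) - G (u', v'))"
    by (intro tendsto_intros)
  moreover have "(\<lambda>n. M * norm ((X n, Y n) - (u', v'))) \<longlonglongrightarrow> M * norm ((u, v) - (u', v'))"
    by (intro tendsto_mult tendsto_norm tendsto_diff tendsto_const XY)
  moreover have "norm (G (X n, Y n) - G (u', v')) \<le> M * norm ((X n, Y n) - (u', v'))" for n
    using X(1)[of n] Y(1)[of n] u v by (intro M) auto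
  ultimately show ?thesis by (intro LIMSEQ_le) auto
qed

text \<open>The errors of the quadratic minorants are of second order and that of the linearization
  of \<open>H\<close> is below first order; near \<open>(u, v)\<close> each fits into half of
  \<open>\<epsilon> * norm (w - (u, v))\<close>.\<close>

lemma regular_subdiff_Psi:
  fixes f :: "'a::real_inner \<Rightarrow> ereal" and g :: "'b::real_inner \<Rightarrow> ereal"
  assumes fu: "f u = ereal a" and gv: "g v = ereal b" and H: "smooth H"
    and f: "\<And>w. ereal (a + p \<bullet> (w - u) - \<kappa> * (norm (w - u))\<^sup>2) \<le> f w"
    and g: "\<And>w. ereal (b + q \<bullet> (w - v) - \<mu> * (norm (w - v))\<^sup>2) \<le> g w"
    and \<kappa>: "0 \<le> \<kappa>" "0 \<le> \<mu>"
  shows "(p + grad_x H u v, q + grad_y H u v) \<in> regular_subdiff (Psi f g H) (u, v)"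
proof (rule regular_subdiffI)
  show "Psi f g H (u, v) = ereal (a + b + H (u, v))" by (simp add: Psi_def fu gv)
  fix \<epsilon> :: real assume \<epsilon>: "0 < \<epsilon>"
  let ?G = "full_grad H (u, v)"
  have "(H has_derivative (\<lambda>h. h \<bullet> ?G)) (at (u, v))"
    using smooth_imp_GDERIV[OF H] by (simp add: gderiv_def)
  then obtain d where d: "0 < d" and dH: "\<And>w. norm (w - (u, v)) < d \<Longrightarrow>
      norm (H w - H (u, v) - (w - (u, v)) \<bullet> ?G) \<le> \<epsilon> / 2 * norm (w - (u, v))"
    unfolding has_derivative_at_alt using \<epsilon> by (metis half_gt_zero_iff)
  \<comment> \<open>Within this radius the sum of the quadratic errors is at most \<epsilon>/2 times
    the distance; the summand 1 avoids a zero denominator.\<close>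
  define e where "e = min d (\<epsilon> / (2 * (\<kappa> + \<mu> + 1)))"
  have e: "0 < e" using d \<epsilon> \<kappa> by (simp add: e_def)
  have "\<forall>\<^sub>F w in nhds (u, v). dist w (u, v) < e" using e eventually_nhds_metric by blast
  then show "\<forall>\<^sub>F w in nhds (u, v). ereal (a + b + H (u, v) + (p + grad_x H u v, q + grad_y H u v)
      \<bullet> (w - (u, v)) - \<epsilon> * norm (w - (u, v))) \<le> Psi f g H w"
  proof eventually_elim
    case (elim w)
    obtain w1 w2 where w: "w = (w1, w2)" by (cases w)
    let ?n = "norm (w - (u, v))"
    have n: "?n < d" "?n \<le> \<epsilon> / (2 * (\<kappa> + \<mu> + 1))" using elim by (simp_all add: e_def dist_norm)
    have n1: "norm (w1 - u) \<le> ?n" "norm (w2 - v) \<le> ?n"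
      using norm_fst_le[of "w1 - u" "w2 - v"] norm_snd_le[of "w2 - v" "w1 - u"] by (simp_all add: w)
    have "H w \<ge> H (u, v) + (w - (u, v)) \<bullet> ?G - \<epsilon> / 2 * ?n"
      using dH[OF n(1)] unfolding real_norm_def by linarith
    moreover have "(w - (u, v)) \<bullet> ?G = (w1 - u) \<bullet> grad_x H u v + (w2 - v) \<bullet> grad_y H u v"
      by (simp add: w full_grad_def)
    moreover have "\<kappa> * (norm (w1 - u))\<^sup>2 + \<mu> * (norm (w2 - v))\<^sup>2 \<le> \<epsilon> / 2 * ?n"
    proof -
      have "\<kappa> * (norm (w1 - u))\<^sup>2 + \<mu> * (norm (w2 - v))\<^sup>2 \<le> \<kappa> * ?n\<^sup>2 + \<mu> * ?n\<^sup>2"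
        using n1 \<kappa> by (intro add_mono mult_left_mono power_mono) auto
      also have "\<dots> \<le> ((\<kappa> + \<mu> + 1) * ?n) * ?n" by (simp add: algebra_simps power2_eq_square)
      also have "\<dots> \<le> \<epsilon> / 2 * ?n"
        using n(2) \<kappa> by (intro mult_right_mono) (simp_all add: field_simps)
      finally show ?thesis .
    qed
    ultimately have le: "a + b + H (u, v) + (p + grad_x H u v, q + grad_y H u v) \<bullet> (w - (u, v)) - \<epsilon> * ?n
       \<le> (a + p \<bullet> (w1 - u) - \<kappa> * (norm (w1 - u))\<^sup>2) + (b + q \<bullet> (w2 - v) - \<mu> * (norm (w2 - v))\<^sup>2) + H w"
      by (simp add: w inner_add_left inner_add_right inner_commute)
    have "ereal (a + p \<bullet> (w1 - u) - \<kappa> * (norm (w1 - u))\<^sup>2)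
         + ereal (b + q \<bullet> (w2 - v) - \<mu> * (norm (w2 - v))\<^sup>2) + ereal (H w) \<le> f w1 + g w2 + ereal (H w)"
      by (intro add_mono f g order_refl)
    then show ?case using le by (simp add: Psi_def w order_trans[rotated])
  qed
qed

lemma regular_subdiffD:
  fixes h :: "'a::real_inner \<Rightarrow> ereal"
  assumes v: "v \<in> regular_subdiff h x" and hx: "h x = ereal c" and \<epsilon>: "0 < \<epsilon>"
  shows "\<forall>\<^sub>F w in nhds x. ereal (c + v \<bullet> (w - x) - \<epsilon> * norm (w - x)) \<le> h w"
proof -
  have "0 \<le> Liminf (at x) (\<lambda>w. (h w - h x - ereal (v \<bullet> (w - x))) / ereal (norm (w - x)))"
    using v by (simp add: regular_subdiff_def)
  moreover have "ereal (- \<epsilon>) < 0" using \<epsilon> by simp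
  ultimately have "\<forall>\<^sub>F w in at x. ereal (- \<epsilon>) < (h w - h x - ereal (v \<bullet> (w - x))) / ereal (norm (w - x))"
    unfolding le_Liminf_iff by blast
  then have "\<forall>\<^sub>F w in nhds x. w \<noteq> x \<longrightarrow>
      ereal (- \<epsilon>) < (h w - h x - ereal (v \<bullet> (w - x))) / ereal (norm (w - x))"
    by (simp add: eventually_at_filter)
  then show ?thesis
  proof eventually_elim
    case (elim w)
    show ?case
    proof (cases "w = x")
      case False
      then have n: "0 < norm (w - x)" by simp
      show ?thesis
      proof (cases "h w")
        case (real b)
        then have "- \<epsilon> < (b - c - v \<bullet> (w - x)) / norm (w - x)" using elim False hx n by simp
        then have "- \<epsilon> * norm (w - x) < b - c - v \<bullet> (w - x)" using n by (simp only: pos_less_divide_eq)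
        then show ?thesis using real by simp
      next
        case MInf
        then show ?thesis using elim False hx n by simp
      qed simp
    qed (simp add: hx)
  qed
qed

text \<open>The penalty in \<open>Upsilon\<close> is nonnegative and vanishes at
  \<open>(u, v, u, v)\<close>, so a minorant of \<open>Psi\<close> in the first two blocks is a
  minorant of \<open>Upsilon\<close>.\<close>

lemma regular_subdiff_Upsilon_diagonal:
  fixes f :: "'a::euclidean_space \<Rightarrow> ereal" and g :: "'b::euclidean_space \<Rightarrow> ereal"
  assumes w: "(p, q) \<in> regular_subdiff (Psi f g H) (u, v)" and fin: "Psi f g H (u, v) = ereal c"
    and \<delta>: "0 \<le> \<delta>"
  shows "(p, q, 0, 0) \<in> regular_subdiff (Upsilon f g H \<delta>) (u, v, u, v)"
proof (rule regular_subdiffI)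
  show "Upsilon f g H \<delta> (u, v, u, v) = ereal c" using fin by (simp add: Upsilon_def Psi_def)
  fix \<epsilon> :: real assume \<epsilon>: "0 < \<epsilon>"
  have "((\<lambda>w. (fst w, fst (snd w))) \<longlongrightarrow> (fst (u, v, u, v), fst (snd (u, v, u, v)))) (nhds (u, v, u, v))"
    by (intro tendsto_Pair tendsto_fst tendsto_snd tendsto_ident_at filterlim_ident)
  then have lim: "filterlim (\<lambda>w. (fst w, fst (snd w))) (nhds (u, v)) (nhds (u, v, u, v))" by simp
  show "\<forall>\<^sub>F w in nhds (u, v, u, v). ereal (c + (p, q, 0, 0) \<bullet> (w - (u, v, u, v))
      - \<epsilon> * norm (w - (u, v, u, v))) \<le> Upsilon f g H \<delta> w"
    using eventually_compose_filterlim[OF regular_subdiffD[OF w fin \<epsilon>] lim]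
  proof eventually_elim
    case (elim w)
    obtain w1 w2 w3 w4 where w: "w = (w1, w2, w3, w4)" by (cases w) auto
    have "norm ((w1, w2) - (u, v)) \<le> norm (w - (u, v, u, v))"
      by (rule power2_le_imp_le) (simp_all add: w norm_Pair)
    then have "\<epsilon> * norm ((w1, w2) - (u, v)) \<le> \<epsilon> * norm (w - (u, v, u, v))" using \<epsilon> by simp
    then have "ereal (c + (p, q, 0, 0) \<bullet> (w - (u, v, u, v)) - \<epsilon> * norm (w - (u, v, u, v)))
        \<le> ereal (c + (p, q) \<bullet> ((w1, w2) - (u, v)) - \<epsilon> * norm ((w1, w2) - (u, v)))"
      by (simp add: w)
    also have "\<dots> \<le> Psi f g H (w1, w2)" using elim by (simp add: w)
    also have "\<dots> \<le> Upsilon f g H \<delta> w"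
      using \<delta> unfolding Upsilon_def Psi_def by (simp add: w add_increasing2)
    finally show ?case .
  qed
qed

text \<open>The factor \<open>1 + 2 * b\<close> originates here:
  \<open>u + \<beta> *\<^sub>R (u - v)\<close> has norm at most \<open>1 + 2 * b\<close> times a
  common bound of \<open>u\<close> and \<open>v\<close>.\<close>

lemma extrapolation_in_cball:
  fixes u v :: "'a::real_normed_vector"
  assumes "(1 + 2 * b) *\<^sub>R u \<in> cball 0 r" "(1 + 2 * b) *\<^sub>R v \<in> cball 0 r" "0 \<le> \<beta>" "\<beta> \<le> b"
  shows "u + \<beta> *\<^sub>R (u - v) \<in> cball 0 r"
proof -
  define a where "a = r / (1 + 2 * b)"
  have b: "0 < 1 + 2 * b" using assms by simp
  have "norm w \<le> a" if "(1 + 2 * b) *\<^sub>R w \<in> cball 0 r" for w :: 'a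
  proof -
    have "(1 + 2 * b) * norm w \<le> r" using that b by (simp only: mem_cball_0 norm_scaleR)
    then show ?thesis using b by (simp add: a_def pos_le_divide_eq mult.commute)
  qed
  then have uv: "norm u \<le> a" "norm v \<le> a" using assms by blast+
  have "norm (u + \<beta> *\<^sub>R (u - v)) \<le> norm u + \<beta> * norm (u - v)"
    using norm_triangle_ineq[of u "\<beta> *\<^sub>R (u - v)"] assms(3) by simp
  also have "\<dots> \<le> a + b * (a + a)"
    using uv norm_triangle_ineq4[of u v] assms norm_ge_zero[of u]
    by (intro add_mono mult_mono) auto
  also have "\<dots> = a * (1 + 2 * b)" by (simp add: algebra_simps)
  also have "\<dots> = r" using b by (simp add: a_def)
  finally show ?thesis by simp
qed

text \<open>On a ball the slope of the proximal minorant is bounded by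
  \<open>2 * R / \<tau>0 + B\<close>, and its quadratic term by \<open>R / \<tau>0\<close> times the
  distance. Hence prox values cannot exceed those at nearby points by much, a substitute for upper
  semicontinuity.\<close>

lemma prox_gradient_upper:
  fixes h :: "'a::real_inner \<Rightarrow> ereal"
  assumes z: "z \<in> prox \<tau> h (c - \<tau> *\<^sub>R G)" "h z = ereal r" and h: "proper h"
    and \<tau>: "0 < \<tau>0" "\<tau>0 \<le> \<tau>" and G: "norm G \<le> B"
    and ball: "c \<in> cball 0 R" "z \<in> cball 0 R" "w \<in> cball 0 R"
  shows "ereal r \<le> h w + ereal ((2 * R / \<tau>0 + B + R / \<tau>0) * norm (w - z))"
proof -
  let ?v = "(1 / \<tau>) *\<^sub>R (c - \<tau> *\<^sub>R G - z)"
  have R: "0 \<le> R" using ball(1) norm_ge_zero[of c] by (simp del: norm_ge_zero)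
  have v_eq: "?v = (1 / \<tau>) *\<^sub>R (c - z) - G" using \<tau> by (simp add: algebra_simps)
  have "norm ?v \<le> norm ((1 / \<tau>) *\<^sub>R (c - z)) + norm G"
    unfolding v_eq by (rule norm_triangle_ineq4)
  also have "norm ((1 / \<tau>) *\<^sub>R (c - z)) = 1 / \<tau> * norm (c - z)" using \<tau> by simp
  also have "\<dots> \<le> 1 / \<tau>0 * (2 * R)"
    using \<tau> ball norm_triangle_ineq4[of c z] by (intro mult_mono) (auto simp: frac_le)
  finally have v: "norm ?v \<le> 2 * R / \<tau>0 + B" using G by simp
  have 1: "- (2 * R / \<tau>0 + B) * norm (w - z) \<le> ?v \<bullet> (w - z)"
  proof -
    have "- (?v \<bullet> (w - z)) \<le> norm ?v * norm (w - z)" using Cauchy_Schwarz_ineq2[of ?v "w - z"] by linarith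
    also have "\<dots> \<le> (2 * R / \<tau>0 + B) * norm (w - z)" using v by (intro mult_right_mono) auto
    finally show ?thesis unfolding mult_minus_left by linarith
  qed
  have 2: "1 / (2 * \<tau>) * (norm (w - z))\<^sup>2 \<le> R / \<tau>0 * norm (w - z)"
  proof -
    have "1 / (2 * \<tau>) * norm (w - z) \<le> 1 / (2 * \<tau>0) * (2 * R)"
      using \<tau> ball norm_triangle_ineq4[of w z] by (intro mult_mono) (auto simp: frac_le)
    then have "(1 / (2 * \<tau>) * norm (w - z)) * norm (w - z) \<le> (R / \<tau>0) * norm (w - z)"
      by (intro mult_right_mono) auto
    then show ?thesis by (simp add: power2_eq_square mult.assoc)
  qed
  have "ereal (r + ?v \<bullet> (w - z) - 1 / (2 * \<tau>) * (norm (w - z))\<^sup>2) \<le> h w"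
    using \<tau> by (intro prox_quadratic_minorant z h) auto
  moreover have "r - (2 * R / \<tau>0 + B + R / \<tau>0) * norm (w - z)
      \<le> r + ?v \<bullet> (w - z) - 1 / (2 * \<tau>) * (norm (w - z))\<^sup>2"
    using 1 2 unfolding distrib_right[of "2 * R / \<tau>0 + B" "R / \<tau>0"] mult_minus_left by linarith
  ultimately have "ereal (r - (2 * R / \<tau>0 + B + R / \<tau>0) * norm (w - z)) \<le> h w"
    by (meson ereal_less_eq(3) order_trans)
  then show ?thesis by (cases "h w") auto
qed

section \<open>The iterates of PALMenls\<close>

text \<open>The line search enters through the accepted trial alone: an extrapolation parameter at
  most \<open>\<beta>max\<close>, step sizes at least \<open>\<tau>lo\<close>, and the acceptance
  test.\<close>

locale palm =
  fixes f :: "'a::euclidean_space \<Rightarrow> ereal" and g :: "'b::euclidean_space \<Rightarrow> ereal"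
    and H :: "'a \<times> 'b \<Rightarrow> real" and L2 :: "'a \<Rightarrow> real"
    and \<delta> \<alpha> \<tau>lo \<beta>max r1 r2 :: real and m :: nat
    and x :: "nat \<Rightarrow> 'a" and y :: "nat \<Rightarrow> 'b"
  assumes f: "proper f" "lsc f" "bounded_below f"
    and g: "proper g" "lsc g" "bounded_below g"
    and H: "smooth H"
    and L2: "\<And>u. (L2 u)-lipschitz_on UNIV (\<lambda>v. grad_y H u v)"
    and pos: "0 < \<delta>" "0 < \<alpha>" "0 < \<tau>lo" "0 \<le> \<beta>max"
    and start: "(x 0, y 0) \<in> edom (Psi f g H)"
    and trial: "\<And>k. \<exists>\<beta> \<tau>1 \<tau>2. 0 \<le> \<beta> \<and> \<beta> \<le> \<beta>max \<and> \<tau>lo \<le> \<tau>1 \<and> \<tau>lo \<le> \<tau>2 \<and>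
      palm_trial f g H x y k \<beta> \<tau>1 \<tau>2 (x (Suc k)) (y (Suc k))"
    and accept: "\<And>k. palm_accept f g H \<delta> \<alpha> m x y k (x (Suc k)) (y (Suc k))"
    and B1: "0 < r1" "\<And>k. (1 + 2 * \<beta>max) *\<^sub>R x k \<in> cball 0 r1"
    and B2: "0 < r2" "\<And>k. (1 + 2 * \<beta>max) *\<^sub>R y k \<in> cball 0 r2"
    and M_finite: "bdd_above {norm (grad_x H u v - grad_x H u' v') / norm ((u, v) - (u', v')) |u u' v v'.
        u \<in> cball 0 r1 \<and> u' \<in> cball 0 r1 \<and> u \<noteq> u' \<and> v \<in> cball 0 r2 \<and> v' \<in> cball 0 r2 \<and> v \<noteq> v'}"
    and L2_finite: "bdd_above (L2 ` cball 0 r1)"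
begin

abbreviation "\<Psi> \<equiv> Psi f g H"
abbreviation "z \<equiv> palm_z x y"
abbreviation "s k \<equiv> norm (z (Suc k) - z k)"

definition "fr k = real_of_ereal (f (x k))"
definition "gr k = real_of_ereal (g (y k))"
definition "P k = fr k + gr k + H (x k, y k)"
definition "U k = P k + \<delta> / 2 * (norm (x k - x (k - 1)))\<^sup>2 + \<delta> / 2 * (norm (y k - y (k - 1)))\<^sup>2"

lemma s_square: "(s k)\<^sup>2 = (norm (x (Suc k) - x k))\<^sup>2 + (norm (y (Suc k) - y k))\<^sup>2 +
   (norm (x k - x (k - 1)))\<^sup>2 + (norm (y k - y (k - 1)))\<^sup>2"
  by (simp add: palm_z_def norm_Pair)

lemma step_le_s:
  shows step_x_le: "norm (x (Suc k) - x k) \<le> s k"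
    and step_y_le: "norm (y (Suc k) - y k) \<le> s k"
    and prev_step_x_le: "norm (x k - x (k - 1)) \<le> s k"
    and prev_step_y_le: "norm (y k - y (k - 1)) \<le> s k"
  by (rule power2_le_imp_le; simp add: s_square)+

lemma step_pair_le: "norm ((x (Suc k), y (Suc k)) - (x k, y k)) \<le> s k"
  by (rule power2_le_imp_le) (simp_all add: s_square norm_Pair)

lemma in_ball_x: "x k \<in> cball 0 r1" and in_ball_y: "y k \<in> cball 0 r2"
  using extrapolation_in_cball[OF B1(2) B1(2), of 0 k k] extrapolation_in_cball[OF B2(2) B2(2), of 0 k k] pos
  by auto

lemma stepE:
  obtains \<beta> \<tau>1 \<tau>2 xt yt where
    "xt = x k + \<beta> *\<^sub>R (x k - x (k - 1))" "yt = y k + \<beta> *\<^sub>R (y k - y (k - 1))" "0 \<le> \<beta>" "\<beta> \<le> \<beta>max"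
    "\<tau>lo \<le> \<tau>1" "\<tau>lo \<le> \<tau>2" "xt \<in> cball 0 r1" "yt \<in> cball 0 r2"
    "x (Suc k) \<in> prox \<tau>1 f (xt - \<tau>1 *\<^sub>R grad_x H xt (y k))"
    "y (Suc k) \<in> prox \<tau>2 g (yt - \<tau>2 *\<^sub>R grad_y H (x (Suc k)) yt)"
proof -
  obtain \<beta> \<tau>1 \<tau>2 where *: "0 \<le> \<beta>" "\<beta> \<le> \<beta>max" "\<tau>lo \<le> \<tau>1" "\<tau>lo \<le> \<tau>2"
      "palm_trial f g H x y k \<beta> \<tau>1 \<tau>2 (x (Suc k)) (y (Suc k))"
    using trial by blast
  show thesis
    by (rule that[OF refl refl *(1-4) extrapolation_in_cball[OF B1(2) B1(2) *(1,2)]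
          extrapolation_in_cball[OF B2(2) B2(2) *(1,2)]])
      (use *(5) in \<open>simp_all add: palm_trial_def Let_def\<close>)
qed

lemma finite_values:
  shows f_x: "f (x k) = ereal (fr k)" and g_y: "g (y k) = ereal (gr k)"
proof -
  have "\<bar>f (x k)\<bar> \<noteq> \<infinity> \<and> \<bar>g (y k)\<bar> \<noteq> \<infinity>"
  proof (cases k)
    case 0
    have "f (x 0) + g (y 0) + ereal (H (x 0, y 0)) < \<infinity>" using start by (simp add: edom_def Psi_def)
    moreover have "f (x 0) \<noteq> -\<infinity>" "g (y 0) \<noteq> -\<infinity>" using f(1) g(1) by (simp_all add: proper_def)
    ultimately show ?thesis unfolding 0 by (cases "f (x 0)"; cases "g (y 0)") auto
  next
    case (Suc j)
    show ?thesis unfolding Suc using f(1) g(1) by (rule_tac stepE[of j]) (auto dest: prox_finite)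
  qed
  then show "f (x k) = ereal (fr k)" "g (y k) = ereal (gr k)"
    by (simp_all add: fr_def gr_def ereal_real)
qed

lemma Psi_eq: "\<Psi> (x k, y k) = ereal (P k)"
  by (simp add: Psi_def P_def f_x g_y)

lemma Upsilon_eq: "Upsilon f g H \<delta> (z k) = ereal (U k)"
  by (simp add: Upsilon_def U_def P_def f_x g_y palm_z_def)

lemma gradient_bound:
  obtains B where "0 \<le> B"
    "\<And>u v. u \<in> cball 0 r1 \<Longrightarrow> v \<in> cball 0 r2 \<Longrightarrow> norm (full_grad H (u, v)) \<le> B"
proof -
  have "compact (full_grad H ` (cball 0 r1 \<times> cball 0 r2))"
    by (intro compact_continuous_image compact_Times compact_cball
        continuous_on_subset[OF continuous_on_full_grad[OF H]]) auto
  then have "bounded (full_grad H ` (cball 0 r1 \<times> cball 0 r2))" by (rule compact_imp_bounded)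
  then obtain B where "0 < B" "\<And>p. p \<in> full_grad H ` (cball 0 r1 \<times> cball 0 r2) \<Longrightarrow> norm p \<le> B"
    unfolding bounded_pos by blast
  then show thesis by (intro that[of B]) auto
qed

lemma H_Lipschitz:
  obtains C where "0 \<le> C" "\<And>k. \<bar>H (x (Suc k), y (Suc k)) - H (x k, y k)\<bar> \<le> C * s k"
proof -
  obtain B where B: "0 \<le> B"
      "\<And>u v. u \<in> cball 0 r1 \<Longrightarrow> v \<in> cball 0 r2 \<Longrightarrow> norm (full_grad H (u, v)) \<le> B"
    using gradient_bound by blast
  let ?S = "cball (0::'a) r1 \<times> cball (0::'b) r2"
  have "\<bar>H (x (Suc k), y (Suc k)) - H (x k, y k)\<bar> \<le> B * s k" for k
  proof -
    have "norm (H (x (Suc k), y (Suc k)) - H (x k, y k)) \<le> B * norm ((x (Suc k), y (Suc k)) - (x k, y k))"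
    proof (rule differentiable_bound[of ?S H "\<lambda>p h. h \<bullet> full_grad H p"])
      show "convex ?S" by (intro convex_Times convex_cball)
      show "(H has_derivative (\<lambda>h. h \<bullet> full_grad H p)) (at p within ?S)" for p
        using smooth_imp_GDERIV[OF H, of p] by (simp add: gderiv_def has_derivative_at_withinI)
      show "onorm (\<lambda>h. h \<bullet> full_grad H p) \<le> B" if "p \<in> ?S" for p
      proof (rule onorm_bound[OF B(1)])
        fix h :: "'a \<times> 'b"
        have "norm (full_grad H p) \<le> B" using B(2) that by (cases p) auto
        then have "norm h * norm (full_grad H p) \<le> norm h * B" by (intro mult_left_mono) auto
        then show "norm (h \<bullet> full_grad H p) \<le> B * norm h"
          using Cauchy_Schwarz_ineq2[of h "full_grad H p"] by (simp add: mult.commute)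
      qed
    qed (use in_ball_x in_ball_y in auto)
    also have "\<dots> \<le> B * s k" using step_pair_le B(1) by (intro mult_left_mono) auto
    finally show ?thesis by simp
  qed
  then show thesis using B(1) that by blast
qed

lemma prox_step_upper:
  obtains C where "0 \<le> C"
    "\<And>k w. w \<in> cball 0 r1 \<Longrightarrow> ereal (fr (Suc k)) \<le> f w + ereal (C * norm (w - x (Suc k)))"
    "\<And>k w. w \<in> cball 0 r2 \<Longrightarrow> ereal (gr (Suc k)) \<le> g w + ereal (C * norm (w - y (Suc k)))"
proof -
  obtain B where B: "0 \<le> B"
      "\<And>u v. u \<in> cball 0 r1 \<Longrightarrow> v \<in> cball 0 r2 \<Longrightarrow> norm (full_grad H (u, v)) \<le> B"
    using gradient_bound by blast
  define C where "C r = 2 * r / \<tau>lo + B + r / \<tau>lo" for r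
  have C: "0 \<le> C r1" "0 \<le> C r2" using B pos B1(1) B2(1) by (simp_all add: C_def)
  have weaken: "h + ereal (C r * norm w) \<le> h + ereal (max (C r1) (C r2) * norm w)"
    if "r \<in> {r1, r2}" for h r and w :: "'d::real_normed_vector"
    using that by (intro add_mono order_refl) (auto intro!: mult_right_mono)
  have fx: "ereal (fr (Suc k)) \<le> f w + ereal (C r1 * norm (w - x (Suc k)))" if "w \<in> cball 0 r1" for k w
  proof (rule stepE[of k])
    fix \<beta> \<tau>1 \<tau>2 xt yt
    assume *: "\<tau>lo \<le> \<tau>1" "xt \<in> cball 0 r1" "x (Suc k) \<in> prox \<tau>1 f (xt - \<tau>1 *\<^sub>R grad_x H xt (y k))"
    have "norm (grad_x H xt (y k)) \<le> B"
      using B(2)[OF *(2) in_ball_y[of k]] norm_fst_le order_trans by (fastforce simp: full_grad_def)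
    then show ?thesis
      unfolding C_def by (rule prox_gradient_upper[OF *(3) f_x f(1) pos(3) *(1) _ *(2) in_ball_x that])
  qed
  have gy: "ereal (gr (Suc k)) \<le> g w + ereal (C r2 * norm (w - y (Suc k)))" if "w \<in> cball 0 r2" for k w
  proof (rule stepE[of k])
    fix \<beta> \<tau>1 \<tau>2 xt yt
    assume *: "\<tau>lo \<le> \<tau>2" "yt \<in> cball 0 r2" "y (Suc k) \<in> prox \<tau>2 g (yt - \<tau>2 *\<^sub>R grad_y H (x (Suc k)) yt)"
    have "norm (grad_y H (x (Suc k)) yt) \<le> B"
      using B(2)[OF in_ball_x[of "Suc k"] *(2)] norm_snd_le order_trans by (fastforce simp: full_grad_def)
    then show ?thesis
      unfolding C_def by (rule prox_gradient_upper[OF *(3) g_y g(1) pos(3) *(1) _ *(2) in_ball_y that])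
  qed
  show thesis
    by (rule that[of "max (C r1) (C r2)"])
      (use C fx gy weaken[of r1] weaken[of r2] order_trans in \<open>fastforce+\<close>)
qed

lemma grad_x_Lipschitz:
  obtains M where "0 \<le> M" "\<And>u u' v v'. u \<in> cball 0 r1 \<Longrightarrow> u' \<in> cball 0 r1 \<Longrightarrow> v \<in> cball 0 r2 \<Longrightarrow>
    v' \<in> cball 0 r2 \<Longrightarrow> norm (grad_x H u v - grad_x H u' v') \<le> M * norm ((u, v) - (u', v'))"
proof -
  obtain M where M: "\<And>u u' v v'. u \<in> cball 0 r1 \<Longrightarrow> u' \<in> cball 0 r1 \<Longrightarrow> v \<in> cball 0 r2 \<Longrightarrow>
    v' \<in> cball 0 r2 \<Longrightarrow> u \<noteq> u' \<Longrightarrow> v \<noteq> v' \<Longrightarrow>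
    norm (grad_x H u v - grad_x H u' v') / norm ((u, v) - (u', v')) \<le> M"
    using M_finite unfolding bdd_above_def by blast
  define G where "G p = grad_x H (fst p) (snd p)" for p
  have "G = (\<lambda>p. fst (full_grad H p))" by (auto simp: G_def full_grad_def)
  then have cont: "continuous_on UNIV G"
    using continuous_on_fst[OF continuous_on_full_grad[OF H]] by simp
  have "norm (G (u, v) - G (u', v')) \<le> max M 0 * norm ((u, v) - (u', v'))"
    if "u \<in> cball 0 r1" "u' \<in> cball 0 r1" "v \<in> cball 0 r2" "v' \<in> cball 0 r2" for u u' v v'
  proof (rule Lipschitz_off_diagonal_imp_Lipschitz[OF cont B1(1) B2(1) _ that])
    fix u u' v v'
    assume *: "u \<in> cball (0::'a) r1" "u' \<in> cball 0 r1" "v \<in> cball (0::'b) r2" "v' \<in> cball 0 r2" "u \<noteq> u'" "v \<noteq> v'"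
    have "0 < norm ((u, v) - (u', v'))" using *(5) by (simp add: zero_prod_def)
    then have "norm (G (u, v) - G (u', v')) \<le> M * norm ((u, v) - (u', v'))"
      using M[OF *] by (simp add: G_def pos_divide_le_eq)
    also have "\<dots> \<le> max M 0 * norm ((u, v) - (u', v'))" by (intro mult_right_mono) auto
    finally show "norm (G (u, v) - G (u', v')) \<le> max M 0 * norm ((u, v) - (u', v'))" .
  qed
  then show thesis by (intro that[of "max M 0"]) (auto simp: G_def)
qed

text \<open>Adding the partial gradients of \<open>H\<close> at the new point to the prox slopes
  leaves scaled differences between extrapolated and new points plus gradient differences, all of
  order \<open>s k\<close>. The first block moves both arguments and needs M; the second is
  evaluated at the new \<open>x\<close> already, so \<open>L2\<close> suffices.\<close>

lemma subgradient_bound: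
  obtains b where "0 < b"
    "\<And>k. \<exists>w\<in>regular_subdiff \<Psi> (x (Suc k), y (Suc k)). norm w \<le> b * s k"
proof -
  obtain M where M: "0 \<le> M" "\<And>u u' v v'. u \<in> cball 0 r1 \<Longrightarrow> u' \<in> cball 0 r1 \<Longrightarrow> v \<in> cball 0 r2 \<Longrightarrow>
    v' \<in> cball 0 r2 \<Longrightarrow> norm (grad_x H u v - grad_x H u' v') \<le> M * norm ((u, v) - (u', v'))"
    using grad_x_Lipschitz by blast
  obtain l where l: "\<And>u. u \<in> cball 0 r1 \<Longrightarrow> L2 u \<le> l" using L2_finite unfolding bdd_above_def by blast
  have l0: "0 \<le> l" using l[of "x 0"] in_ball_x lipschitz_on_nonneg[OF L2] order_trans by blast
  \<comment> \<open>From the current step plus \<open>\<beta>max\<close> times the previous one;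
    \<open>s k\<close> bounds both, since \<open>z\<close> stacks two consecutive iterates.\<close>
  define q where "q = 1 + \<beta>max"
  define b where "b = (1 / \<tau>lo * q + M * (q + 1)) + (1 / \<tau>lo * q + l * q)"
  have q: "0 < q" using pos by (simp add: q_def)
  have b0: "0 < b" unfolding b_def using pos q M l0
    by (intro add_pos_nonneg add_nonneg_nonneg mult_pos_pos mult_nonneg_nonneg) auto
  have "\<exists>w\<in>regular_subdiff \<Psi> (x (Suc k), y (Suc k)). norm w \<le> b * s k" for k
  proof (rule stepE[of k])
    fix \<beta> \<tau>1 \<tau>2 xt yt
    assume xt: "xt = x k + \<beta> *\<^sub>R (x k - x (k - 1))" and yt: "yt = y k + \<beta> *\<^sub>R (y k - y (k - 1))"
      and \<beta>: "0 \<le> \<beta>" "\<beta> \<le> \<beta>max" and \<tau>: "\<tau>lo \<le> \<tau>1" "\<tau>lo \<le> \<tau>2"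
      and ball: "xt \<in> cball 0 r1" "yt \<in> cball 0 r2"
      and px: "x (Suc k) \<in> prox \<tau>1 f (xt - \<tau>1 *\<^sub>R grad_x H xt (y k))"
      and py: "y (Suc k) \<in> prox \<tau>2 g (yt - \<tau>2 *\<^sub>R grad_y H (x (Suc k)) yt)"
    have \<tau>0: "0 < \<tau>1" "0 < \<tau>2" using \<tau> pos by linarith+
    define p where "p = (1 / \<tau>1) *\<^sub>R (xt - \<tau>1 *\<^sub>R grad_x H xt (y k) - x (Suc k))"
    define p' where "p' = (1 / \<tau>2) *\<^sub>R (yt - \<tau>2 *\<^sub>R grad_y H (x (Suc k)) yt - y (Suc k))"
    define w where "w = (p + grad_x H (x (Suc k)) (y (Suc k)), p' + grad_y H (x (Suc k)) (y (Suc k)))"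
    have "w \<in> regular_subdiff \<Psi> (x (Suc k), y (Suc k))"
      unfolding w_def
    proof (rule regular_subdiff_Psi[where f = f and g = g and u = "x (Suc k)" and v = "y (Suc k)"
          and a = "fr (Suc k)" and b = "gr (Suc k)" and p = p and q = p'
          and \<kappa> = "1 / (2 * \<tau>1)" and \<mu> = "1 / (2 * \<tau>2)"])
      show "ereal (fr (Suc k) + p \<bullet> (w - x (Suc k)) - 1 / (2 * \<tau>1) * (norm (w - x (Suc k)))\<^sup>2) \<le> f w" for w
        unfolding p_def by (rule prox_quadratic_minorant[OF px f_x f(1) \<tau>0(1)])
      show "ereal (gr (Suc k) + p' \<bullet> (w - y (Suc k)) - 1 / (2 * \<tau>2) * (norm (w - y (Suc k)))\<^sup>2) \<le> g w" for w
        unfolding p'_def by (rule prox_quadratic_minorant[OF py g_y g(1) \<tau>0(2)])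
    qed (use \<tau>0 in \<open>simp_all add: f_x g_y H\<close>)
    moreover have "norm w \<le> b * s k"
    proof -
      have dx: "norm (xt - x (Suc k)) \<le> q * s k"
      proof -
        have "norm (xt - x (Suc k)) \<le> norm (x k - x (Suc k)) + norm (\<beta> *\<^sub>R (x k - x (k - 1)))"
          unfolding xt by (metis add_diff_eq diff_add_eq norm_triangle_ineq)
        also have "\<dots> \<le> s k + \<beta>max * s k"
          using step_x_le[of k] prev_step_x_le[of k] \<beta>
          by (intro add_mono) (auto simp: norm_minus_commute intro!: mult_mono)
        finally show ?thesis by (simp add: q_def distrib_right)
      qed
      have dy: "norm (yt - y (Suc k)) \<le> q * s k"
      proof -
        have "norm (yt - y (Suc k)) \<le> norm (y k - y (Suc k)) + norm (\<beta> *\<^sub>R (y k - y (k - 1)))"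
          unfolding yt by (metis add_diff_eq diff_add_eq norm_triangle_ineq)
        also have "\<dots> \<le> s k + \<beta>max * s k"
          using step_y_le[of k] prev_step_y_le[of k] \<beta>
          by (intro add_mono) (auto simp: norm_minus_commute intro!: mult_mono)
        finally show ?thesis by (simp add: q_def distrib_right)
      qed
      have scale: "norm ((1 / \<tau>) *\<^sub>R d) \<le> 1 / \<tau>lo * q * s k"
        if "\<tau>lo \<le> \<tau>" "norm d \<le> q * s k" for \<tau> and d :: "'d::real_normed_vector"
      proof -
        have "norm ((1 / \<tau>) *\<^sub>R d) = 1 / \<tau> * norm d" using that pos by simp
        also have "\<dots> \<le> 1 / \<tau>lo * (q * s k)" using that pos by (intro mult_mono) (auto simp: frac_le)
        finally show ?thesis by simp
      qed
      have "fst w = (1 / \<tau>1) *\<^sub>R (xt - x (Suc k)) + (grad_x H (x (Suc k)) (y (Suc k)) - grad_x H xt (y k))"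
        using \<tau>0 by (simp add: w_def p_def algebra_simps)
      then have "norm (fst w) \<le> norm ((1 / \<tau>1) *\<^sub>R (xt - x (Suc k))) + norm (grad_x H (x (Suc k)) (y (Suc k)) - grad_x H xt (y k))"
        by (metis norm_triangle_ineq)
      also have "\<dots> \<le> 1 / \<tau>lo * q * s k + M * ((q + 1) * s k)"
      proof (rule add_mono[OF scale[OF \<tau>(1) dx]])
        have "norm (grad_x H (x (Suc k)) (y (Suc k)) - grad_x H xt (y k)) \<le> M * norm ((x (Suc k), y (Suc k)) - (xt, y k))"
          by (intro M in_ball_x in_ball_y ball)
        also have "norm ((x (Suc k), y (Suc k)) - (xt, y k)) \<le> norm (x (Suc k) - xt) + norm (y (Suc k) - y k)"
          by (simp add: norm_Pair sqrt_sum_squares_le_sum)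
        also have "\<dots> \<le> (q + 1) * s k" using dx step_y_le[of k] by (simp add: norm_minus_commute distrib_right)
        finally show "norm (grad_x H (x (Suc k)) (y (Suc k)) - grad_x H xt (y k)) \<le> M * ((q + 1) * s k)"
          using M(1) by (simp add: mult_left_mono)
      qed
      finally have w1: "norm (fst w) \<le> (1 / \<tau>lo * q + M * (q + 1)) * s k" by (simp only: distrib_right mult.assoc)
      have "snd w = (1 / \<tau>2) *\<^sub>R (yt - y (Suc k)) + (grad_y H (x (Suc k)) (y (Suc k)) - grad_y H (x (Suc k)) yt)"
        using \<tau>0 by (simp add: w_def p'_def algebra_simps)
      then have "norm (snd w) \<le> norm ((1 / \<tau>2) *\<^sub>R (yt - y (Suc k))) + norm (grad_y H (x (Suc k)) (y (Suc k)) - grad_y H (x (Suc k)) yt)"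
        by (metis norm_triangle_ineq)
      also have "\<dots> \<le> 1 / \<tau>lo * q * s k + l * (q * s k)"
      proof (rule add_mono[OF scale[OF \<tau>(2) dy]])
        have "norm (grad_y H (x (Suc k)) (y (Suc k)) - grad_y H (x (Suc k)) yt) \<le> L2 (x (Suc k)) * norm (y (Suc k) - yt)"
          using lipschitz_onD[OF L2, of "y (Suc k)" yt "x (Suc k)"] by (simp add: dist_norm)
        also have "\<dots> \<le> l * (q * s k)"
          using l[OF in_ball_x] l0 dy by (intro mult_mono) (auto simp: norm_minus_commute)
        finally show "norm (grad_y H (x (Suc k)) (y (Suc k)) - grad_y H (x (Suc k)) yt) \<le> l * (q * s k)" .
      qed
      finally have w2: "norm (snd w) \<le> (1 / \<tau>lo * q + l * q) * s k" by (simp only: distrib_right mult.assoc)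
      have "norm w \<le> norm (fst w) + norm (snd w)"
        by (metis norm_Pair_le prod.collapse)
      also have "\<dots> \<le> b * s k" using add_mono[OF w1 w2] by (simp only: b_def distrib_right)
      finally show ?thesis .
    qed
    ultimately show ?thesis by blast
  qed
  then show thesis using b0 that by blast
qed

lemma descent: "U (Suc k) \<le> U (ell m U k) - \<alpha> / 2 * (s k)\<^sup>2"
proof -
  have "(\<lambda>j. Upsilon f g H \<delta> (z j)) ` {k - m..k} = ereal ` U ` {k - m..k}"
    by (simp add: Upsilon_eq image_image)
  moreover have "Max (ereal ` U ` {k - m..k}) = ereal (Max (U ` {k - m..k}))"
    by (rule mono_Max_commute[symmetric]) (auto simp: mono_def)
  ultimately have "Max ((\<lambda>j. Upsilon f g H \<delta> (z j)) ` {k - m..k}) = ereal (U (ell m U k))"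
    by (simp add: ell_Max)
  moreover have "(x (Suc k), y (Suc k), x k, y k) = z (Suc k)" by (simp add: palm_z_def)
  ultimately show ?thesis
    using accept[of k] by (simp only: palm_accept_def Upsilon_eq) simp
qed

text \<open>For \<open>f\<close> and \<open>g\<close> this is prox minimality tested against the
  previous iterate. The new penalty is a squared step, one factor of which is bounded by the
  diameter of the ball; the old penalty is only discarded.\<close>

lemma growth: "\<exists>C. \<forall>k. U (Suc k) \<le> U k + C * s k"
proof -
  obtain C where C: "0 \<le> C"
    "\<And>k w. w \<in> cball 0 r1 \<Longrightarrow> ereal (fr (Suc k)) \<le> f w + ereal (C * norm (w - x (Suc k)))"
    "\<And>k w. w \<in> cball 0 r2 \<Longrightarrow> ereal (gr (Suc k)) \<le> g w + ereal (C * norm (w - y (Suc k)))"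
    using prox_step_upper by blast
  obtain D where D: "0 \<le> D" "\<And>k. \<bar>H (x (Suc k), y (Suc k)) - H (x k, y k)\<bar> \<le> D * s k"
    using H_Lipschitz by blast
  have "U (Suc k) \<le> U k + (C + C + D + \<delta> * r1 + \<delta> * r2) * s k" for k
  proof -
    have Cs: "C * norm (x k - x (Suc k)) \<le> C * s k" "C * norm (y k - y (Suc k)) \<le> C * s k"
      using C(1) step_x_le[of k] step_y_le[of k] by (simp_all add: norm_minus_commute mult_left_mono)
    have "fr (Suc k) \<le> fr k + C * norm (x k - x (Suc k))"
      using C(2)[OF in_ball_x, of k k] by (simp add: f_x)
    moreover have "gr (Suc k) \<le> gr k + C * norm (y k - y (Suc k))"
      using C(3)[OF in_ball_y, of k k] by (simp add: g_y)
    moreover have "\<delta> / 2 * (norm (x (Suc k) - x k))\<^sup>2 \<le> \<delta> * r1 * s k"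
    proof -
      have "norm (x (Suc k) - x k) \<le> 2 * r1"
        using norm_triangle_ineq4[of "x (Suc k)" "x k"] in_ball_x[of k] in_ball_x[of "Suc k"] by simp
      then have "(norm (x (Suc k) - x k))\<^sup>2 \<le> (2 * r1) * s k"
        unfolding power2_eq_square using step_x_le[of k] B1(1) by (intro mult_mono) auto
      then show ?thesis using pos(1) by simp
    qed
    moreover have "\<delta> / 2 * (norm (y (Suc k) - y k))\<^sup>2 \<le> \<delta> * r2 * s k"
    proof -
      have "norm (y (Suc k) - y k) \<le> 2 * r2"
        using norm_triangle_ineq4[of "y (Suc k)" "y k"] in_ball_y[of k] in_ball_y[of "Suc k"] by simp
      then have "(norm (y (Suc k) - y k))\<^sup>2 \<le> (2 * r2) * s k"
        unfolding power2_eq_square using step_y_le[of k] B2(1) by (intro mult_mono) auto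
      then show ?thesis using pos(1) by simp
    qed
    moreover have "H (x (Suc k), y (Suc k)) \<le> H (x k, y k) + D * s k" using D(2)[of k] by linarith
    moreover have "0 \<le> \<delta> / 2 * (norm (x k - x (k - 1)))\<^sup>2" "0 \<le> \<delta> / 2 * (norm (y k - y (k - 1)))\<^sup>2"
      using pos(1) by simp_all
    ultimately show ?thesis using Cs by (simp add: U_def P_def distrib_right)
  qed
  then show ?thesis by blast
qed

lemma bdd_below_U: "bdd_below (range U)"
proof -
  obtain a b where ab: "\<And>u. ereal a \<le> f u" "\<And>v. ereal b \<le> g v"
    using f(3) g(3) by (auto simp: bounded_below_def)
  have "compact (H ` (cball 0 r1 \<times> cball 0 r2))"
    by (intro compact_continuous_image compact_Times compact_cball
        continuous_on_subset[OF smooth_imp_continuous[OF H]]) auto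
  then have "bounded (H ` (cball 0 r1 \<times> cball 0 r2))" by (rule compact_imp_bounded)
  then obtain B where B: "\<And>p. p \<in> cball 0 r1 \<times> cball 0 r2 \<Longrightarrow> \<bar>H p\<bar> \<le> B"
    unfolding bounded_iff by auto
  have "a + b - B \<le> U k" for k
  proof -
    have "a \<le> fr k" "b \<le> gr k" using ab(1)[of "x k"] ab(2)[of "y k"] by (simp_all add: f_x g_y)
    moreover have "- B \<le> H (x k, y k)" using B[of "(x k, y k)"] in_ball_x[of k] in_ball_y[of k] by (simp add: abs_le_iff)
    moreover have "0 \<le> \<delta> / 2 * (norm (x k - x (k - 1)))\<^sup>2" "0 \<le> \<delta> / 2 * (norm (y k - y (k - 1)))\<^sup>2"
      using pos(1) by simp_all
    ultimately show ?thesis by (simp add: U_def P_def)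
  qed
  then show ?thesis by (intro bdd_belowI[of _ "a + b - B"]) auto
qed

sublocale D: nonmonotone_descent m \<alpha> U z
  by unfold_locales (rule pos(2), rule descent, rule growth, rule bdd_below_U)

end

lemma lsc_eventually_less:
  assumes "lsc h" "(X \<longlongrightarrow> u) F" "a < h u"
  shows "\<forall>\<^sub>F n in F. a < h (X n)"
proof -
  have "a < Liminf (nhds u) h" using assms by (auto simp: lsc_def intro: less_le_trans)
  then have "\<forall>\<^sub>F w in nhds u. a < h w" by (rule less_LiminfD)
  then show ?thesis using assms(2) by (rule eventually_compose_filterlim)
qed

lemma bounded_below_real_less: "bounded_below h \<Longrightarrow> \<exists>b. ereal b < h v"
  unfolding bounded_below_def by (metis ereal_less(2) gt_ex less_ereal.simps(1) less_le_trans lt_ex)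

section \<open>Cluster points and the KL inequality along the iterates\<close>

context palm
begin

abbreviation "\<omega> \<equiv> D.\<omega>"

lemma P_tendsto: "P \<longlonglongrightarrow> \<omega>"
proof -
  have "(\<lambda>k. norm (x k - x (k - 1))) \<longlonglongrightarrow> 0"
    by (rule Lim_null_comparison[OF _ D.s_tendsto]) (use prev_step_x_le in simp)
  moreover have "(\<lambda>k. norm (y k - y (k - 1))) \<longlonglongrightarrow> 0"
    by (rule Lim_null_comparison[OF _ D.s_tendsto]) (use prev_step_y_le in simp)
  ultimately have "(\<lambda>k. U k - \<delta> / 2 * (norm (x k - x (k - 1)))\<^sup>2 - \<delta> / 2 * (norm (y k - y (k - 1)))\<^sup>2)
     \<longlonglongrightarrow> \<omega> - \<delta> / 2 * 0\<^sup>2 - \<delta> / 2 * 0\<^sup>2"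
    by (intro tendsto_diff tendsto_mult tendsto_const tendsto_power D.U_tendsto)
  then show ?thesis by (simp add: U_def)
qed

text \<open>\<open>f u\<close> or \<open>g v\<close> could be infinite a priori, so lower
  semicontinuity is applied to arbitrary reals below them and the bound is passed to the
  limit.\<close>

lemma Psi_cluster_le:
  assumes r: "strict_mono r" and xr: "(\<lambda>n. x (r n)) \<longlonglongrightarrow> u" and yr: "(\<lambda>n. y (r n)) \<longlonglongrightarrow> v"
  shows "\<exists>a b. f u = ereal a \<and> g v = ereal b \<and> a + b + H (u, v) \<le> \<omega>"
proof -
  have Hr: "(\<lambda>n. H (x (r n), y (r n))) \<longlonglongrightarrow> H (u, v)"
    by (rule continuous_on_tendsto_compose[OF smooth_imp_continuous[OF H] tendsto_Pair[OF xr yr]]) auto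
  have Pr: "(\<lambda>n. P (r n)) \<longlonglongrightarrow> \<omega>"
    using LIMSEQ_subseq_LIMSEQ[OF P_tendsto r] by (simp add: o_def)
  have key: "a + b + H (u, v) \<le> \<omega>" if "ereal a < f u" "ereal b < g v" for a b
  proof (rule tendsto_le[OF _ Pr])
    show "(\<lambda>n. a + b + H (x (r n), y (r n))) \<longlonglongrightarrow> a + b + H (u, v)"
      by (intro tendsto_add tendsto_const Hr)
    show "\<forall>\<^sub>F n in sequentially. a + b + H (x (r n), y (r n)) \<le> P (r n)"
      using lsc_eventually_less[OF f(2) xr that(1)] lsc_eventually_less[OF g(2) yr that(2)]
      by eventually_elim (simp add: f_x g_y P_def)
  qed simp
  \<comment> \<open>Holding one minorant fixed bounds the other function from above; this proves
    both values finite before the two bounds are sharpened together.\<close>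
  obtain a0 b0 where ab0: "ereal a0 < f u" "ereal b0 < g v"
    using bounded_below_real_less[OF f(3)] bounded_below_real_less[OF g(3)] by blast
  have "f u \<le> ereal (\<omega> - H (u, v) - b0)"
  proof (rule dense_le)
    fix a assume "a < f u"
    then show "a \<le> ereal (\<omega> - H (u, v) - b0)" using key[OF _ ab0(2)] by (cases a) fastforce+
  qed
  then obtain a where a: "f u = ereal a" using ab0(1) by (cases "f u") auto
  have "g v \<le> ereal (\<omega> - H (u, v) - a0)"
  proof (rule dense_le)
    fix b assume "b < g v"
    then show "b \<le> ereal (\<omega> - H (u, v) - a0)" using key[OF ab0(1)] by (cases b) fastforce+
  qed
  then obtain b where b: "g v = ereal b" using ab0(2) by (cases "g v") auto
  have "a + b + H (u, v) \<le> \<omega>"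
  proof (rule field_le_epsilon)
    fix e :: real assume "0 < e"
    then show "a + b + H (u, v) \<le> \<omega> + e" using key[of "a - e / 2" "b - e / 2"] a b by simp
  qed
  then show ?thesis using a b by blast
qed

text \<open>The missing inequality comes from testing prox minimality at the cluster point itself:
  \<open>f\<close> at an iterate exceeds \<open>f u\<close> by at most \<open>C\<close> times the
  distance, and likewise for \<open>g\<close>.\<close>

lemma Psi_cluster:
  assumes r: "strict_mono r" and xr: "(\<lambda>n. x (r n)) \<longlonglongrightarrow> u" and yr: "(\<lambda>n. y (r n)) \<longlonglongrightarrow> v"
  shows "\<Psi> (u, v) = ereal \<omega>"
proof -
  obtain a b where ab: "f u = ereal a" "g v = ereal b" "a + b + H (u, v) \<le> \<omega>"
    using Psi_cluster_le[OF assms] by blast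
  obtain C where "0 \<le> C" and C:
    "\<And>k w. w \<in> cball 0 r1 \<Longrightarrow> ereal (fr (Suc k)) \<le> f w + ereal (C * norm (w - x (Suc k)))"
    "\<And>k w. w \<in> cball 0 r2 \<Longrightarrow> ereal (gr (Suc k)) \<le> g w + ereal (C * norm (w - y (Suc k)))"
    using prox_step_upper by blast
  have u: "u \<in> cball 0 r1"
    by (rule Lim_in_closed_set[OF closed_cball always_eventually _ xr]) (use in_ball_x in auto)
  have v: "v \<in> cball 0 r2"
    by (rule Lim_in_closed_set[OF closed_cball always_eventually _ yr]) (use in_ball_y in auto)
  have Hr: "(\<lambda>n. H (x (r n), y (r n))) \<longlonglongrightarrow> H (u, v)"
    by (rule continuous_on_tendsto_compose[OF smooth_imp_continuous[OF H] tendsto_Pair[OF xr yr]]) auto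
  have Pr: "(\<lambda>n. P (r n)) \<longlonglongrightarrow> \<omega>"
    using LIMSEQ_subseq_LIMSEQ[OF P_tendsto r] by (simp add: o_def)
  have "\<omega> \<le> (a + C * norm (u - u)) + (b + C * norm (v - v)) + H (u, v)"
  proof (rule tendsto_le[OF _ _ Pr])
    show "(\<lambda>n. (a + C * norm (u - x (r n))) + (b + C * norm (v - y (r n))) + H (x (r n), y (r n)))
      \<longlonglongrightarrow> (a + C * norm (u - u)) + (b + C * norm (v - v)) + H (u, v)"
      by (intro tendsto_add tendsto_mult tendsto_norm tendsto_diff tendsto_const xr yr Hr)
    show "\<forall>\<^sub>F n in sequentially. P (r n) \<le>
        (a + C * norm (u - x (r n))) + (b + C * norm (v - y (r n))) + H (x (r n), y (r n))"
      using eventually_gt_at_top[of 0]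
    proof eventually_elim
      case (elim n)
      \<comment> \<open>\<open>0 < n \<le> r n\<close> excludes the starting point, which is not a
        prox point.\<close>
      then have "Suc (r n - 1) = r n" using seq_suble[OF r, of n] by simp
      then show ?case using C(1)[OF u, of "r n - 1"] C(2)[OF v, of "r n - 1"] ab by (simp add: P_def)
    qed
  qed simp
  then show ?thesis using ab by (simp add: Psi_def)
qed

text \<open>The regular subgradients have norm at most \<open>b * s k\<close> and tend to 0, while
  points and values converge; this is the definition of a limiting subgradient.\<close>

lemma cluster_critical:
  assumes r: "strict_mono r" and xr: "(\<lambda>n. x (r n)) \<longlonglongrightarrow> u" and yr: "(\<lambda>n. y (r n)) \<longlonglongrightarrow> v"
  shows "0 \<in> subdiff \<Psi> (u, v)" and "(u, v, u, v) \<in> crit (Upsilon f g H \<delta>)"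
proof -
  obtain b where b: "0 < b" "\<And>k. \<exists>w\<in>regular_subdiff \<Psi> (x (Suc k), y (Suc k)). norm w \<le> b * s k"
    using subgradient_bound by blast
  then obtain w where w: "\<And>k. w k \<in> regular_subdiff \<Psi> (x (Suc k), y (Suc k))" "\<And>k. norm (w k) \<le> b * s k"
    by metis
  have "(\<lambda>k. b * s k) \<longlonglongrightarrow> b * 0" by (intro tendsto_intros D.s_tendsto)
  then have w0: "w \<longlonglongrightarrow> 0" using w(2) by (intro Lim_null_comparison[of w "\<lambda>k. b * s k"]) auto
  \<comment> \<open>The shift makes every index positive, so that it belongs to the result of an
    iteration.\<close>
  define q where "q n = r (Suc n)" for n
  have q: "Suc (q n - 1) = q n" for n using seq_suble[OF r, of "Suc n"] by (simp add: q_def)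
  have "filterlim q at_top sequentially"
    unfolding q_def using filterlim_subseq[OF r] filterlim_sequentially_Suc by blast
  then have "filterlim (\<lambda>n. q n - 1) at_top sequentially"
    by (rule filterlim_compose[OF filterlim_minus_const_nat_at_top])
  then have V: "(\<lambda>n. w (q n - 1)) \<longlonglongrightarrow> 0" by (rule filterlim_compose[OF w0])
  have Vin: "w (q n - 1) \<in> regular_subdiff \<Psi> (x (q n), y (q n))" for n
    using w(1)[of "q n - 1"] by (simp only: q)
  have lim: "(\<lambda>n. x (q n)) \<longlonglongrightarrow> u" "(\<lambda>n. y (q n)) \<longlonglongrightarrow> v" "(\<lambda>n. P (q n)) \<longlonglongrightarrow> \<omega>"
    unfolding q_def
    using LIMSEQ_Suc[OF xr] LIMSEQ_Suc[OF yr] LIMSEQ_Suc[OF LIMSEQ_subseq_LIMSEQ[OF P_tendsto r]]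
    by (simp_all add: o_def)
  have val: "\<Psi> (u, v) = ereal \<omega>" by (rule Psi_cluster[OF assms])
  have Plim: "(\<lambda>n. ereal (P (q n))) \<longlonglongrightarrow> ereal \<omega>" using lim(3) by simp
  show "0 \<in> subdiff \<Psi> (u, v)"
    unfolding subdiff_def
  proof (intro CollectI conjI exI)
    show "(u, v) \<in> edom \<Psi>" using val by (simp add: edom_def)
    show "(\<lambda>n. (x (q n), y (q n))) \<longlonglongrightarrow> (u, v)" using lim by (intro tendsto_Pair)
    show "(\<lambda>n. \<Psi> (x (q n), y (q n))) \<longlonglongrightarrow> \<Psi> (u, v)" using Plim by (simp only: val Psi_eq)
    show "\<forall>n. w (q n - 1) \<in> regular_subdiff \<Psi> (x (q n), y (q n))" using Vin by blast
    show "(\<lambda>n. w (q n - 1)) \<longlonglongrightarrow> 0" by (rule V)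
  qed
  have diag: "Upsilon f g H \<delta> (a, b, a, b) = \<Psi> (a, b)" for a b by (simp add: Upsilon_def Psi_def)
  \<comment> \<open>The approximating points are taken on the diagonal rather than at
    \<open>z k\<close>: there \<open>Upsilon\<close> equals \<open>Psi\<close> and its subgradients
    are those of \<open>Psi\<close> padded with zeros.\<close>
  have "0 \<in> subdiff (Upsilon f g H \<delta>) (u, v, u, v)"
    unfolding subdiff_def
  proof (intro CollectI conjI exI)
    show "(u, v, u, v) \<in> edom (Upsilon f g H \<delta>)" using val by (simp add: edom_def diag)
    show "(\<lambda>n. (x (q n), y (q n), x (q n), y (q n))) \<longlonglongrightarrow> (u, v, u, v)" using lim by (intro tendsto_Pair)
    show "(\<lambda>n. Upsilon f g H \<delta> (x (q n), y (q n), x (q n), y (q n))) \<longlonglongrightarrow> Upsilon f g H \<delta> (u, v, u, v)"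
      using Plim by (simp only: val Psi_eq diag)
    show "\<forall>n. (fst (w (q n - 1)), snd (w (q n - 1)), 0, 0)
        \<in> regular_subdiff (Upsilon f g H \<delta>) (x (q n), y (q n), x (q n), y (q n))"
      using Vin pos(1) by (intro allI regular_subdiff_Upsilon_diagonal[OF _ Psi_eq]) auto
    have "(\<lambda>n. (fst (w (q n - 1)), snd (w (q n - 1)), 0::'a, 0::'b)) \<longlonglongrightarrow> (fst (0::'a \<times> 'b), snd (0::'a \<times> 'b), 0, 0)"
      using tendsto_Pair[OF tendsto_fst[OF V] tendsto_Pair[OF tendsto_snd[OF V] tendsto_const[of "(0::'a, 0::'b)"]]] .
    then show "(\<lambda>n. (fst (w (q n - 1)), snd (w (q n - 1)), 0::'a, 0::'b)) \<longlonglongrightarrow> 0"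
      by (simp add: zero_prod_def)
  qed
  then show "(u, v, u, v) \<in> crit (Upsilon f g H \<delta>)" by (simp add: crit_def)
qed

text \<open>The KL inequality of \<^term>\<open>\<Psi>\<close> is transferred to the values of \<^const>\<open>Upsilon\<close>: either the
  \<^term>\<open>\<Psi>\<close>-part accounts for at least half of the gap, or the quadratic part does and the gap is
  at most a multiple of the squared step.\<close>

lemma KL_along_sequence:
  assumes KL: "\<And>p. p \<in> dom_subdiff \<Psi> \<Longrightarrow> \<exists>\<phi>. Q \<phi> \<and> KL_with \<Psi> p \<phi>"
  shows "\<exists>\<Phi> b. finite \<Phi> \<and> 0 < b \<and> (\<forall>\<phi>\<in>\<Phi>. Q \<phi> \<and> (\<exists>\<eta>>0. \<phi> \<in> KL_family \<eta>)) \<and>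
    (\<forall>\<^sub>F k in sequentially. \<omega> < U (Suc k) \<longrightarrow>
      (\<exists>\<phi>\<in>\<Phi>. 1 \<le> deriv \<phi> ((U (Suc k) - \<omega>) / 2) * (b * s k)) \<or> 1 \<le> sqrt (\<delta> / (U (Suc k) - \<omega>)) * s k)"
proof -
  obtain b where b: "0 < b" "\<And>k. \<exists>w\<in>regular_subdiff \<Psi> (x (Suc k), y (Suc k)). norm w \<le> b * s k"
    using subgradient_bound by blast
  \<comment> \<open>The reference value is \<omega> instead of the value at the centre of
    \<open>A\<close>, as all cluster points share it. \<open>Q\<close> records extra knowledge about
    \<phi>, such as being a power function.\<close>
  define good where "good A \<phi> \<eta> \<longleftrightarrow> 0 < \<eta> \<and> \<phi> \<in> KL_family \<eta> \<and> Q \<phi> \<and>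
     (\<forall>q\<in>A. ereal \<omega> < \<Psi> q \<and> \<Psi> q < ereal \<omega> + \<eta> \<longrightarrow>
        1 \<le> ereal (deriv \<phi> (real_of_ereal (\<Psi> q - ereal \<omega>))) * edist_set 0 (subdiff \<Psi> q))" for A \<phi> \<eta>
  define \<U> where "\<U> = {A. open A \<and> (\<exists>\<phi> \<eta>. good A \<phi> \<eta>)}"
  have "\<exists>\<F>\<subseteq>\<U>. finite \<F> \<and> (\<forall>\<^sub>F k in sequentially. (x k, y k) \<in> \<Union>\<F>)"
  proof (rule eventually_in_finite_subfamily)
    have "range (\<lambda>k. (x k, y k)) \<subseteq> cball 0 r1 \<times> cball 0 r2" using in_ball_x in_ball_y by blast
    then show "bounded (range (\<lambda>k. (x k, y k)))"
      by (rule bounded_subset[rotated]) (intro bounded_Times bounded_cball)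
    fix p and r :: "nat \<Rightarrow> nat"
    assume r: "strict_mono r" and lim: "((\<lambda>k. (x k, y k)) \<circ> r) \<longlonglongrightarrow> p"
    obtain u v where p: "p = (u, v)" by (cases p)
    have lims: "(\<lambda>n. x (r n)) \<longlonglongrightarrow> u" "(\<lambda>n. y (r n)) \<longlonglongrightarrow> v"
      using tendsto_fst[OF lim] tendsto_snd[OF lim] by (simp_all add: p o_def)
    have val: "\<Psi> p = ereal \<omega>" unfolding p by (rule Psi_cluster[OF r lims])
    have "0 \<in> subdiff \<Psi> p" unfolding p by (rule cluster_critical(1)[OF r lims])
    then have "p \<in> dom_subdiff \<Psi>" by (auto simp: dom_subdiff_def)
    then obtain \<phi> where \<phi>: "Q \<phi>" "KL_with \<Psi> p \<phi>" using KL by blast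
    obtain \<eta> A where A: "open A" "p \<in> A" and "0 < \<eta>" "\<phi> \<in> KL_family \<eta>"
      "\<forall>q\<in>A. ereal \<omega> < \<Psi> q \<and> \<Psi> q < ereal \<omega> + \<eta> \<longrightarrow>
        1 \<le> ereal (deriv \<phi> (real_of_ereal (\<Psi> q - ereal \<omega>))) * edist_set 0 (subdiff \<Psi> q)"
      using \<phi>(2) unfolding KL_with_def val by (elim exE conjE) (rule that)
    then have "good A \<phi> \<eta>" using \<phi>(1) unfolding good_def by (intro conjI)
    then show "\<exists>A\<in>\<U>. p \<in> A" using A by (intro bexI[of _ A]) (auto simp only: \<U>_def)
  qed (simp add: \<U>_def)
  then obtain \<F> where \<F>: "\<F> \<subseteq> \<U>" "finite \<F>" and ev: "\<forall>\<^sub>F k in sequentially. (x k, y k) \<in> \<Union>\<F>" by blast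
  have "\<forall>A\<in>\<F>. \<exists>\<phi> \<eta>. good A \<phi> \<eta>" using \<F>(1) by (auto simp: \<U>_def)
  then obtain \<phi> \<eta> where good: "\<And>A. A \<in> \<F> \<Longrightarrow> good A (\<phi> A) (\<eta> A)" by metis
  have gap: "(\<lambda>k. ereal (U (Suc k) - \<omega>)) \<longlonglongrightarrow> ereal (\<omega> - \<omega>)"
    by (rule tendsto_ereal[OF tendsto_diff[OF LIMSEQ_Suc[OF D.U_tendsto] tendsto_const]])
  have small: "\<forall>\<^sub>F k in sequentially. \<forall>A\<in>\<F>. ereal (U (Suc k) - \<omega>) < \<eta> A"
  proof (intro eventually_ball_finite \<F> ballI)
    fix A assume "A \<in> \<F>"
    then have "0 < \<eta> A" using good by (simp add: good_def)
    then show "\<forall>\<^sub>F k in sequentially. ereal (U (Suc k) - \<omega>) < \<eta> A"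
      using order_tendstoD(2)[OF gap, of "\<eta> A"] by (simp add: zero_ereal_def)
  qed
  have "\<forall>\<^sub>F k in sequentially. (x (Suc k), y (Suc k)) \<in> \<Union>\<F>"
    by (rule eventually_compose_filterlim[OF ev filterlim_Suc])
  with small have "\<forall>\<^sub>F k in sequentially. \<omega> < U (Suc k) \<longrightarrow>
      (\<exists>\<phi>\<in>\<phi> ` \<F>. 1 \<le> deriv \<phi> ((U (Suc k) - \<omega>) / 2) * (b * s k)) \<or> 1 \<le> sqrt (\<delta> / (U (Suc k) - \<omega>)) * s k"
  proof eventually_elim
    case (elim k)
    show ?case
    proof
      assume less: "\<omega> < U (Suc k)"
      \<comment> \<open>\<open>t\<close> is the gap of \<open>Upsilon\<close> and \<open>a\<close>
        the gap of \<open>Psi\<close>; the penalty makes up the difference.\<close>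
      define t where "t = U (Suc k) - \<omega>"
      define a where "a = P (Suc k) - \<omega>"
      have t0: "0 < t" using less by (simp add: t_def)
      have ta: "t - a = \<delta> / 2 * ((norm (x (Suc k) - x k))\<^sup>2 + (norm (y (Suc k) - y k))\<^sup>2)"
        by (simp add: t_def a_def U_def distrib_left)
      have "\<dots> \<le> \<delta> / 2 * (s k)\<^sup>2"
        using pos(1) by (intro mult_left_mono) (auto simp: s_square)
      then have ta_le: "t - a \<le> \<delta> / 2 * (s k)\<^sup>2" using ta by simp
      have at: "a \<le> t" using ta pos(1) by (smt (verit) mult_nonneg_nonneg zero_le_power2 divide_nonneg_nonneg)
      show "(\<exists>\<phi>\<in>\<phi> ` \<F>. 1 \<le> deriv \<phi> ((U (Suc k) - \<omega>) / 2) * (b * s k)) \<or> 1 \<le> sqrt (\<delta> / (U (Suc k) - \<omega>)) * s k"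
        unfolding t_def[symmetric]
      proof (cases "a \<le> t / 2")
        case True
        \<comment> \<open>The penalty accounts for at least half of \<open>t\<close> and is itself
          at most \<delta>/2 times the squared step.\<close>
        then have "t \<le> \<delta> * (s k)\<^sup>2" using ta_le by simp
        then have "1 \<le> \<delta> / t * (s k)\<^sup>2" using t0 by (simp add: pos_le_divide_eq)
        then have "1 \<le> sqrt (\<delta> / t * (s k)\<^sup>2)" by simp
        then have "1 \<le> sqrt (\<delta> / t) * s k" by (simp only: real_sqrt_mult real_sqrt_abs abs_norm_cancel)
        then show "(\<exists>\<phi>\<in>\<phi> ` \<F>. 1 \<le> deriv \<phi> (t / 2) * (b * s k)) \<or> 1 \<le> sqrt (\<delta> / t) * s k" by blast
      next
        case False
        obtain A where A: "A \<in> \<F>" "(x (Suc k), y (Suc k)) \<in> A" using elim(2) by blast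
        have gA: "\<phi> A \<in> KL_family (\<eta> A)" "0 < \<eta> A" using good[OF A(1)] by (simp_all add: good_def)
        have t\<eta>: "ereal t < \<eta> A" using elim(1) A(1) by (simp add: t_def)
        then have a\<eta>: "ereal a < \<eta> A" using at by (metis ereal_less_eq(3) le_less_trans)
        have "ereal \<omega> < \<Psi> (x (Suc k), y (Suc k))" using False t0 by (simp add: Psi_eq a_def)
        moreover have "\<Psi> (x (Suc k), y (Suc k)) < ereal \<omega> + \<eta> A"
          using a\<eta> unfolding Psi_eq by (cases "\<eta> A") (auto simp: a_def)
        ultimately have "1 \<le> ereal (deriv (\<phi> A) (real_of_ereal (\<Psi> (x (Suc k), y (Suc k)) - ereal \<omega>)))
            * edist_set 0 (subdiff \<Psi> (x (Suc k), y (Suc k)))"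
          using good[OF A(1)] A(2) unfolding good_def by blast
        then have "1 \<le> ereal (deriv (\<phi> A) a) * edist_set 0 (subdiff \<Psi> (x (Suc k), y (Suc k)))"
          by (simp add: Psi_eq a_def)
        also have "\<dots> \<le> ereal (deriv (\<phi> A) a) * ereal (b * s k)"
        proof (rule ereal_mult_left_mono)
          obtain w where w: "w \<in> regular_subdiff \<Psi> (x (Suc k), y (Suc k))" "norm w \<le> b * s k"
            using b(2) by blast
          then have "edist_set 0 (subdiff \<Psi> (x (Suc k), y (Suc k))) \<le> ereal (norm w)"
            using regular_subdiff_subset_subdiff by (intro edist_set_le_norm) blast
          then show "edist_set 0 (subdiff \<Psi> (x (Suc k), y (Suc k))) \<le> ereal (b * s k)"
            using w(2) by (meson ereal_less_eq(3) order_trans)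
          show "0 \<le> ereal (deriv (\<phi> A) a)"
            using gA(1) a\<eta> False t0 by (auto simp: KL_family_def intro: less_imp_le)
        qed
        finally have "1 \<le> deriv (\<phi> A) a * (b * s k)" by simp
        \<comment> \<open>The derivative decreases and \<open>a > t / 2\<close>, which replaces the
          gap of \<open>Psi\<close> by a function of the gap of \<open>Upsilon\<close>.\<close>
        also have "\<dots> \<le> deriv (\<phi> A) (t / 2) * (b * s k)"
          using KL_family_deriv_antimono[OF gA(1) _ _ a\<eta>, of "t / 2"] t0 False b(1)
          by (intro mult_right_mono) auto
        finally show "(\<exists>\<phi>\<in>\<phi> ` \<F>. 1 \<le> deriv \<phi> (t / 2) * (b * s k)) \<or> 1 \<le> sqrt (\<delta> / t) * s k"
          using A(1) by blast
      qed
    qed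
  qed
  moreover have "\<forall>\<phi>\<in>\<phi> ` \<F>. Q \<phi> \<and> (\<exists>\<eta>>0. \<phi> \<in> KL_family \<eta>)"
    using good unfolding good_def by blast
  ultimately show ?thesis using \<F>(2) b(1) by (intro exI[of _ "\<phi> ` \<F>"] exI[of _ b]) simp
qed

text \<open>Which member of the finite family applies may change with \<open>k\<close>. The sum of
  their nonnegative derivatives dominates each of them, and so does the added term for the penalty
  alternative.\<close>

lemma summable_steps:
  assumes KL: "KL_function \<Psi>"
    and K1: "Liminf (inf sequentially (principal (K1_set m \<alpha> U z))) (decrease_ratio m U z) = 0 \<longrightarrow>
      (\<lambda>k. sqrt (U (ell m U (Suc k)) - U (Suc k))) summable_on K1_set m \<alpha> U z"
  shows "summable s"
proof -
  have "\<exists>\<phi>. True \<and> KL_with \<Psi> p \<phi>" if "p \<in> dom_subdiff \<Psi>" for p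
    using KL that by (simp add: KL_function_def)
  from KL_along_sequence[of "\<lambda>_. True", OF this]
  obtain \<Phi> b where \<Phi>: "finite \<Phi>" "0 < b" "\<And>\<phi>. \<phi> \<in> \<Phi> \<Longrightarrow> \<exists>\<eta>>0. \<phi> \<in> KL_family \<eta>"
    and ev: "\<forall>\<^sub>F k in sequentially. \<omega> < U (Suc k) \<longrightarrow>
      (\<exists>\<phi>\<in>\<Phi>. 1 \<le> deriv \<phi> ((U (Suc k) - \<omega>) / 2) * (b * s k)) \<or> 1 \<le> sqrt (\<delta> / (U (Suc k) - \<omega>)) * s k"
    by blast
  have "\<forall>\<phi>\<in>\<Phi>. \<exists>e>0. \<exists>\<eta>. ereal e < \<eta> \<and> \<phi> \<in> KL_family \<eta>"
  proof
    fix \<phi> assume "\<phi> \<in> \<Phi>"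
    then obtain \<eta> where \<eta>: "0 < \<eta>" "\<phi> \<in> KL_family \<eta>" using \<Phi>(3) by blast
    then obtain e where "ereal 0 < ereal e" "ereal e < \<eta>" using ereal_dense2[of 0 \<eta>] by auto
    then show "\<exists>e>0. \<exists>\<eta>. ereal e < \<eta> \<and> \<phi> \<in> KL_family \<eta>" using \<eta>(2) by auto
  qed
  then obtain e where e: "\<And>\<phi>. \<phi> \<in> \<Phi> \<Longrightarrow> 0 < e \<phi> \<and> (\<exists>\<eta>. ereal (e \<phi>) < \<eta> \<and> \<phi> \<in> KL_family \<eta>)" by metis
  \<comment> \<open>A common radius for the family; inserting 1 makes the minimum meaningful for an
    empty \<Phi>.\<close>
  define r where "r = Min (insert 1 (e ` \<Phi>))"
  have r0: "0 < r" using \<Phi>(1) e by (simp add: r_def)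
  have fam: "\<exists>\<eta>. ereal r < \<eta> \<and> \<phi> \<in> KL_family \<eta>" if \<phi>: "\<phi> \<in> \<Phi>" for \<phi>
  proof -
    have "r \<le> e \<phi>" using \<Phi>(1) \<phi> by (simp add: r_def)
    then show ?thesis using e[OF \<phi>] by (metis ereal_less_eq(3) le_less_trans)
  qed
  have halves: "0 < deriv \<phi> (a / 2)" "deriv \<phi> (a / 2) * (a - d) \<le> 2 * \<phi> (a / 2) - 2 * \<phi> (d / 2)" "0 \<le> \<phi> (a / 2)"
    if \<phi>: "\<phi> \<in> \<Phi>" and a: "0 < a" "a < r" "0 \<le> d" "d \<le> a" for \<phi> a d
  proof -
    obtain \<eta> where \<eta>: "ereal r < \<eta>" "\<phi> \<in> KL_family \<eta>" using fam[OF \<phi>] by blast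
    have a\<eta>: "ereal (a / 2) < \<eta>" "ereal (d / 2) < \<eta>"
      using a by (auto intro!: le_less_trans[OF _ \<eta>(1)])
    then show "0 < deriv \<phi> (a / 2)" "0 \<le> \<phi> (a / 2)" using \<eta>(2) a by (auto simp: KL_family_def)
    show "deriv \<phi> (a / 2) * (a - d) \<le> 2 * \<phi> (a / 2) - 2 * \<phi> (d / 2)"
      using KL_family_tangent[OF \<eta>(2) _ a\<eta>(1) _ a\<eta>(2)] a by (simp add: algebra_simps)
  qed
  \<comment> \<open>\<open>Dq\<close> is the derivative of \<open>Fq\<close>: the factor 2 offsets
    the argument \<open>t / 2\<close>, and \<open>2 * sqrt \<delta> * sqrt t\<close> desingularizes
    the penalty.\<close>
  define Dq where "Dq t = b * (\<Sum>\<phi>\<in>\<Phi>. deriv \<phi> (t / 2)) + sqrt (\<delta> / t)" for t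
  define Fq where "Fq t = b * (\<Sum>\<phi>\<in>\<Phi>. 2 * \<phi> (t / 2)) + 2 * sqrt \<delta> * sqrt t" for t
  show ?thesis
  proof (rule D.summable_steps_if_KL[of r Dq Fq])
    fix d a :: real assume a: "0 \<le> d" "d \<le> a" "0 < a" "a < r"
    have "(\<Sum>\<phi>\<in>\<Phi>. deriv \<phi> (a / 2)) * (a - d) \<le> (\<Sum>\<phi>\<in>\<Phi>. 2 * \<phi> (a / 2)) - (\<Sum>\<phi>\<in>\<Phi>. 2 * \<phi> (d / 2))"
      unfolding sum_distrib_right sum_subtractf[symmetric] using halves a by (intro sum_mono) auto
    then have "b * ((\<Sum>\<phi>\<in>\<Phi>. deriv \<phi> (a / 2)) * (a - d)) \<le>
        b * ((\<Sum>\<phi>\<in>\<Phi>. 2 * \<phi> (a / 2)) - (\<Sum>\<phi>\<in>\<Phi>. 2 * \<phi> (d / 2)))"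
      using \<Phi>(2) by simp
    moreover have "sqrt (\<delta> / a) * (a - d) \<le> 2 * sqrt \<delta> * sqrt a - 2 * sqrt \<delta> * sqrt d"
    proof -
      have sq: "sqrt d \<le> sqrt a" "0 < sqrt a" using a by simp_all
      have "a - d = (sqrt a - sqrt d) * (sqrt a + sqrt d)" using a by (simp add: algebra_simps)
      also have "\<dots> \<le> (sqrt a - sqrt d) * (2 * sqrt a)" using sq by (intro mult_left_mono) auto
      finally have "(a - d) / sqrt a \<le> 2 * (sqrt a - sqrt d)" using sq by (simp add: pos_divide_le_eq mult_ac)
      then have "sqrt \<delta> * ((a - d) / sqrt a) \<le> sqrt \<delta> * (2 * (sqrt a - sqrt d))"
        using pos(1) by (intro mult_left_mono) auto
      then show ?thesis by (simp add: real_sqrt_divide algebra_simps)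
    qed
    ultimately show "Dq a * (a - d) \<le> Fq a - Fq d"
      unfolding Dq_def Fq_def by (simp add: distrib_right right_diff_distrib mult.assoc)
  next
    fix a :: real assume a: "0 \<le> a" "a < r"
    have "0 \<le> \<phi> (a / 2)" if "\<phi> \<in> \<Phi>" for \<phi>
    proof (cases "a = 0")
      case True
      then show ?thesis using \<Phi>(3)[OF that] by (auto simp: KL_family_def)
    qed (use halves(3)[OF that, of a 0] a in auto)
    then have "0 \<le> (\<Sum>\<phi>\<in>\<Phi>. 2 * \<phi> (a / 2))" by (intro sum_nonneg) simp
    then show "0 \<le> Fq a" using \<Phi>(2) pos(1) a by (simp add: Fq_def)
  next
    fix a :: real assume a: "0 < a" "a < r"
    have "0 \<le> deriv \<phi> (a / 2)" if "\<phi> \<in> \<Phi>" for \<phi>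
      using halves(1)[OF that a, of 0] a by simp
    then have "0 \<le> (\<Sum>\<phi>\<in>\<Phi>. deriv \<phi> (a / 2))" by (rule sum_nonneg)
    then show "0 \<le> Dq a" using \<Phi>(2) pos(1) a by (simp add: Dq_def)
  next
    have "(\<lambda>k. U (Suc k) - \<omega>) \<longlonglongrightarrow> \<omega> - \<omega>"
      by (rule tendsto_diff[OF LIMSEQ_Suc[OF D.U_tendsto] tendsto_const])
    then have "\<forall>\<^sub>F k in sequentially. U (Suc k) - \<omega> < r" using r0 by (intro order_tendstoD(2)) auto
    with ev show "\<forall>\<^sub>F k in sequentially. \<omega> < U (Suc k) \<longrightarrow> 1 \<le> Dq (U (Suc k) - \<omega>) * s k"
    proof eventually_elim
      case (elim k)
      show ?case
      proof
        assume less: "\<omega> < U (Suc k)"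
        define t where "t = U (Suc k) - \<omega>"
        have t: "0 < t" "t < r" using less elim by (simp_all add: t_def)
        have nn: "0 \<le> deriv \<phi> (t / 2)" if "\<phi> \<in> \<Phi>" for \<phi>
          using halves(1)[OF that t, of 0] t by simp
        then have "0 \<le> (\<Sum>\<phi>\<in>\<Phi>. deriv \<phi> (t / 2))" by (rule sum_nonneg)
        then have sums: "0 \<le> b * (\<Sum>\<phi>\<in>\<Phi>. deriv \<phi> (t / 2))" "0 \<le> sqrt (\<delta> / t)"
          using \<Phi>(2) pos(1) t by simp_all
        have "(\<exists>\<phi>\<in>\<Phi>. 1 \<le> deriv \<phi> (t / 2) * (b * s k)) \<or> 1 \<le> sqrt (\<delta> / t) * s k"
          unfolding t_def by (rule elim(1)[rule_format, OF less])
        then consider \<phi> where "\<phi> \<in> \<Phi>" "1 \<le> deriv \<phi> (t / 2) * (b * s k)"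
          | "1 \<le> sqrt (\<delta> / t) * s k" by blast
        then show "1 \<le> Dq (U (Suc k) - \<omega>) * s k"
          unfolding t_def[symmetric]
        proof cases
          case 1
          have "deriv \<phi> (t / 2) \<le> (\<Sum>\<phi>\<in>\<Phi>. deriv \<phi> (t / 2))"
            using 1 nn \<Phi>(1) by (intro member_le_sum) auto
          then have "deriv \<phi> (t / 2) * (b * s k) \<le> (\<Sum>\<phi>\<in>\<Phi>. deriv \<phi> (t / 2)) * (b * s k)"
            using \<Phi>(2) by (intro mult_right_mono) auto
          also have "\<dots> = (b * (\<Sum>\<phi>\<in>\<Phi>. deriv \<phi> (t / 2))) * s k" by (simp only: mult_ac)
          also have "\<dots> \<le> Dq t * s k"
            unfolding Dq_def using sums(2) by (intro mult_right_mono) simp_all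
          finally show "1 \<le> Dq t * s k" using 1 by simp
        next
          case 2
          have "sqrt (\<delta> / t) * s k \<le> Dq t * s k"
            using sums unfolding Dq_def by (intro mult_right_mono) auto
          then show "1 \<le> Dq t * s k" using 2 by simp
        qed
      qed
    qed
  qed (use r0 K1 in auto)
qed

text \<open>The derivative of \<open>c * t powr (1 - \<theta>)\<close> at \<open>t / 2\<close> is a
  multiple of \<open>t powr (- \<theta>)\<close>, and the sum of the finitely many constants bounds
  each of them.\<close>

lemma KL_exponent_along_sequence:
  assumes \<theta>: "1/2 \<le> \<theta>" "\<theta> < 1" and KL: "KL_function_exponent \<theta> \<Psi>"
  shows "\<exists>B>0. \<forall>\<^sub>F k in sequentially. \<omega> < U (Suc k) \<longrightarrow> (U (Suc k) - \<omega>) powr \<theta> \<le> B * s k"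
proof -
  define Q where "Q \<phi> \<longleftrightarrow> (\<exists>c>0. \<phi> = (\<lambda>t. c * t powr (1 - \<theta>)))" for \<phi> :: "real \<Rightarrow> real"
  have "\<exists>\<phi>. Q \<phi> \<and> KL_with \<Psi> p \<phi>" if p: "p \<in> dom_subdiff \<Psi>" for p
  proof -
    obtain c where c: "0 < c" "KL_with \<Psi> p (\<lambda>t. c * t powr (1 - \<theta>))"
      using bspec[OF KL[unfolded KL_function_exponent_def] p] by blast
    have "Q (\<lambda>t. c * t powr (1 - \<theta>))" unfolding Q_def using c(1) by (intro exI[of _ c] conjI refl)
    then show ?thesis using c(2) by blast
  qed
  from KL_along_sequence[of Q, OF this]
  obtain \<Phi> b where \<Phi>: "finite \<Phi>" "0 < b" "\<And>\<phi>. \<phi> \<in> \<Phi> \<Longrightarrow> Q \<phi>"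
    and ev: "\<forall>\<^sub>F k in sequentially. \<omega> < U (Suc k) \<longrightarrow>
      (\<exists>\<phi>\<in>\<Phi>. 1 \<le> deriv \<phi> ((U (Suc k) - \<omega>) / 2) * (b * s k)) \<or> 1 \<le> sqrt (\<delta> / (U (Suc k) - \<omega>)) * s k"
    by blast
  have "\<forall>\<phi>\<in>\<Phi>. \<exists>c>0. \<phi> = (\<lambda>t. c * t powr (1 - \<theta>))"
    using \<Phi>(3) unfolding Q_def by (rule ballI)
  from bchoice[OF this] obtain c
    where all: "\<forall>\<phi>\<in>\<Phi>. 0 < c \<phi> \<and> \<phi> = (\<lambda>t. c \<phi> * t powr (1 - \<theta>))" ..
  have c0: "0 < c \<phi>" and c: "(\<lambda>t. c \<phi> * t powr (1 - \<theta>)) = \<phi>" if "\<phi> \<in> \<Phi>" for \<phi>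
    using bspec[OF all that] by (rule conjunct1, rule sym[OF conjunct2])
  define B0 where "B0 = (\<Sum>\<phi>\<in>\<Phi>. c \<phi> * (1 - \<theta>) * 2 powr \<theta>)"
  have terms: "0 \<le> c \<phi> * (1 - \<theta>) * 2 powr \<theta>" if "\<phi> \<in> \<Phi>" for \<phi>
    using c0[OF that] \<theta> by simp
  have B0: "0 \<le> B0" unfolding B0_def using terms by (intro sum_nonneg)
  have deriv_le: "deriv \<phi> (t / 2) \<le> B0 * t powr (- \<theta>)" if \<phi>: "\<phi> \<in> \<Phi>" and t: "0 < t" for \<phi> t
  proof -
    have "((\<lambda>t. c \<phi> * t powr (1 - \<theta>)) has_real_derivative c \<phi> * ((1 - \<theta>) * (t / 2) powr (1 - \<theta> - 1))) (at (t / 2))"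
      using t by (intro DERIV_cmult has_real_derivative_powr) auto
    then have "(\<phi> has_real_derivative c \<phi> * ((1 - \<theta>) * (t / 2) powr (1 - \<theta> - 1))) (at (t / 2))"
      by (simp only: c[OF \<phi>])
    then have "deriv \<phi> (t / 2) = c \<phi> * ((1 - \<theta>) * (t / 2) powr (1 - \<theta> - 1))" by (rule DERIV_imp_deriv)
    also have "(t / 2) powr (1 - \<theta> - 1) = 2 powr \<theta> * t powr (- \<theta>)"
      using t by (simp add: powr_divide powr_minus field_simps)
    also have "c \<phi> * ((1 - \<theta>) * (2 powr \<theta> * t powr (- \<theta>))) = (c \<phi> * (1 - \<theta>) * 2 powr \<theta>) * t powr (- \<theta>)"
      by simp
    also have "\<dots> \<le> B0 * t powr (- \<theta>)"
      unfolding B0_def using \<phi> \<Phi>(1) terms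
      by (intro mult_right_mono member_le_sum[of _ _ "\<lambda>\<phi>. c \<phi> * (1 - \<theta>) * 2 powr \<theta>"]) auto
    finally show ?thesis .
  qed
  define B where "B = B0 * b + sqrt \<delta>"
  have B: "0 < B" using B0 \<Phi>(2) pos(1) by (simp add: B_def add_nonneg_pos)
  have "(\<lambda>k. U (Suc k) - \<omega>) \<longlonglongrightarrow> \<omega> - \<omega>"
    by (rule tendsto_diff[OF LIMSEQ_Suc[OF D.U_tendsto] tendsto_const])
  then have "\<forall>\<^sub>F k in sequentially. U (Suc k) - \<omega> < 1" by (intro order_tendstoD(2)) auto
  with ev have "\<forall>\<^sub>F k in sequentially. \<omega> < U (Suc k) \<longrightarrow> (U (Suc k) - \<omega>) powr \<theta> \<le> B * s k"
  proof eventually_elim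
    case (elim k)
    show ?case
    proof
      assume less: "\<omega> < U (Suc k)"
      define t where "t = U (Suc k) - \<omega>"
      have t: "0 < t" "t < 1" using less elim by (simp_all add: t_def)
      have "(\<exists>\<phi>\<in>\<Phi>. 1 \<le> deriv \<phi> (t / 2) * (b * s k)) \<or> 1 \<le> sqrt (\<delta> / t) * s k"
        unfolding t_def by (rule elim(1)[rule_format, OF less])
      then consider \<phi> where "\<phi> \<in> \<Phi>" "1 \<le> deriv \<phi> (t / 2) * (b * s k)"
        | "1 \<le> sqrt (\<delta> / t) * s k" by blast
      then show "(U (Suc k) - \<omega>) powr \<theta> \<le> B * s k"
        unfolding t_def[symmetric]
      proof cases
        case 1
        have "deriv \<phi> (t / 2) * (b * s k) \<le> B0 * t powr (- \<theta>) * (b * s k)"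
          using deriv_le[OF 1(1) t(1)] \<Phi>(2) by (intro mult_right_mono) auto
        then have "1 \<le> (B0 * b * s k) / t powr \<theta>" using 1(2) by (simp add: powr_minus_divide)
        then have "t powr \<theta> \<le> B0 * b * s k" using t by (simp add: pos_le_divide_eq)
        also have "\<dots> \<le> B * s k" using pos(1) unfolding B_def by (intro mult_right_mono) auto
        finally show "t powr \<theta> \<le> B * s k" .
      next
        case 2
        then have "sqrt t \<le> sqrt \<delta> * s k" using t by (simp add: real_sqrt_divide pos_le_divide_eq)
        \<comment> \<open>The penalty alone has exponent 1/2; this is where \<theta> at least 1/2,
          together with \<open>t < 1\<close>, makes it no worse than exponent \<theta>.\<close>
        moreover have "t powr \<theta> \<le> t powr (1/2)" using t \<theta> by (intro powr_mono') auto
        moreover have "t powr (1/2) = sqrt t" using t by (simp add: powr_half_sqrt)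
        moreover have "sqrt \<delta> * s k \<le> B * s k"
          using B0 \<Phi>(2) unfolding B_def by (intro mult_right_mono) auto
        ultimately show "t powr \<theta> \<le> B * s k" by linarith
      qed
    qed
  qed
  then show ?thesis using B by blast
qed

lemma limit_if_summable:
  assumes "summable s"
  obtains zt where "z \<longlonglongrightarrow> zt" "zt \<in> crit (Upsilon f g H \<delta>)"
    "\<And>k. norm (z k - zt) \<le> (\<Sum>j. s (k + j))"
proof -
  have "summable (\<lambda>k. z (Suc k) - z k)" using assms by (rule summable_norm_cancel)
  then have "convergent (\<lambda>n. \<Sum>k<n. z (Suc k) - z k)" by (simp add: summable_iff_convergent)
  then obtain d where "(\<lambda>n. z n - z 0) \<longlonglongrightarrow> d" by (auto simp: convergent_def sum_lessThan_telescope)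
  then have "(\<lambda>n. z n - z 0 + z 0) \<longlonglongrightarrow> d + z 0" by (intro tendsto_intros)
  then obtain zt where zt: "z \<longlonglongrightarrow> zt" by auto
  obtain u v u' v' where eq: "zt = (u, v, u', v')" by (cases zt) auto
  have xy: "x \<longlonglongrightarrow> u" "y \<longlonglongrightarrow> v" "(\<lambda>k. x (k - 1)) \<longlonglongrightarrow> u'" "(\<lambda>k. y (k - 1)) \<longlonglongrightarrow> v'"
    using tendsto_fst[OF zt] tendsto_fst[OF tendsto_snd[OF zt]]
      tendsto_fst[OF tendsto_snd[OF tendsto_snd[OF zt]]] tendsto_snd[OF tendsto_snd[OF tendsto_snd[OF zt]]]
    by (simp_all add: palm_z_def eq)
  \<comment> \<open>The last two blocks of \<open>z\<close> are delayed copies of the first two, so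
    the limit lies on the diagonal, where criticality is known.\<close>
  have "u' = u" "v' = v"
    using LIMSEQ_unique[OF xy(1)] LIMSEQ_unique[OF xy(2)] LIMSEQ_Suc[OF xy(3)] LIMSEQ_Suc[OF xy(4)] by simp_all
  then have "zt \<in> crit (Upsilon f g H \<delta>)"
    using cluster_critical(2)[of id u v] xy by (simp add: eq strict_mono_id)
  moreover have "norm (z k - zt) \<le> (\<Sum>j. s (k + j))" for k
  proof -
    have "(\<lambda>j. z (k + j)) \<longlonglongrightarrow> zt" using LIMSEQ_ignore_initial_segment[OF zt, of k] by (simp add: add.commute)
    then have "(\<lambda>j. z (k + Suc j) - z (k + j)) sums (zt - z (k + 0))" by (rule telescope_sums)
    moreover have "summable (\<lambda>j. s (k + j))"
      using summable_ignore_initial_segment[OF assms, of k] by (simp add: add.commute)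
    ultimately have "norm (zt - z k) \<le> (\<Sum>j. s (k + j))"
      using summable_norm[of "\<lambda>j. z (k + Suc j) - z (k + j)"] by (simp add: sums_iff)
    then show ?thesis by (simp add: norm_minus_commute)
  qed
  ultimately show thesis using that zt by blast
qed

end

theorem theorem5p3:
  fixes f :: "'a::euclidean_space \<Rightarrow> ereal"
    and g :: "'b::euclidean_space \<Rightarrow> ereal"
    and H :: "'a \<times> 'b \<Rightarrow> real"
    and L1 :: "'b \<Rightarrow> real" and L2 :: "'a \<Rightarrow> real"
    and L \<delta> \<alpha> \<tau>lo \<tau>hi \<beta>max \<eta> \<eta>1 \<eta>2 r1 r2 :: real
    and m :: nat
    and x :: "nat \<Rightarrow> 'a" and y :: "nat \<Rightarrow> 'b"
    and z :: "nat \<Rightarrow> 'a \<times> 'b \<times> 'a \<times> 'b"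
    and U :: "nat \<Rightarrow> real"
  assumes f: "proper f" "lsc f" "bounded_below f"
    and g: "proper g" "lsc g" "bounded_below g"
    and H: "smooth H"
    and L1: "\<And>y. (L1 y)-lipschitz_on UNIV (\<lambda>x. grad_x H x y)"
    and L2: "\<And>x. (L2 x)-lipschitz_on UNIV (\<lambda>y. grad_y H x y)"
    and Psi: "coercive (Psi f g H)" "bounded_below (Psi f g H)"
    and KL: "KL_function (Psi f g H)"
    and L_finite: "bdd_above ((\<lambda>(x, y). max (L1 y) (L2 x)) ` level_set0 f g H (x 0) (y 0))"
    and L_def: "L = (SUP (x, y)\<in>level_set0 f g H (x 0) (y 0). max (L1 y) (L2 x))"
    and alg: "PALMenls f g H L \<delta> \<alpha> \<tau>lo \<tau>hi \<beta>max \<eta> \<eta>1 \<eta>2 m x y"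
    and B1: "0 < r1" "\<And>k. (1 + 2 * \<beta>max) *\<^sub>R x k \<in> cball 0 r1"
    and B2: "0 < r2" "\<And>k. (1 + 2 * \<beta>max) *\<^sub>R y k \<in> cball 0 r2"
    and M_finite: "bdd_above {norm (grad_x H u v - grad_x H u' v') / norm ((u, v) - (u', v')) |u u' v v'.
        u \<in> cball 0 r1 \<and> u' \<in> cball 0 r1 \<and> u \<noteq> u' \<and> v \<in> cball 0 r2 \<and> v' \<in> cball 0 r2 \<and> v \<noteq> v'}"
    and L2_finite: "bdd_above (L2 ` cball 0 r1)"
    and z_def: "z = palm_z x y"
    and U_def: "U = (\<lambda>k. real_of_ereal (Upsilon f g H \<delta> (z k)))"
  shows
    "((Liminf (inf sequentially (principal (K1_set m \<alpha> U z))) (decrease_ratio m U z) = 0 \<longrightarrow>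
         (\<lambda>k. sqrt (U (ell m U (Suc k)) - U (Suc k))) summable_on K1_set m \<alpha> U z)
      \<longrightarrow> summable (\<lambda>k. norm (z (Suc k) - z k)))
   \<and>
     (\<forall>\<theta>. 1/2 \<le> \<theta> \<and> \<theta> < 1 \<and> KL_function_exponent \<theta> (Psi f g H) \<longrightarrow>
        convergent U \<and>
        ((\<exists>k0::nat. \<exists>\<gamma>>0. \<exists>\<tau>. 0 < \<tau> \<and> \<tau> < 1 \<and>
            (\<forall>k\<ge>k0.
               (\<lambda>j. sqrt (U (ell m U (Suc j)) - U (Suc j)))
                 summable_on {j \<in> K2_set m \<alpha> \<theta> U z \<union> K31_set m \<alpha> \<theta> (lim U) U z. k \<le> j} \<and>
               (\<Sum>\<^sub>\<infinity>j\<in>{j \<in> K2_set m \<alpha> \<theta> U z \<union> K31_set m \<alpha> \<theta> (lim U) U z. k \<le> j}.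
                   sqrt (U (ell m U (Suc j)) - U (Suc j)))
                 \<le> (if \<theta> = 1/2 then \<gamma> * \<tau> ^ k
                    else \<gamma> * real k powr ((1 - \<theta>) / (1 - 2 * \<theta>)))))
         \<longrightarrow>
         (\<exists>zt \<in> crit (Upsilon f g H \<delta>). z \<longlonglongrightarrow> zt \<and>
            summable (\<lambda>j. norm (z (Suc j) - z j)) \<and>
            (\<exists>kb::nat. \<exists>\<gamma>>0. \<exists>\<rho>. 0 < \<rho> \<and> \<rho> < 1 \<and>
               (\<forall>k\<ge>kb.
                  norm (z k - zt) \<le> (\<Sum>j. norm (z (Suc (k + j)) - z (k + j))) \<and>
                  (\<Sum>j. norm (z (Suc (k + j)) - z (k + j)))
                    \<le> (if \<theta> = 1/2 then \<gamma> * \<rho> ^ k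
                       else \<gamma> * real k powr ((1 - \<theta>) / (1 - 2 * \<theta>))))))))"
proof -
  have par: "0 < \<delta>" "0 < \<alpha>" "0 < \<tau>lo" "0 \<le> \<beta>max" "0 < \<eta>" "\<eta> < 1"
    and start: "(x 0, y 0) \<in> edom (Psi f g H)"
    and iter: "\<And>k. PALMenls_iteration f g H \<delta> \<alpha> \<tau>lo \<tau>hi \<beta>max \<eta> \<eta>1 \<eta>2 m x y k"
    using alg by (simp_all add: PALMenls_def)
  interpret P: palm f g H L2 \<delta> \<alpha> \<tau>lo \<beta>max r1 r2 m x y
  proof (unfold_locales; (rule f g H L2 par start B1 B2 M_finite L2_finite)?)
    fix k
    obtain \<beta>0 \<tau>10 \<tau>20 l X Y where *: "\<beta>0 \<in> {0..\<beta>max}" and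
      trial: "palm_trial f g H x y k (\<beta>0 * \<eta> ^ l) (max (\<tau>10 * \<eta>1 ^ l) \<tau>lo)
        (max (\<tau>20 * \<eta>2 ^ l) \<tau>lo) (X l) (Y l)" and
      acc: "palm_accept f g H \<delta> \<alpha> m x y k (X l) (Y l)" and
      new: "x (Suc k) = X l" "y (Suc k) = Y l"
      using iter[of k] unfolding PALMenls_iteration_def by blast
    \<comment> \<open>Backtracking only shrinks the extrapolation parameter, while the
      \<open>max\<close> keeps the step sizes above \<open>\<tau>lo\<close>.\<close>
    have "\<beta>0 * \<eta> ^ l \<le> \<beta>0 * 1" using * par by (intro mult_left_mono power_le_one) auto
    then show "\<exists>\<beta> \<tau>1 \<tau>2. 0 \<le> \<beta> \<and> \<beta> \<le> \<beta>max \<and> \<tau>lo \<le> \<tau>1 \<and> \<tau>lo \<le> \<tau>2 \<and>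
        palm_trial f g H x y k \<beta> \<tau>1 \<tau>2 (x (Suc k)) (y (Suc k))"
      using trial * par new
      by (intro exI[of _ "\<beta>0 * \<eta> ^ l"] exI[of _ "max (\<tau>10 * \<eta>1 ^ l) \<tau>lo"]
          exI[of _ "max (\<tau>20 * \<eta>2 ^ l) \<tau>lo"]) auto
    show "palm_accept f g H \<delta> \<alpha> m x y k (x (Suc k)) (y (Suc k))" using acc new by simp
  qed
  have U: "U = P.U" by (simp add: U_def z_def P.Upsilon_eq)
  have lim: "lim P.U = P.D.\<omega>" by (rule P.D.lim_U)
  have conv: "convergent P.U" using P.D.U_tendsto by (rule convergentI)
  have rate_eq: "(if \<theta> = 1/2 then \<gamma> * \<rho> ^ k else \<gamma> * real k powr ((1 - \<theta>) / (1 - 2 * \<theta>)))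
      = \<gamma> * kl_rate \<theta> \<rho> k" for \<theta> \<gamma> \<rho> k
    by (simp add: kl_rate_def)
  have part2: "\<exists>zt \<in> crit (Upsilon f g H \<delta>). palm_z x y \<longlonglongrightarrow> zt \<and> summable P.D.s \<and>
      (\<exists>kb::nat. \<exists>\<gamma>>0. \<exists>\<rho>. 0 < \<rho> \<and> \<rho> < 1 \<and> (\<forall>k\<ge>kb.
        norm (palm_z x y k - zt) \<le> (\<Sum>j. P.D.s (k + j)) \<and> (\<Sum>j. P.D.s (k + j)) \<le> \<gamma> * kl_rate \<theta> \<rho> k))"
    if \<theta>: "1/2 \<le> \<theta>" "\<theta> < 1" and KL\<theta>: "KL_function_exponent \<theta> (Psi f g H)"
      and K: "K = K2_set m \<alpha> \<theta> P.U (palm_z x y) \<union> K31_set m \<alpha> \<theta> P.D.\<omega> P.U (palm_z x y)"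
      and h: "h = (\<lambda>j. sqrt (P.U (ell m P.U (Suc j)) - P.U (Suc j)))"
      and tail: "0 < \<gamma>" "0 < \<tau>" "\<tau> < 1" "\<And>k. k \<ge> k0 \<Longrightarrow>
        h summable_on {j \<in> K. k \<le> j} \<and> infsum h {j \<in> K. k \<le> j} \<le> \<gamma> * kl_rate \<theta> \<tau> k"
    for \<theta> \<gamma> \<tau> :: real and k0 :: nat and K h
  proof -
    obtain B where "0 < B" "\<forall>\<^sub>F k in sequentially. P.D.\<omega> < P.U (Suc k) \<longrightarrow>
        (P.U (Suc k) - P.D.\<omega>) powr \<theta> \<le> B * P.D.s k"
      using P.KL_exponent_along_sequence[OF \<theta> KL\<theta>] by blast
    then have sums: "summable P.D.s" and rate: "\<exists>\<gamma>>0. \<exists>\<rho>. 0 < \<rho> \<and> \<rho> < 1 \<and>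
        (\<forall>\<^sub>F k in sequentially. (\<Sum>j. P.D.s (k + j)) \<le> \<gamma> * kl_rate \<theta> \<rho> k)"
      using P.D.step_sums_rate_if_KL[OF \<theta> _ _ K h tail(4,1,2,3)] by blast+
    obtain zt where "palm_z x y \<longlonglongrightarrow> zt" "zt \<in> crit (Upsilon f g H \<delta>)"
      "\<And>k. norm (palm_z x y k - zt) \<le> (\<Sum>j. P.D.s (k + j))"
      using P.limit_if_summable[OF sums] by blast
    then show ?thesis using sums rate unfolding eventually_sequentially by blast
  qed
  show ?thesis
    unfolding U z_def lim rate_eq
  proof (intro conjI impI allI)
    assume "Liminf (inf sequentially (principal (K1_set m \<alpha> P.U (palm_z x y)))) (decrease_ratio m P.U (palm_z x y)) = 0 \<longrightarrow>
      (\<lambda>k. sqrt (P.U (ell m P.U (Suc k)) - P.U (Suc k))) summable_on K1_set m \<alpha> P.U (palm_z x y)"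
    then show "summable P.D.s" by (rule P.summable_steps[OF KL])
  next
    fix \<theta> :: real
    assume "1/2 \<le> \<theta> \<and> \<theta> < 1 \<and> KL_function_exponent \<theta> (Psi f g H)"
    then have \<theta>: "1/2 \<le> \<theta>" "\<theta> < 1" "KL_function_exponent \<theta> (Psi f g H)" by simp_all
    show "convergent P.U" by (rule conv)
    let ?K = "K2_set m \<alpha> \<theta> P.U (palm_z x y) \<union> K31_set m \<alpha> \<theta> P.D.\<omega> P.U (palm_z x y)"
    let ?h = "\<lambda>j. sqrt (P.U (ell m P.U (Suc j)) - P.U (Suc j))"
    assume "\<exists>k0::nat. \<exists>\<gamma>>0. \<exists>\<tau>. 0 < \<tau> \<and> \<tau> < 1 \<and> (\<forall>k\<ge>k0.
        ?h summable_on {j \<in> ?K. k \<le> j} \<and> infsum ?h {j \<in> ?K. k \<le> j} \<le> \<gamma> * kl_rate \<theta> \<tau> k)"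
    then obtain k0 :: nat and \<gamma> \<tau> where *: "0 < \<gamma>" "0 < \<tau>" "\<tau> < 1" and
      tail: "\<forall>k\<ge>k0. ?h summable_on {j \<in> ?K. k \<le> j} \<and> infsum ?h {j \<in> ?K. k \<le> j} \<le> \<gamma> * kl_rate \<theta> \<tau> k"
      by (elim exE conjE)
    from part2[OF \<theta> refl refl * tail[rule_format]]
    show "\<exists>zt \<in> crit (Upsilon f g H \<delta>). palm_z x y \<longlonglongrightarrow> zt \<and> summable P.D.s \<and>
      (\<exists>kb::nat. \<exists>\<gamma>>0. \<exists>\<rho>. 0 < \<rho> \<and> \<rho> < 1 \<and> (\<forall>k\<ge>kb.
        norm (palm_z x y k - zt) \<le> (\<Sum>j. P.D.s (k + j)) \<and> (\<Sum>j. P.D.s (k + j)) \<le> \<gamma> * kl_rate \<theta> \<rho> k))" .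
  qed
qed

end
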